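(* Let $X\subset\mathbb{C}P^n$ be a (non-empty) algebraic submanifold with $\dim_{\mathbb C}X=k$, where $\mathbb{C}P^n$ is considered with its standard Fubini--Study metric. Then for every $t>0$ $$\mathrm{vol}(X+t)\ \ge\ \mathrm{vol}(\mathbb{C}P^k+t),$$ where $\mathbb{C}P^k\subset\mathbb{C}P^n$ is standardly embedded.
   Context: An algebraic submanifold is a smooth closed complex submanifold of $\mathbb{C}P^n$ that is the zero set of homogeneous polynomials. The Fubini--Study metric is normalized so that the Hopf map $\mathbb S^{2n+1}\to\mathbb{C}P^n$ from the unit sphere is a Riemannian submersion; $\mathrm{vol}$ is the corresponding $2n$-dimensional Riemannian volume. For $Y\subset\mathbb{C}P^n$, $Y+t$ denotes the $t$-neighborhood of $Y$ in the Riemannian distance (points at distance at most $t$ from $Y$). The standardly embedded $\mathbb{C}P^k$ is the projectivization of a $(k+1)$-dimensional complex linear subspace of $\mathbb C^{n+1}$. *)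

theory Defs
  imports "HOL-Analysis.Analysis"
begin

section \<open>Complex projective space\<close>

text \<open>
  A type \<open>'n\<close> with \<open>CARD('n) = n + 1\<close> indexes the homogeneous coordinates, so \<open>'n cproj\<close> is
  the complex projective space of complex dimension \<open>n = CARD('n) - 1\<close>.
\<close>

typedef (overloaded) 'n::finite cproj =
  "{l :: (complex ^ 'n) set. vec.subspace l \<and> vec.dim l = 1}"
  morphisms line_of cproj_of_line
proof -
  have "vec.dim (vec.span {axis undefined 1 :: complex ^ 'n}) = 1"
    by (subst vec.dim_span_eq_card_independent) (auto simp: axis_eq_0_iff)
  then show ?thesis
    by (intro exI[of _ "vec.span {axis undefined 1}"]) (auto simp: vec.subspace_span)
qed

text \<open>The canonical projection; only used at nonzero vectors.\<close>

definition proj :: "complex ^ 'n \<Rightarrow> 'n::finite cproj" where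
  "proj z = cproj_of_line (vec.span {z})"

definition projectivization :: "(complex ^ 'n) set \<Rightarrow> 'n::finite cproj set" where
  "projectivization L = {p. line_of p \<subseteq> L}"

text \<open>The quotient topology.\<close>

instantiation cproj :: (finite) topological_space
begin

definition open_cproj :: "'a cproj set \<Rightarrow> bool" where
  "open_cproj U \<longleftrightarrow> open {z. z \<noteq> 0 \<and> proj z \<in> U}"

instance
proof
  have "{z :: complex ^ 'a. z \<noteq> 0 \<and> proj z \<in> UNIV} = - {0}"
    by auto
  then show "open (UNIV :: 'a cproj set)"
    by (simp add: open_cproj_def open_Compl)
next
  fix S T :: "'a cproj set"
  assume "open S" "open T"
  moreover have "{z. z \<noteq> 0 \<and> proj z \<in> S \<inter> T} =
      {z. z \<noteq> 0 \<and> proj z \<in> S} \<inter> {z. z \<noteq> 0 \<and> proj z \<in> T}"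
    by auto
  ultimately show "open (S \<inter> T)"
    by (simp add: open_cproj_def open_Int)
next
  fix K :: "'a cproj set set"
  assume "\<forall>S\<in>K. open S"
  moreover have "{z. z \<noteq> 0 \<and> proj z \<in> \<Union>K} = (\<Union>S\<in>K. {z. z \<noteq> 0 \<and> proj z \<in> S})"
    by auto
  ultimately show "open (\<Union>K)"
    by (auto simp: open_cproj_def intro!: open_UN)
qed

end


section \<open>Algebraic submanifolds\<close>

text \<open>
  Since \<open>proj\<close> is a holomorphic submersion on the nonzero vectors, a function on projective space
  is holomorphic iff its pullback along \<open>proj\<close> is, i.e. iff the pullback is complex differentiable
  at every nonzero vector over the given open set.
\<close>

definition holomorphic_cproj :: "('n::finite cproj \<Rightarrow> complex) \<Rightarrow> 'n cproj set \<Rightarrow> bool" where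
  "holomorphic_cproj f U \<longleftrightarrow>
     (\<forall>z. z \<noteq> 0 \<and> proj z \<in> U \<longrightarrow>
        (\<exists>D. ((\<lambda>y. f (proj y)) has_derivative D) (at z) \<and> Vector_Spaces.linear (*s) (*) D))"

text \<open>
  A complex submanifold of (pure) dimension \<open>k\<close> is locally the common zero set of \<open>n - k\<close>
  holomorphic functions whose Jacobian has full rank \<open>n - k\<close>.  The rank is read off from the
  differentials of the pullbacks along the submersion \<open>proj\<close>.
\<close>

definition complex_submanifold :: "nat \<Rightarrow> 'n::finite cproj set \<Rightarrow> bool" where
  "complex_submanifold k X \<longleftrightarrow>
     (\<exists>m. k + m + 1 = CARD('n) \<and>
       (\<forall>p\<in>X. \<exists>U f. open U \<and> p \<in> U \<and>
          (\<forall>j<m. holomorphic_cproj (f j) U) \<and>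
          X \<inter> U = {q \<in> U. \<forall>j<m. f j q = 0} \<and>
          (\<forall>z. z \<noteq> 0 \<and> proj z \<in> X \<inter> U \<longrightarrow>
             (\<forall>a :: nat \<Rightarrow> complex.
                (\<forall>v. (\<Sum>j<m. a j * frechet_derivative (\<lambda>y. f j (proj y)) (at z) v) = 0) \<longrightarrow>
                (\<forall>j<m. a j = 0)))))"

definition homogeneous_polynomial :: "nat \<Rightarrow> (complex ^ 'n::finite \<Rightarrow> complex) \<Rightarrow> bool" where
  "homogeneous_polynomial d F \<longleftrightarrow>
     (\<exists>c :: ('n \<Rightarrow> nat) \<Rightarrow> complex.
        \<forall>z. F z = (\<Sum>\<alpha> | (\<Sum>i\<in>UNIV. \<alpha> i) = d. c \<alpha> * (\<Prod>i\<in>UNIV. (z $ i) ^ \<alpha> i)))"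

definition algebraic_submanifold :: "nat \<Rightarrow> 'n::finite cproj set \<Rightarrow> bool" where
  "algebraic_submanifold k X \<longleftrightarrow>
     closed X \<and> complex_submanifold k X \<and>
     (\<exists>P. (\<forall>F\<in>P. \<exists>d. homogeneous_polynomial d F) \<and>
          X = {p. \<forall>F\<in>P. \<forall>z\<in>line_of p. F z = 0})"


section \<open>The Fubini--Study metric\<close>

definition hermitian :: "complex ^ 'n \<Rightarrow> complex ^ 'n::finite \<Rightarrow> complex" where
  "hermitian v w = (\<Sum>i\<in>UNIV. v $ i * cnj (w $ i))"

text \<open>The component of \<open>v\<close> that is Hermitian orthogonal to \<open>z\<close>.\<close>

definition horizontal :: "complex ^ 'n \<Rightarrow> complex ^ 'n \<Rightarrow> complex ^ 'n::finite" where
  "horizontal z v = v - (hermitian v z / hermitian z z) *s z"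

text \<open>
  The inner product of the images of \<open>v\<close> and \<open>w\<close> under the differential of \<open>proj\<close> at \<open>z \<noteq> 0\<close>.
  For \<open>norm z = 1\<close> and \<open>v\<close>, \<open>w\<close> tangent to the unit sphere, \<open>horizontal\<close> removes exactly the
  component along the Hopf fibre, so the Hopf map is a Riemannian submersion.  For general \<open>z\<close> the
  factor comes from the radial retraction onto the sphere, whose differential is
  \<open>1 / norm z\<close> times the identity on horizontal vectors.
\<close>

definition fs_metric :: "complex ^ 'n \<Rightarrow> complex ^ 'n \<Rightarrow> complex ^ 'n::finite \<Rightarrow> real" where
  "fs_metric z v w = (horizontal z v \<bullet> horizontal z w) / (norm z)\<^sup>2"

text \<open>
  The Riemannian distance: the infimum of the lengths of piecewise \<open>C\<^sup>1\<close> curves.  A curve in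
  projective space is given by a lift \<open>c\<close> to the nonzero vectors; every piecewise \<open>C\<^sup>1\<close> curve has
  such a lift.  The library's notion allows an unbounded derivative near the break points, so
  \<open>has_integral\<close> is needed to exclude curves of infinite length.
\<close>

definition fs_dist :: "'n::finite cproj \<Rightarrow> 'n cproj \<Rightarrow> real" where
  "fs_dist p q = Inf {l. \<exists>c :: real \<Rightarrow> complex ^ 'n.
     c piecewise_C1_differentiable_on {0..1} \<and> (\<forall>s\<in>{0..1}. c s \<noteq> 0) \<and>
     proj (c 0) = p \<and> proj (c 1) = q \<and>
     ((\<lambda>s. let v = vector_derivative c (at s) in sqrt (fs_metric (c s) v v)) has_integral l) {0..1}}"

definition fs_neighborhood :: "'n::finite cproj set \<Rightarrow> real \<Rightarrow> 'n cproj set" where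
  "fs_neighborhood Y t = {q. Y \<noteq> {} \<and> (INF p\<in>Y. fs_dist q p) \<le> t}"


section \<open>The Riemannian volume\<close>

text \<open>
  The determinant of a matrix indexed by a finite set \<open>S\<close> (the Leibniz formula, as for \<open>det\<close>).
\<close>

definition det_on :: "'a set \<Rightarrow> ('a \<Rightarrow> 'a \<Rightarrow> real) \<Rightarrow> real" where
  "det_on S A = (\<Sum>\<pi> | \<pi> permutes S. of_int (sign \<pi>) * (\<Prod>a\<in>S. A a (\<pi> a)))"

text \<open>
  The \<open>i\<close>-th affine chart has as coordinates the \<open>n\<close> complex numbers \<open>w j\<close> with \<open>j \<noteq> i\<close>, the
  \<open>i\<close>-th homogeneous coordinate being \<open>1\<close>.  The corresponding \<open>2 n\<close> real coordinates are indexed by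
  \<open>(j, b)\<close>, where \<open>b\<close> distinguishes the imaginary from the real part of \<open>w j\<close>.
\<close>

definition chart_lift :: "'n \<Rightarrow> ('n \<Rightarrow> complex) \<Rightarrow> complex ^ 'n::finite" where
  "chart_lift i w = (\<chi> j. if j = i then 1 else w j)"

definition coord_vector :: "'n \<times> bool \<Rightarrow> complex ^ 'n::finite" where
  "coord_vector = (\<lambda>(j, b). axis j (if b then \<i> else 1))"

definition fs_density :: "'n::finite \<Rightarrow> ('n \<Rightarrow> complex) \<Rightarrow> real" where
  "fs_density i w = sqrt (det_on ((- {i}) \<times> UNIV)
     (\<lambda>a b. fs_metric (chart_lift i w) (coord_vector a) (coord_vector b)))"

text \<open>
  The Riemannian volume of a Borel set, obtained from the atlas of affine charts and the partition
  of unity \<open>[z] \<mapsto> (cmod (z $ i) / norm z)\<^sup>2\<close>.  The measure \<open>\<Pi>\<^sub>M j\<in>-{i}. lborel\<close> is Lebesgue measure on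
  the \<open>2 n\<close> real chart coordinates.
\<close>

definition fs_volume :: "'n::finite cproj set \<Rightarrow> ennreal" where
  "fs_volume A = (\<Sum>i\<in>UNIV. \<integral>\<^sup>+ w.
     indicator A (proj (chart_lift i w)) *
     ennreal ((cmod (chart_lift i w $ i) / norm (chart_lift i w))\<^sup>2 * fs_density i w)
     \<partial>(\<Pi>\<^sub>M j\<in>-{i}. (lborel :: complex measure)))"

end

theory Submission
  imports Defs "HOL-Complex_Analysis.Complex_Analysis" "HOL-Real_Asymp.Real_Asymp"
begin

text \<open>
  The proof is a volume comparison in the style of Heintze and Karcher, carried out for cones in
  \<open>\<complex>\<^sup>n\<^sup>+\<^sup>1\<close> rather than on projective space.  Let \<open>C\<close> be the cone over \<open>X\<close>.  The distance of two points
  of projective space is the angle between the lines (\<open>geodesic_length\<close>, \<open>curve_lengths_ge\<close>), so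
  for \<open>t < pi / 2\<close> the point \<open>proj z\<close> lies within \<open>t\<close> of \<open>X\<close> iff \<open>infdist z C \<le> sin t * norm z\<close>.  Split
  \<open>z = x + v\<close> with \<open>x\<close> a nearest point of \<open>C\<close>.  As \<open>C\<close> is a cone, \<open>v\<close> is orthogonal to \<open>x\<close>, and the condition
  says that the slope \<open>norm v / norm x\<close> is at most \<open>tan t\<close>.

  For \<open>0 < l < 1\<close> consider the contraction \<open>x + v \<mapsto> x + l *\<^sub>R v\<close>.  Its inverse has the eigenvalue
  \<open>1 / l\<close> on vectors normal to \<open>C\<close> at \<open>x\<close>, and \<open>(1 - \<mu>) / (1 - l * \<mu>)\<close> on tangent vectors, where \<open>\<mu>\<close> runs
  through the eigenvalues of the second fundamental form of \<open>C\<close> in direction \<open>v\<close>.  That \<open>x\<close> is nearest to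
  \<open>x + v\<close> forces \<open>\<mu> \<le> 1\<close>.  That \<open>C\<close> is complex forces the sum of the \<open>\<mu>\<close> to vanish, because the second
  fundamental form changes its sign when both arguments are multiplied by \<open>\<i>\<close>.  Hence the product of
  the tangential eigenvalues is at most 1, and the inverse contraction expands volumes at most by
  \<open>(1 / l) ^ d\<close>, where \<open>d\<close> is the real codimension (\<open>contraction_volume_bound\<close>).  For a linear subspace
  all \<open>\<mu>\<close> are 0 and the expansion is exactly \<open>(1 / l) ^ d\<close>.

  Measured by the logarithm \<open>\<theta>\<close> of the slope, the volume of \<open>{z. norm x \<le> 1}\<close> therefore has a
  density with respect to \<open>exp (d * \<theta>)\<close> that decreases for \<open>C\<close> and is constant for a linear subspace
  (\<open>shell_shift_le\<close>, \<open>subspace_shell_shift_ge\<close>).  Integration over complex lines turns Fubini--Study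
  volumes into integrals against this measure, with the weight \<open>1 / (1 + exp \<theta> ^ 2) ^ (n + 1)\<close> that is
  the same for all cones (\<open>fs_volume_cone_formula\<close>), and the total is always the volume of the unit
  ball.  Of two densities with the same total, the decreasing one has the larger mass below any
  threshold, here \<open>ln (tan t)\<close> (\<open>shift_increasing_comparison\<close>, \<open>mass_comparison\<close>).

  The differentiability of the nearest point map rests on the second-order shape of \<open>C\<close> alone, which is
  recorded as \<open>quadratic_contact\<close>.  For the zero set of holomorphic functions with independent
  differentials it is obtained from the Cauchy estimates on complex lines and Brouwer's fixed point
  theorem (\<open>complex_differentiable_second_order\<close>, \<open>zero_set_quadratic_contact\<close>).
\<close>

section \<open>Orthonormal bases and symmetric forms\<close>

definition onb :: "'a::euclidean_space set \<Rightarrow> 'a set \<Rightarrow> bool" where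
  "onb B W \<longleftrightarrow> pairwise orthogonal B \<and> (\<forall>b\<in>B. norm b = 1) \<and> span B = W"

lemma onb_exists:
  assumes "subspace W"
  obtains B where "onb B W"
  using orthonormal_basis_subspace[OF assms] unfolding onb_def by metis

lemma onb_independent: "onb B W \<Longrightarrow> independent B"
  unfolding onb_def by (intro pairwise_orthogonal_independent) auto

lemma onb_finite: "onb B W \<Longrightarrow> finite B"
  using onb_independent independent_imp_finite by blast

lemma onb_subset: "onb B W \<Longrightarrow> b \<in> B \<Longrightarrow> b \<in> W"
  unfolding onb_def using span_base by blast

lemma onb_card: "onb B W \<Longrightarrow> card B = dim W"
  using onb_independent[of B W] dim_span_eq_card_independent[of B] unfolding onb_def by metis

lemma onb_inner: "onb B W \<Longrightarrow> b \<in> B \<Longrightarrow> c \<in> B \<Longrightarrow> b \<bullet> c = (if b = c then 1 else 0)"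
  unfolding onb_def pairwise_def orthogonal_def by (auto simp: norm_eq_1)

lemma onb_expand: "onb B W \<Longrightarrow> x \<in> W \<Longrightarrow> (\<Sum>b\<in>B. (x \<bullet> b) *\<^sub>R b) = x"
  using orthonormal_basis_expand[of B x] onb_finite[of B W] unfolding onb_def by metis

lemma onb_parseval:
  assumes B: "onb B W" and x: "x \<in> W"
  shows "(\<Sum>b\<in>B. (x \<bullet> b)\<^sup>2) = (norm x)\<^sup>2"
proof -
  have "x \<bullet> x = x \<bullet> (\<Sum>b\<in>B. (x \<bullet> b) *\<^sub>R b)"
    using onb_expand[OF B x] by simp
  then show ?thesis
    unfolding inner_sum_right inner_scaleR_right power2_eq_square[symmetric] power2_norm_eq_inner by simp
qed

lemma onb_union:
  assumes B: "onb B W" and W: "subspace W" and C: "onb C (W\<^sup>\<bottom>)"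
  shows "onb (B \<union> C) UNIV" "B \<inter> C = {}"
proof -
  have orth: "orthogonal b c" if "b \<in> B" "c \<in> C" for b c
    using onb_subset[OF B that(1)] onb_subset[OF C that(2)]
    by (auto simp: orthogonal_comp_def orthogonal_commute)
  have "x \<in> span (B \<union> C)" for x
  proof -
    obtain y z where "y \<in> span W" and z: "\<And>w. w \<in> span W \<Longrightarrow> orthogonal z w" and "x = y + z"
      using orthogonal_subspace_decomp_exists[of W x] by blast
    then have "y \<in> span B" "z \<in> span C"
      using B C W by (auto simp: onb_def orthogonal_comp_def span_base span_span orthogonal_commute)
    then have "y \<in> span (B \<union> C)" "z \<in> span (B \<union> C)"
      using span_mono[of B "B \<union> C"] span_mono[of C "B \<union> C"] by auto
    then show ?thesis
      unfolding \<open>x = y + z\<close> by (rule span_add)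
  qed
  moreover have "pairwise orthogonal (B \<union> C)"
    using B C orth unfolding onb_def pairwise_def by (metis Un_iff orthogonal_commute)
  ultimately show "onb (B \<union> C) UNIV"
    using B C unfolding onb_def by auto
  show "B \<inter> C = {}"
  proof (rule ccontr)
    assume "B \<inter> C \<noteq> {}"
    then obtain b where "b \<in> B" "b \<in> C" by auto
    then show False
      using orth[of b b] B unfolding onb_def orthogonal_def by (auto simp: norm_eq_1)
  qed
qed

text \<open>
  Near \<open>t = 0\<close> the linear term dominates, and it has both signs; this is how first variations vanish.
\<close>

lemma zero_of_quadratic_bound:
  fixes a c :: real
  assumes "\<And>t. 2 * t * a \<le> t\<^sup>2 * c"
  shows "a = 0"
proof (rule ccontr)
  assume "a \<noteq> 0"
  define d where "d = \<bar>c\<bar> + 1"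
  have d: "d > 0" "c < d" by (auto simp: d_def)
  have "2 * (a / d) * a * d\<^sup>2 \<le> (a / d)\<^sup>2 * c * d\<^sup>2"
    by (intro mult_right_mono assms) auto
  then have "2 * a\<^sup>2 * d \<le> a\<^sup>2 * c"
    using d by (simp add: power2_eq_square field_simps)
  moreover have "a\<^sup>2 * c < a\<^sup>2 * d" "0 < a\<^sup>2 * d"
    using d \<open>a \<noteq> 0\<close> by (auto intro!: mult_strict_left_mono)
  ultimately show False by linarith
qed

text \<open>
  The spectral theorem for a symmetric form on a subspace, by induction on the dimension: split off
  a maximiser of the form on the unit sphere.
\<close>

lemma diagonalizing_basis_exists:
  fixes s :: "'a::euclidean_space \<Rightarrow> 'a \<Rightarrow> real"
  assumes s: "bilinear s" and sym: "\<And>x y. s x y = s y x"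
    and W: "subspace W"
  shows "\<exists>B. onb B W \<and> (\<forall>b\<in>B. \<forall>c\<in>B. b \<noteq> c \<longrightarrow> s b c = 0)"
  using W
proof (induction "dim W" arbitrary: W rule: less_induct)
  case less
  show ?case
  proof (cases "W = {0}")
    case True
    then show ?thesis
      by (intro exI[of _ "{}"]) (auto simp: onb_def)
  next
    case False
    let ?S = "{w \<in> W. norm w = 1}"
    have "?S = W \<inter> sphere 0 1"
      by auto
    then have cS: "compact ?S"
      using closed_subspace[OF less.prems] by (metis closed_Int_compact compact_sphere)
    obtain w where w: "w \<in> W" "w \<noteq> 0"
      using False subspace_0[OF less.prems] by blast
    have neS: "?S \<noteq> {}"
      using w subspace_scale[OF less.prems, of w "1 / norm w"] by force
    have "continuous_on ?S (\<lambda>w. s w w)"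
      by (rule bilinear_continuous_on_compose[OF continuous_on_id continuous_on_id s])
    from continuous_attains_sup[OF cS neS this] obtain b
      where b: "b \<in> W" "norm b = 1" and max: "\<And>w. w \<in> W \<Longrightarrow> norm w = 1 \<Longrightarrow> s w w \<le> s b b"
      by auto
    have scl: "s (c *\<^sub>R x) (d *\<^sub>R y) = c * d * s x y" for c d x y
      using s by (simp add: bilinear_lmul bilinear_rmul)
    have max': "s w w \<le> s b b * (w \<bullet> w)" if "w \<in> W" for w
    proof (cases "w = 0")
      case True
      then show ?thesis using bilinear_lzero[OF s] by simp
    next
      case False
      have "s ((1 / norm w) *\<^sub>R w) ((1 / norm w) *\<^sub>R w) \<le> s b b"
        using that False by (intro max subspace_scale[OF less.prems]) auto
      then show ?thesis
        unfolding scl using False by (simp add: field_simps dot_square_norm power2_eq_square)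
    qed
    define W' where "W' = {u \<in> W. b \<bullet> u = 0}"
    have W': "subspace W'"
      using less.prems unfolding W'_def subspace_def by (auto simp: inner_add_right)
    have "b \<notin> W'"
      using b by (auto simp: W'_def norm_eq_1)
    moreover have "W' \<subseteq> W"
      by (auto simp: W'_def)
    ultimately have "W' \<subset> W"
      using b by blast
    then have dim: "dim W' < dim W"
      using W' less.prems by (metis dim_psubset span_eq_iff)
    from less.hyps[OF dim W'] obtain B' where B': "onb B' W'"
      and diag: "\<And>b c. b \<in> B' \<Longrightarrow> c \<in> B' \<Longrightarrow> b \<noteq> c \<Longrightarrow> s b c = 0"
      by blast
    \<comment> \<open>First variation at the maximiser: b is s-orthogonal to its Euclidean orthogonal complement.\<close>
    have sb: "s b u = 0" if u: "u \<in> W'" for u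
    proof (rule zero_of_quadratic_bound)
      fix t :: real
      have bu: "b \<bullet> u = 0" "u \<in> W" using u by (auto simp: W'_def)
      have "s (b + t *\<^sub>R u) (b + t *\<^sub>R u) \<le> s b b * ((b + t *\<^sub>R u) \<bullet> (b + t *\<^sub>R u))"
        using b bu by (intro max' subspace_add[OF less.prems] subspace_scale[OF less.prems]) auto
      moreover have "s (b + t *\<^sub>R u) (b + t *\<^sub>R u) = s b b + 2 * t * s b u + t\<^sup>2 * s u u"
        using s sym[of u b]
        by (simp add: bilinear_ladd bilinear_radd bilinear_lmul bilinear_rmul algebra_simps power2_eq_square)
      moreover have "(b + t *\<^sub>R u) \<bullet> (b + t *\<^sub>R u) = 1 + t\<^sup>2 * (u \<bullet> u)"
        using bu b by (simp add: inner_add_left inner_add_right inner_commute[of u b] norm_eq_1 power2_eq_square)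
      ultimately have "s b b + 2 * t * s b u + t\<^sup>2 * s u u \<le> s b b * (1 + t\<^sup>2 * (u \<bullet> u))"
        by metis
      then show "2 * t * s b u \<le> t\<^sup>2 * (s b b * (u \<bullet> u) - s u u)"
        by (simp add: algebra_simps)
    qed
    have "x \<in> span (insert b B')" if "x \<in> W" for x
    proof -
      have "x - (x \<bullet> b) *\<^sub>R b \<in> W'"
        using that b less.prems unfolding W'_def
        by (auto intro!: subspace_diff subspace_scale simp: inner_diff_right norm_eq_1 inner_commute[of b x])
      then have "x - (x \<bullet> b) *\<^sub>R b \<in> span B'"
        using B' by (simp add: onb_def)
      then show ?thesis
        unfolding span_insert by blast
    qed
    moreover have "span (insert b B') \<subseteq> W"
      using b onb_subset[OF B'] by (intro span_minimal less.prems) (auto simp: W'_def)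
    ultimately have "span (insert b B') = W" by auto
    moreover have "pairwise orthogonal (insert b B')"
      using B' onb_subset[OF B'] unfolding onb_def W'_def
      by (auto simp: pairwise_insert orthogonal_def inner_commute)
    ultimately have "onb (insert b B') W"
      using B' b unfolding onb_def by auto
    moreover have "\<forall>x\<in>insert b B'. \<forall>y\<in>insert b B'. x \<noteq> y \<longrightarrow> s x y = 0"
      using diag sb onb_subset[OF B'] sym by (metis insert_iff)
    ultimately show ?thesis by blast
  qed
qed

text \<open>
  Each \<open>s c c\<close> is the average of the eigenvalues with weights \<open>(b \<bullet> c)\<^sup>2\<close>, and by Parseval the weights
  of a fixed \<open>b\<close> add up to 1.
\<close>

lemma trace_basis_independent:
  fixes s :: "'a::euclidean_space \<Rightarrow> 'a \<Rightarrow> real"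
  assumes s: "bilinear s"
    and B: "onb B W" and diag: "\<And>b c. b \<in> B \<Longrightarrow> c \<in> B \<Longrightarrow> b \<noteq> c \<Longrightarrow> s b c = 0"
    and C: "onb C W"
  shows "(\<Sum>c\<in>C. s c c) = (\<Sum>b\<in>B. s b b)"
proof -
  note fB = onb_finite[OF B]
  have *: "s c c = (\<Sum>b\<in>B. (b \<bullet> c)\<^sup>2 * s b b)" if "c \<in> C" for c
  proof -
    let ?e = "\<Sum>b\<in>B. (c \<bullet> b) *\<^sub>R b"
    have "s c c = s ?e ?e"
      using onb_expand[OF B] onb_subset[OF C that] by simp
    also have "\<dots> = (\<Sum>(b, b')\<in>B \<times> B. s ((c \<bullet> b) *\<^sub>R b) ((c \<bullet> b') *\<^sub>R b'))"
      by (rule bilinear_sum[OF s])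
    also have "\<dots> = (\<Sum>b\<in>B. \<Sum>b'\<in>B. (c \<bullet> b) * (c \<bullet> b') * s b b')"
      using s by (simp add: sum.cartesian_product bilinear_lmul bilinear_rmul algebra_simps)
    also have "\<dots> = (\<Sum>b\<in>B. \<Sum>b'\<in>B. if b' = b then (b \<bullet> c)\<^sup>2 * s b b else 0)"
      using diag by (intro sum.cong refl) (auto simp: power2_eq_square inner_commute)
    finally show ?thesis
      using fB by simp
  qed
  have "(\<Sum>c\<in>C. s c c) = (\<Sum>c\<in>C. \<Sum>b\<in>B. (b \<bullet> c)\<^sup>2 * s b b)"
    using * by simp
  also have "\<dots> = (\<Sum>b\<in>B. (\<Sum>c\<in>C. (b \<bullet> c)\<^sup>2) * s b b)"
    by (subst sum.swap) (simp add: sum_distrib_right)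
  also have "\<dots> = (\<Sum>b\<in>B. s b b)"
    using onb_parseval[OF C onb_subset[OF B]] B by (intro sum.cong) (auto simp: onb_def)
  finally show ?thesis .
qed

lemma det_eq_prod_eigenvalues:
  fixes f :: "real^'m \<Rightarrow> real^'m"
  assumes f: "linear f" and B: "onb B UNIV" and eig: "\<And>b. b \<in> B \<Longrightarrow> f b = e b *\<^sub>R b"
  shows "det (matrix f) = (\<Prod>b\<in>B. e b)"
proof -
  have "card B = CARD('m)"
    using onb_card[OF B] by simp
  then obtain g where g: "bij_betw g (UNIV :: 'm set) B"
    using onb_finite[OF B] using finite_same_card_bij[of "UNIV :: 'm set" B] by auto
  \<comment> \<open>The columns of U are the eigenvectors, so U conjugates f to the diagonal matrix E.\<close>
  define U :: "real^'m^'m" where "U = (\<chi> i j. g j $ i)"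
  define E :: "real^'m^'m" where "E = (\<chi> i j. if i = j then e (g j) else 0)"
  have gB: "g j \<in> B" for j using g by (auto simp: bij_betw_def)
  have "(transpose U ** U) $ i $ j = (mat 1 :: real^'m^'m) $ i $ j" for i j
  proof -
    have "(transpose U ** U) $ i $ j = g i \<bullet> g j"
      by (simp add: matrix_matrix_mult_def transpose_def U_def inner_vec_def)
    also have "\<dots> = (if g i = g j then 1 else 0)"
      using onb_inner[OF B gB gB] by simp
    also have "\<dots> = (mat 1 :: real^'m^'m) $ i $ j"
      using g by (auto simp: mat_def bij_betw_def inj_on_def)
    finally show ?thesis .
  qed
  then have "transpose U ** U = mat 1"
    by (simp add: vec_eq_iff)
  then have "det U * det U = 1"
    by (metis det_I det_mul det_transpose)
  then have U0: "det U \<noteq> 0" by auto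
  have "(matrix f ** U) $ i $ j = (U ** E) $ i $ j" for i j
  proof -
    have "(matrix f ** U) $ i $ j = (matrix f *v g j) $ i"
      by (simp add: matrix_matrix_mult_def matrix_vector_mult_def U_def)
    also have "\<dots> = e (g j) * g j $ i"
      using f eig[OF gB] by (simp add: matrix_works)
    also have "\<dots> = (U ** E) $ i $ j"
      by (simp add: matrix_matrix_mult_def U_def E_def if_distrib sum.delta cong: if_cong)
    finally show ?thesis .
  qed
  then have "matrix f ** U = U ** E"
    by (simp add: vec_eq_iff)
  then have "det (matrix f) * det U = det U * det E"
    by (metis det_mul)
  then have "det (matrix f) = det E"
    using U0 by simp
  also have "\<dots> = (\<Prod>i\<in>UNIV. E $ i $ i)"
    by (rule det_diagonal) (simp add: E_def)
  also have "\<dots> = (\<Prod>b\<in>B. e b)"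
    using prod.reindex_bij_betw[OF g, of e] by (simp add: E_def)
  finally show ?thesis .
qed


section \<open>Volumes of differentiable images\<close>

text \<open>
  The change-of-variables theorems are about \<open>real^'m\<close>.  Matching the standard bases gives an isometry
  that preserves Lebesgue measure and carries these theorems to an arbitrary Euclidean space.
\<close>

lemma coordinate_isometry_exists:
  assumes dim: "DIM('a::euclidean_space) = CARD('m::finite)"
  obtains \<phi> :: "'a::euclidean_space \<Rightarrow> real^'m::finite" and \<psi> :: "real^'m::finite \<Rightarrow> 'a::euclidean_space"
  where "linear \<phi>" "linear \<psi>" "\<And>x. \<psi> (\<phi> x) = x" "\<And>y. \<phi> (\<psi> y) = y"
    "\<And>x y. \<phi> x \<bullet> \<phi> y = x \<bullet> y"
    "\<And>K. K \<in> sets borel \<Longrightarrow> \<phi> ` K \<in> sets borel"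
    "\<And>K. K \<in> sets borel \<Longrightarrow> emeasure lborel (\<phi> ` K) = emeasure lborel K"
proof -
  have "card (Basis :: 'a set) = card (Basis :: (real^'m) set)"
    using dim by simp
  then obtain \<pi> where \<pi>: "bij_betw \<pi> (Basis :: 'a set) (Basis :: (real^'m) set)"
    using finite_same_card_bij[of "Basis :: 'a set" "Basis :: (real^'m) set"] by auto
  define \<sigma> where "\<sigma> = inv_into (Basis :: 'a set) \<pi>"
  have \<pi>B: "\<pi> b \<in> Basis" if "b \<in> Basis" for b using \<pi> that by (auto simp: bij_betw_def)
  have \<sigma>B: "\<sigma> c \<in> Basis" "\<pi> (\<sigma> c) = c" if "c \<in> Basis" for c
    using \<pi> that by (auto simp: \<sigma>_def bij_betw_def inv_into_into f_inv_into_f)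
  define \<phi> where "\<phi> x = (\<Sum>b\<in>Basis. (x \<bullet> b) *\<^sub>R \<pi> b)" for x
  define \<psi> where "\<psi> y = (\<Sum>b\<in>Basis. (y \<bullet> \<pi> b) *\<^sub>R b)" for y
  have in\<pi>: "\<pi> b \<bullet> \<pi> c = (if b = c then 1 else 0)" if "b \<in> Basis" "c \<in> Basis" for b c
    using inner_Basis[OF \<pi>B[OF that(1)] \<pi>B[OF that(2)]] \<pi> that by (auto simp: bij_betw_def inj_on_def)
  have \<phi>in: "\<phi> x \<bullet> \<pi> c = x \<bullet> c" if "c \<in> Basis" for x c
    using that by (simp add: \<phi>_def inner_sum_left in\<pi> if_distrib cong: if_cong)
  have \<psi>in: "\<psi> y \<bullet> c = y \<bullet> \<pi> c" if "c \<in> Basis" for y c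
    using that by (simp add: \<psi>_def inner_sum_left inner_Basis if_distrib cong: if_cong)
  have lin: "linear \<phi>" "linear \<psi>"
    by (auto simp: \<phi>_def \<psi>_def linear_iff inner_add_left scaleR_add_left sum.distrib scaleR_sum_right)
  have \<psi>\<phi>: "\<psi> (\<phi> x) = x" for x
    by (rule euclidean_eqI) (simp add: \<psi>in \<phi>in)
  have \<phi>\<psi>: "\<phi> (\<psi> y) = y" for y
  proof (rule euclidean_eqI)
    fix c :: "real^'m" assume "c \<in> Basis"
    then show "\<phi> (\<psi> y) \<bullet> c = y \<bullet> c"
      using \<phi>in[OF \<sigma>B(1), of c "\<psi> y"] \<psi>in[OF \<sigma>B(1), of c y] \<sigma>B(2)[of c] by simp
  qed
  have ip: "\<phi> x \<bullet> \<phi> y = x \<bullet> y" for x y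
  proof -
    have "\<phi> x \<bullet> \<phi> y = (\<Sum>b\<in>Basis. (x \<bullet> b) * (\<pi> b \<bullet> \<phi> y))"
      by (subst \<phi>_def) (simp add: inner_sum_left)
    also have "\<dots> = x \<bullet> y"
      by (simp add: \<phi>in inner_commute[of _ "\<phi> y"] euclidean_inner[of x y])
    finally show ?thesis .
  qed
  have [measurable]: "\<phi> \<in> borel \<rightarrow>\<^sub>M borel"
    using lin(1) by (intro borel_measurable_continuous_onI linear_continuous_on) (simp add: linear_conv_bounded_linear)
  have [measurable]: "\<psi> \<in> borel \<rightarrow>\<^sub>M borel"
    using lin(2) by (intro borel_measurable_continuous_onI linear_continuous_on) (simp add: linear_conv_bounded_linear)
  have distr: "lborel = distr lborel borel \<phi>"
  proof (rule lborel_eqI)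
    fix l u :: "real^'m" assume le: "\<And>b. b \<in> Basis \<Longrightarrow> l \<bullet> b \<le> u \<bullet> b"
    have "\<phi> -` box l u = box (\<psi> l) (\<psi> u)"
    proof (intro set_eqI)
      fix x
      have "(\<forall>c\<in>Basis. l \<bullet> c < \<phi> x \<bullet> c \<and> \<phi> x \<bullet> c < u \<bullet> c) \<longleftrightarrow> (\<forall>b\<in>Basis. l \<bullet> \<pi> b < x \<bullet> b \<and> x \<bullet> b < u \<bullet> \<pi> b)"
        using \<pi>B \<phi>in \<sigma>B by metis
      then show "(x \<in> \<phi> -` box l u) = (x \<in> box (\<psi> l) (\<psi> u))"
        by (simp add: mem_box \<psi>in)
    qed
    moreover have "emeasure lborel (box (\<psi> l) (\<psi> u)) = (\<Prod>b\<in>Basis. (u - l) \<bullet> \<pi> b)"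
      using le \<pi>B by (subst emeasure_lborel_box) (auto simp: \<psi>in inner_diff_left)
    moreover have "(\<Prod>b\<in>Basis. (u - l) \<bullet> \<pi> b) = (\<Prod>b\<in>Basis. (u - l) \<bullet> b)"
      by (rule prod.reindex_bij_betw[OF \<pi>])
    ultimately show "emeasure (distr lborel borel \<phi>) (box l u) = (\<Prod>b\<in>Basis. (u - l) \<bullet> b)"
      by (simp add: emeasure_distr)
  qed simp
  have im: "\<phi> ` K = \<psi> -` K" "\<phi> -` \<phi> ` K = K" for K
    using \<psi>\<phi> \<phi>\<psi> by (auto simp: image_iff) metis+
  have meas: "\<phi> ` K \<in> sets borel" if "K \<in> sets borel" for K
    using measurable_sets[OF \<open>\<psi> \<in> borel \<rightarrow>\<^sub>M borel\<close> that] by (simp add: im(1))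
  have "emeasure lborel (\<phi> ` K) = emeasure lborel K" if "K \<in> sets borel" for K
    using meas[OF that] by (subst distr, subst emeasure_distr) (auto simp: im(2))
  then show thesis
    using that[of \<phi> \<psi>] lin \<psi>\<phi> \<phi>\<psi> ip meas by simp
qed

text \<open>
  The area estimate for differentiable images asks for an integrable Jacobian; a bounded Jacobian on
  a set of finite measure is integrable because it is measurable.
\<close>

lemma measure_image_le_det_bound:
  fixes f :: "real^'m::{finite,wellorder} \<Rightarrow> real^'m::_"
  assumes S: "S \<in> lmeasurable"
    and deriv: "\<And>x. x \<in> S \<Longrightarrow> (f has_derivative f' x) (at x within S)"
    and bound: "\<And>x. x \<in> S \<Longrightarrow> \<bar>det (matrix (f' x))\<bar> \<le> c"
  shows "measure lebesgue (f ` S) \<le> c * measure lebesgue S"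
proof (rule measure_bounded_differentiable_image[OF S deriv _ bound])
  have "(\<lambda>x. det (matrix (f' x))) \<in> borel_measurable (lebesgue_on S)"
    using S by (intro borel_measurable_det_Jacobian[OF _ deriv]) auto
  then have "(\<lambda>x. \<bar>det (matrix (f' x))\<bar>) \<in> borel_measurable (lebesgue_on S)"
    by (rule borel_measurable_abs)
  moreover have "(\<lambda>_. c) integrable_on S"
    using S by (rule integrable_on_const)
  moreover have "norm \<bar>det (matrix (f' x))\<bar> \<le> c" if "x \<in> S" for x
    using bound[OF that] by simp
  moreover have "S \<in> sets lebesgue"
    using S by (rule fmeasurableD)
  ultimately show "(\<lambda>x. \<bar>det (matrix (f' x))\<bar>) integrable_on S"
    by (rule measurable_bounded_by_integrable_imp_integrable)
qed

text \<open>
  The coordinate isometry keeps eigenvalues and orthonormality, so the Jacobian determinant in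
  coordinates is the product of the eigenvalues.  Derivatives are taken within \<open>S\<close>, since the maps to
  which this is applied come from nearest points and are controlled on a compact set only.
\<close>

lemma emeasure_image_le_eigenvalue_bound:
  fixes f :: "'a::euclidean_space \<Rightarrow> 'a"
  assumes dim: "DIM('a) = CARD('m::{finite,wellorder})"
    and S: "compact S" and c: "0 \<le> c"
    and deriv: "\<And>x. x \<in> S \<Longrightarrow> (f has_derivative f' x) (at x within S)"
    and eig: "\<And>x. x \<in> S \<Longrightarrow> \<exists>B e. onb B UNIV \<and> (\<forall>b\<in>B. f' x b = e b *\<^sub>R b) \<and> \<bar>\<Prod>b\<in>B. e b\<bar> \<le> c"
  shows "emeasure lborel (f ` S) \<le> ennreal c * emeasure lborel S"
proof -
  obtain \<phi> :: "'a \<Rightarrow> real^'m::_" and \<psi> where \<phi>: "linear \<phi>" and \<psi>: "linear \<psi>"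
    and \<psi>\<phi>: "\<And>x. \<psi> (\<phi> x) = x" and \<phi>\<psi>: "\<And>y. \<phi> (\<psi> y) = y"
    and ip: "\<And>x y. \<phi> x \<bullet> \<phi> y = x \<bullet> y"
    and vol: "\<And>K. K \<in> sets borel \<Longrightarrow> emeasure lborel (\<phi> ` K) = emeasure lborel K"
    using coordinate_isometry_exists[OF dim] by metis
  have bl: "bounded_linear \<phi>" "bounded_linear \<psi>"
    using \<phi> \<psi> by (auto simp: linear_conv_bounded_linear)
  have vol': "measure lebesgue (\<phi> ` K) = measure lborel K" if "compact K" for K
  proof -
    have "compact (\<phi> ` K)"
      using that bl by (intro compact_continuous_image linear_continuous_on)
    then show ?thesis
      using vol[of K] that by (simp add: borel_compact measure_def)
  qed
  have contf: "continuous_on S f"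
    using deriv has_derivative_continuous by (force simp: continuous_on_eq_continuous_within)
  then have cfS: "compact (f ` S)"
    using S by (rule compact_continuous_image)
  define g where "g = (\<lambda>y. \<phi> (f (\<psi> y)))"
  define g' where "g' = (\<lambda>y v. \<phi> (f' (\<psi> y) (\<psi> v)))"
  have "measure lebesgue (g ` (\<phi> ` S)) \<le> c * measure lebesgue (\<phi> ` S)"
  proof (rule measure_image_le_det_bound[where f' = g'])
    have "compact (\<phi> ` S)"
      using S bl by (intro compact_continuous_image linear_continuous_on)
    then show "\<phi> ` S \<in> lmeasurable"
      by (rule lmeasurable_compact)
  next
    fix y assume "y \<in> \<phi> ` S"
    then have y: "\<psi> y \<in> S" using \<psi>\<phi> by auto
    have im: "\<psi> ` \<phi> ` S = S"
      using \<psi>\<phi> by (auto simp: image_image)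
    have "((\<lambda>y. f (\<psi> y)) has_derivative (\<lambda>v. f' (\<psi> y) (\<psi> v))) (at y within \<phi> ` S)"
      by (rule has_derivative_in_compose[OF bounded_linear_imp_has_derivative[OF bl(2)]])
        (use deriv[OF y] im in simp)
    then show "(g has_derivative g' y) (at y within \<phi> ` S)"
      unfolding g_def g'_def by (rule bounded_linear.has_derivative[OF bl(1)])
    from eig[OF y] obtain B e where B: "onb B UNIV" and e: "\<And>b. b \<in> B \<Longrightarrow> f' (\<psi> y) b = e b *\<^sub>R b"
      and le: "\<bar>\<Prod>b\<in>B. e b\<bar> \<le> c" by blast
    have nrm: "norm (\<phi> b) = norm b" for b
      by (simp add: norm_eq_sqrt_inner ip)
    have sp: "span (\<phi> ` B) = UNIV"
      using B \<phi>\<psi> unfolding onb_def linear_span_image[OF \<phi>] by (metis surjI)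
    have onb: "onb (\<phi> ` B) UNIV"
      using B sp unfolding onb_def pairwise_def orthogonal_def by (auto simp: ip nrm)
    have lin: "linear (g' y)"
      using has_derivative_linear[OF deriv[OF y]] \<phi> \<psi> unfolding g'_def
      by (auto simp: linear_iff)
    have inj: "inj_on \<phi> B"
      using \<psi>\<phi> by (metis inj_onI)
    have "det (matrix (g' y)) = (\<Prod>b\<in>\<phi> ` B. e (\<psi> b))"
      using e by (intro det_eq_prod_eigenvalues[OF lin onb]) (auto simp: g'_def \<psi>\<phi> linear_cmul[OF \<phi>])
    also have "\<dots> = (\<Prod>b\<in>B. e b)"
      using inj by (simp add: prod.reindex \<psi>\<phi>)
    finally show "\<bar>det (matrix (g' y))\<bar> \<le> c"
      using le by simp
  qed
  moreover have "g ` (\<phi> ` S) = \<phi> ` (f ` S)"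
    by (simp add: g_def image_image \<psi>\<phi>)
  ultimately have "measure lborel (f ` S) \<le> c * measure lborel S"
    using vol'[OF S] vol'[OF cfS] by simp
  moreover have "emeasure lborel K = ennreal (measure lborel K)" if "compact K" for K :: "'a set"
    using emeasure_compact_finite[OF that] by (intro emeasure_eq_ennreal_measure) auto
  ultimately show ?thesis
    using S cfS c by (simp add: ennreal_mult[symmetric])
qed

text \<open>
  By uniqueness of Lebesgue measure it suffices to look at boxes; the preimage of a box is its image
  under the inverse isometry.
\<close>

lemma distr_lborel_isometry:
  fixes f :: "'a::euclidean_space \<Rightarrow> 'a"
  assumes dim: "DIM('a) = CARD('m::{finite,wellorder})"
    and f: "linear f" and iso: "\<And>x. norm (f x) = norm x"
  shows "distr lborel borel f = lborel"
proof -
  have f': "orthogonal_transformation f"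
    unfolding orthogonal_transformation using f iso by blast
  have bl: "bounded_linear f"
    using f by (simp add: linear_conv_bounded_linear)
  have meas [measurable]: "f \<in> borel \<rightarrow>\<^sub>M borel"
    using bl by (intro borel_measurable_continuous_onI linear_continuous_on)
  obtain \<phi> :: "'a \<Rightarrow> real^'m::_" and \<psi> where \<phi>: "linear \<phi>" and \<psi>: "linear \<psi>"
    and \<psi>\<phi>: "\<And>x. \<psi> (\<phi> x) = x" and \<phi>\<psi>: "\<And>y. \<phi> (\<psi> y) = y"
    and ip: "\<And>x y. \<phi> x \<bullet> \<phi> y = x \<bullet> y"
    and mea: "\<And>K. K \<in> sets borel \<Longrightarrow> \<phi> ` K \<in> sets borel"
    and vol: "\<And>K. K \<in> sets borel \<Longrightarrow> emeasure lborel (\<phi> ` K) = emeasure lborel K"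
    by (rule coordinate_isometry_exists[OF dim]) (rule that)
  have nrm: "norm (\<phi> x) = norm x" "norm (\<psi> y) = norm y" for x y
    using ip[of x x] ip[of "\<psi> y" "\<psi> y"] by (simp_all add: norm_eq_sqrt_inner \<phi>\<psi>)
  define g where "g = inv f"
  have g: "orthogonal_transformation g"
    unfolding g_def using f' by (rule orthogonal_transformation_inv)
  have "lborel = distr lborel borel f"
  proof (rule lborel_eqI)
    fix l u :: 'a assume le: "\<And>b. b \<in> Basis \<Longrightarrow> l \<bullet> b \<le> u \<bullet> b"
    let ?b = "box l u"
    have im: "f -` ?b = g ` ?b"
      using bij_vimage_eq_inv_image[OF orthogonal_transformation_bij[OF f']] by (simp add: g_def)
    have mb: "f -` ?b \<in> sets borel"
      using measurable_sets[OF meas, of ?b] by simp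
    have gen: "\<phi> ` K \<in> lmeasurable \<and> measure lebesgue (\<phi> ` K) = measure lborel K"
      if "K \<in> sets borel" "bounded K" for K
    proof -
      have "bounded (\<phi> ` K)"
        using that(2) nrm by (auto simp: bounded_iff)
      then show ?thesis
        using mea[OF that(1)] vol[OF that(1)]
        by (auto simp: measure_def intro!: bounded_set_imp_lmeasurable)
    qed
    have bb: "bounded (f -` ?b)"
      using bounded_box[of l u] iso unfolding bounded_iff by (metis vimageE)
    have "orthogonal_transformation (\<lambda>y. \<phi> (g (\<psi> y)))"
      using g \<phi> \<psi> nrm unfolding orthogonal_transformation linear_iff by simp
    then have "measure lebesgue ((\<lambda>y. \<phi> (g (\<psi> y))) ` \<phi> ` ?b) = measure lebesgue (\<phi> ` ?b)"
      using gen[of ?b] by (intro measure_orthogonal_image) auto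
    also have "(\<lambda>y. \<phi> (g (\<psi> y))) ` \<phi> ` ?b = \<phi> ` (f -` ?b)"
      by (simp add: im image_image \<psi>\<phi>)
    finally have "measure lborel (f -` ?b) = measure lborel ?b"
      using gen[of ?b] gen[OF mb bb] by auto
    then have "emeasure lborel (f -` ?b) = emeasure lborel ?b"
      using emeasure_bounded_finite[OF bb] emeasure_bounded_finite[OF bounded_box[of l u]]
      by (metis emeasure_eq_ennreal_measure less_irrefl infinity_ennreal_def)
    then show "emeasure (distr lborel borel f) ?b = (\<Prod>b\<in>Basis. (u - l) \<bullet> b)"
      using le by (simp add: emeasure_distr)
  qed simp
  then show ?thesis by simp
qed


section \<open>Nearest points on a set with second-order contact\<close>

text \<open>
  A description of \<open>C\<close> near \<open>x\<close> up to third order: \<open>W\<close> is the tangent space, and \<open>C\<close> is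
  approximated by the graph \<open>w \<mapsto> x + w + \<Gamma> w w\<close> in both directions, i.e. points of \<open>C\<close> are near the graph
  and points of the graph are near \<open>C\<close>.  For \<open>v\<close> orthogonal to \<open>W\<close>, the form \<open>2 * (v \<bullet> \<Gamma> u w)\<close> is the second
  fundamental form of \<open>C\<close> in direction \<open>v\<close>.
\<close>

definition quadratic_contact :: "'a::euclidean_space set \<Rightarrow> 'a \<Rightarrow> 'a set \<Rightarrow> ('a \<Rightarrow> 'a \<Rightarrow> 'a) \<Rightarrow> bool" where
  "quadratic_contact C x W \<Gamma> \<longleftrightarrow> subspace W \<and> bilinear \<Gamma> \<and> (\<forall>u w. \<Gamma> u w = \<Gamma> w u) \<and>
     (\<exists>K>0. \<exists>\<epsilon>>0.
       (\<forall>y\<in>C. norm (y - x) < \<epsilon> \<longrightarrow>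
          (\<exists>w\<in>W. norm w \<le> K * norm (y - x) \<and> norm (y - x - w - \<Gamma> w w) \<le> K * norm w ^ 3)) \<and>
       (\<forall>w\<in>W. norm w < \<epsilon> \<longrightarrow> (\<exists>y\<in>C. norm (y - x - w - \<Gamma> w w) \<le> K * norm w ^ 3)))"

lemma small_parameter_expansion:
  fixes a b c \<epsilon> :: real
  assumes \<epsilon>: "\<epsilon> > 0" and le: "\<And>t. \<bar>t\<bar> < \<epsilon> \<Longrightarrow> 2 * t * a + t\<^sup>2 * b \<le> c * \<bar>t\<bar> ^ 3"
  shows "a = 0" "b \<le> 0"
proof -
  have evr: "eventually (\<lambda>t::real. 0 < t \<and> t < \<epsilon>) (at_right 0)"
    using \<epsilon> unfolding eventually_at_right_field by auto
  have lim: "((\<lambda>t. c * t\<^sup>2 - t * b) \<longlongrightarrow> c * 0\<^sup>2 - 0 * b) (at_right (0::real))"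
    by (intro tendsto_intros)
  have div: "x \<le> y" if "t * x \<le> t * y" "0 < t" for x y t :: real
    using that by simp
  have "2 * a \<le> c * 0\<^sup>2 - 0 * b"
  proof (rule tendsto_lowerbound[OF lim])
    show "\<forall>\<^sub>F t in at_right 0. 2 * a \<le> c * t\<^sup>2 - t * b"
      using evr
    proof eventually_elim
      case (elim t)
      have "t * (2 * a) \<le> t * (c * t\<^sup>2 - t * b)"
        using le[of t] elim by (simp add: algebra_simps power2_eq_square power3_eq_cube)
      then show ?case by (rule div) (use elim in simp)
    qed
  qed simp
  moreover have "- (2 * a) \<le> c * 0\<^sup>2 - 0 * b"
  proof (rule tendsto_lowerbound[OF lim])
    show "\<forall>\<^sub>F t in at_right 0. - (2 * a) \<le> c * t\<^sup>2 - t * b"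
      using evr
    proof eventually_elim
      case (elim t)
      have "t * - (2 * a) \<le> t * (c * t\<^sup>2 - t * b)"
        using le[of "-t"] elim by (simp add: algebra_simps power2_eq_square power3_eq_cube)
      then show ?case by (rule div) (use elim in simp)
    qed
  qed simp
  ultimately show a: "a = 0" by simp
  have lim2: "((\<lambda>t. c * t) \<longlongrightarrow> c * 0) (at_right (0::real))"
    by (intro tendsto_intros)
  have "b \<le> c * 0"
  proof (rule tendsto_lowerbound[OF lim2])
    show "\<forall>\<^sub>F t in at_right 0. b \<le> c * t"
      using evr
    proof eventually_elim
      case (elim t)
      have "t\<^sup>2 * b \<le> t\<^sup>2 * (c * t)"
        using le[of t] elim a by (simp add: algebra_simps power2_eq_square power3_eq_cube)
      then show ?case by (rule div) (use elim in simp)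
    qed
  qed simp
  then show "b \<le> 0" by simp
qed

text \<open>
  Comparing \<open>x\<close> with the points of \<open>C\<close> near \<open>x + t *\<^sub>R w + t\<^sup>2 *\<^sub>R \<Gamma> w w\<close> and expanding the squared
  distance to \<open>x + v\<close> in powers of \<open>t\<close>: the first order gives orthogonality, the second order says that
  \<open>x + v\<close> does not lie beyond a focal point, i.e. the eigenvalues of the second fundamental form in
  direction \<open>v\<close> are at most 1.
\<close>

lemma nearest_point_first_second_order:
  fixes C :: "'a::euclidean_space set"
  assumes qc: "quadratic_contact C x W \<Gamma>"
    and near: "\<And>y. y \<in> C \<Longrightarrow> norm v \<le> norm (x + v - y)"
    and w: "w \<in> W"
  shows "v \<bullet> w = 0" "2 * (v \<bullet> \<Gamma> w w) \<le> (norm w)\<^sup>2"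
proof -
  from qc obtain K \<epsilon> where W: "subspace W" and \<Gamma>: "bilinear \<Gamma>" and K: "K > 0" and \<epsilon>: "\<epsilon> > 0"
    and ex: "\<And>w. w \<in> W \<Longrightarrow> norm w < \<epsilon> \<Longrightarrow> \<exists>y\<in>C. norm (y - x - w - \<Gamma> w w) \<le> K * norm w ^ 3"
    unfolding quadratic_contact_def by metis
  define \<gamma> where "\<gamma> = \<Gamma> w w"
  define \<delta> where "\<delta> = min 1 (\<epsilon> / (norm w + 1))"
  have \<delta>: "\<delta> > 0" using \<epsilon> by (simp add: \<delta>_def add_nonneg_pos)
  define k where "k = K * norm w ^ 3"
  have k: "k \<ge> 0" using K by (simp add: k_def)
  define c where "c = 2 * norm v * k + 2 * norm w * (norm \<gamma> + k) + (norm \<gamma> + k)\<^sup>2"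
  have "2 * t * (v \<bullet> w) + t\<^sup>2 * (2 * (v \<bullet> \<gamma>) - (norm w)\<^sup>2) \<le> c * \<bar>t\<bar> ^ 3" if t: "\<bar>t\<bar> < \<delta>" for t
  proof -
    have t1: "\<bar>t\<bar> \<le> 1" "\<bar>t\<bar> * (norm w + 1) < \<epsilon>"
      using t by (auto simp: \<delta>_def pos_less_divide_eq add_nonneg_pos)
    have "norm (t *\<^sub>R w) < \<epsilon>"
      using t1(2) by (simp add: algebra_simps)
    then obtain y where y: "y \<in> C" and e: "norm (y - x - t *\<^sub>R w - \<Gamma> (t *\<^sub>R w) (t *\<^sub>R w)) \<le> K * norm (t *\<^sub>R w) ^ 3"
      using ex[of "t *\<^sub>R w"] W w by (auto intro: subspace_scale)
    define e' where "e' = y - x - t *\<^sub>R w - t\<^sup>2 *\<^sub>R \<gamma>"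
    have e': "norm e' \<le> k * \<bar>t\<bar> ^ 3"
      using e \<Gamma> by (simp add: e'_def \<gamma>_def k_def bilinear_lmul bilinear_rmul power2_eq_square power_mult_distrib mult_ac)
    define g where "g = t\<^sup>2 *\<^sub>R \<gamma> + e'"
    have t3: "\<bar>t\<bar> ^ 3 \<le> t\<^sup>2"
      using power_decreasing[of 2 3 "\<bar>t\<bar>"] t1 by simp
    have t4: "(t\<^sup>2)\<^sup>2 \<le> \<bar>t\<bar> ^ 3"
      using power_decreasing[of 3 4 "\<bar>t\<bar>"] t1 by simp
    have g: "norm g \<le> t\<^sup>2 * (norm \<gamma> + k)"
    proof -
      have "norm g \<le> t\<^sup>2 * norm \<gamma> + k * \<bar>t\<bar> ^ 3"
        using norm_triangle_ineq[of "t\<^sup>2 *\<^sub>R \<gamma>" e'] e' by (simp add: g_def)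
      also have "\<dots> \<le> t\<^sup>2 * norm \<gamma> + k * t\<^sup>2"
        using k t3 by (intro add_left_mono mult_left_mono)
      finally show ?thesis by (simp add: algebra_simps)
    qed
    have yx: "y - x = t *\<^sub>R w + g"
      by (simp add: g_def e'_def)
    have "(norm v)\<^sup>2 \<le> (norm (x + v - y))\<^sup>2"
      using near[OF y] by (simp add: power_mono)
    also have "x + v - y = v - (t *\<^sub>R w + g)"
      using yx by (simp add: algebra_simps)
    finally have "2 * (v \<bullet> (t *\<^sub>R w + g)) \<le> (norm (t *\<^sub>R w + g))\<^sup>2"
      by (simp add: power2_norm_eq_inner inner_diff_left inner_diff_right inner_commute)
    then have "2 * t * (v \<bullet> w) + 2 * (v \<bullet> g) \<le> t\<^sup>2 * (norm w)\<^sup>2 + 2 * t * (w \<bullet> g) + (norm g)\<^sup>2"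
      unfolding power2_norm_eq_inner
      by (simp add: inner_add_left inner_add_right inner_commute algebra_simps power2_eq_square)
    moreover have "v \<bullet> g = t\<^sup>2 * (v \<bullet> \<gamma>) + v \<bullet> e'"
      by (simp add: g_def inner_add_right)
    moreover have "- (v \<bullet> e') \<le> norm v * (k * \<bar>t\<bar> ^ 3)"
      using Cauchy_Schwarz_ineq2[of v e'] mult_left_mono[OF e', of "norm v"] by simp
    moreover have "t * (w \<bullet> g) \<le> norm w * (norm \<gamma> + k) * \<bar>t\<bar> ^ 3"
    proof -
      have "t * (w \<bullet> g) \<le> \<bar>t\<bar> * \<bar>w \<bullet> g\<bar>"
        by (metis abs_ge_self abs_mult)
      also have "\<dots> \<le> \<bar>t\<bar> * (norm w * (t\<^sup>2 * (norm \<gamma> + k)))"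
        using Cauchy_Schwarz_ineq2[of w g] mult_left_mono[OF g, of "norm w"]
        by (intro mult_left_mono) auto
      also have "\<dots> = norm w * (norm \<gamma> + k) * (\<bar>t\<bar> * t\<^sup>2)" by simp
      also have "\<bar>t\<bar> * t\<^sup>2 = \<bar>t\<bar> ^ 3"
        by (simp add: power3_eq_cube power2_eq_square abs_mult)
      finally show ?thesis .
    qed
    moreover have "(norm g)\<^sup>2 \<le> (norm \<gamma> + k)\<^sup>2 * \<bar>t\<bar> ^ 3"
    proof -
      have "(norm g)\<^sup>2 \<le> (t\<^sup>2 * (norm \<gamma> + k))\<^sup>2"
        using g by (intro power_mono) auto
      also have "\<dots> = (norm \<gamma> + k)\<^sup>2 * (t\<^sup>2)\<^sup>2"
        by (simp add: power_mult_distrib)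
      finally show ?thesis
        using mult_left_mono[OF t4 zero_le_power2[of "norm \<gamma> + k"]] by linarith
    qed
    ultimately show ?thesis
      unfolding c_def by (simp add: algebra_simps)
  qed
  from small_parameter_expansion[OF \<delta> this]
  show "v \<bullet> w = 0" "2 * (v \<bullet> \<Gamma> w w) \<le> (norm w)\<^sup>2"
    by (auto simp: \<gamma>_def)
qed

text \<open>
  That \<open>x\<close> is nearest to \<open>x + v\<close> means \<open>2 * (v \<bullet> (y - x)) \<le> (norm (y - x))\<^sup>2\<close>; this goes into the expansion of the
  squared distance of \<open>x + l *\<^sub>R v\<close> and \<open>y\<close>.  For \<open>l < 1\<close> the second summand shows that \<open>x\<close> is the unique
  nearest point, and that almost nearest points are close to \<open>x\<close>.
\<close>

lemma nearest_point_stability: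
  fixes C :: "'a::euclidean_space set"
  assumes near: "\<And>y. y \<in> C \<Longrightarrow> norm v \<le> norm (x + v - y)" and y: "y \<in> C" and l: "0 \<le> l"
  shows "l\<^sup>2 * (norm v)\<^sup>2 + (1 - l) * (norm (y - x))\<^sup>2 \<le> (norm (x + l *\<^sub>R v - y))\<^sup>2"
proof -
  define d where "d = y - x"
  have "(norm v)\<^sup>2 \<le> (norm (x + v - y))\<^sup>2"
    using near[OF y] by (simp add: power_mono)
  also have "x + v - y = v - d"
    by (simp add: d_def)
  finally have "2 * (v \<bullet> d) \<le> (norm d)\<^sup>2"
    by (simp add: power2_norm_eq_inner inner_diff_left inner_diff_right inner_commute)
  then have *: "l * (2 * (v \<bullet> d)) \<le> l * (norm d)\<^sup>2"
    using l by (rule mult_left_mono)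
  have eq: "x + l *\<^sub>R v - y = l *\<^sub>R v - d"
    by (simp add: d_def)
  have "(norm (l *\<^sub>R v - d))\<^sup>2 = l\<^sup>2 * (norm v)\<^sup>2 - l * (2 * (v \<bullet> d)) + (norm d)\<^sup>2"
    unfolding power2_norm_eq_inner
    by (simp add: inner_diff_left inner_diff_right inner_commute power2_eq_square algebra_simps)
  then have "l\<^sup>2 * (norm v)\<^sup>2 + (1 - l) * (norm d)\<^sup>2 \<le> (norm (l *\<^sub>R v - d))\<^sup>2"
    using * unfolding left_diff_distrib by linarith
  then show ?thesis
    unfolding eq unfolding d_def .
qed

lemma nearest_point_unique:
  fixes C :: "'a::euclidean_space set"
  assumes near: "\<And>y. y \<in> C \<Longrightarrow> norm v \<le> norm (x + v - y)" and x: "x \<in> C" and l: "0 \<le> l" "l < 1"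
    and y: "y \<in> C" and le: "\<And>y'. y' \<in> C \<Longrightarrow> norm (x + l *\<^sub>R v - y) \<le> norm (x + l *\<^sub>R v - y')"
  shows "y = x"
proof -
  have "(norm (x + l *\<^sub>R v - y))\<^sup>2 \<le> (norm (x + l *\<^sub>R v - x))\<^sup>2"
    using le[OF x] by (simp add: power_mono)
  then have "(1 - l) * (norm (y - x))\<^sup>2 \<le> 0"
    using nearest_point_stability[OF near y l(1)] by (simp add: power_mult_distrib)
  then show ?thesis
    using l(2) by (simp add: mult_le_0_iff)
qed

lemma cube_sqrt_bound:
  fixes a b r :: real
  assumes "a\<^sup>2 \<le> b * r ^ 3" "0 \<le> b" "0 \<le> r"
  shows "a \<le> r * sqrt (b * r)"
proof (rule power2_le_imp_le)
  have "(r * sqrt (b * r))\<^sup>2 = r\<^sup>2 * (b * r)"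
    using assms by (simp add: power_mult_distrib)
  also have "\<dots> = b * r ^ 3"
    by (simp add: power2_eq_square power3_eq_cube)
  finally show "a\<^sup>2 \<le> (r * sqrt (b * r))\<^sup>2"
    using assms(1) by simp
qed (use assms in simp)

lemma resolvent_identity:
  fixes a c l m :: real
  assumes "1 - l * m \<noteq> 0"
  shows "a / (1 - l * m) * c - l * (a / (1 - l * m) * (m * c)) = a * c"
proof -
  have "X * c - l * (X * (m * c)) = X * (1 - l * m) * c" for X
    by (simp add: algebra_simps)
  moreover have "a / (1 - l * m) * (1 - l * m) = a"
    using assms by simp
  ultimately show ?thesis by metis
qed

text \<open>
  Write \<open>z = x + l *\<^sub>R v\<close> and \<open>s\<close> for the second fundamental form in direction \<open>v\<close>, with eigenvalues
  \<open>\<mu> b = 2 * (v \<bullet> \<Gamma> b b)\<close>.  Up to third order, the squared distance of \<open>z + h\<close> to a point of \<open>C\<close> with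
  tangential part \<open>w\<close> is a constant plus \<open>E w - 2 * (h \<bullet> w)\<close> with \<open>E w = (norm w)\<^sup>2 - l * s w w\<close>.  As \<open>s \<le> 1\<close> and \<open>l < 1\<close>,
  \<open>E\<close> is positive definite, and the model is minimal at \<open>w = M h\<close> with \<open>M\<close> having eigenvalues
  \<open>1 / (1 - l * \<mu> b)\<close>.  Comparing the nearest point \<open>p (z + h)\<close> with a point of \<open>C\<close> over \<open>M h\<close> gives
  \<open>E (w - M h) = O(|h|^3)\<close>, hence \<open>w - M h = O(|h|^(3/2))\<close>, which is \<open>o(|h|)\<close>.
\<close>

lemma nearest_point_has_derivative:
  fixes C :: "'a::euclidean_space set" and p :: "'a \<Rightarrow> 'a"
  assumes qc: "quadratic_contact C x W \<Gamma>" and x: "x \<in> C"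
    and near: "\<And>y. y \<in> C \<Longrightarrow> norm v \<le> norm (x + v - y)"
    and l: "0 < l" "l < 1"
    and B: "onb B W" and diag: "\<And>b c. b \<in> B \<Longrightarrow> c \<in> B \<Longrightarrow> b \<noteq> c \<Longrightarrow> v \<bullet> \<Gamma> b c = 0"
    and p: "\<And>y. y \<in> S \<Longrightarrow> p y \<in> C" "\<And>y y'. y \<in> S \<Longrightarrow> y' \<in> C \<Longrightarrow> norm (y - p y) \<le> norm (y - y')"
    and S: "x + l *\<^sub>R v \<in> S"
  shows "(p has_derivative (\<lambda>h. \<Sum>b\<in>B. ((h \<bullet> b) / (1 - l * (2 * (v \<bullet> \<Gamma> b b)))) *\<^sub>R b)) (at (x + l *\<^sub>R v) within S)"
proof -
  define z where "z = x + l *\<^sub>R v"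
  define \<mu> where "\<mu> b = 2 * (v \<bullet> \<Gamma> b b)" for b
  define s where "s u w = 2 * (v \<bullet> \<Gamma> u w)" for u w
  \<comment> \<open>M h is the minimiser over W of the quadratic model E w - 2 (h . w).\<close>
  define M where "M h = (\<Sum>b\<in>B. ((h \<bullet> b) / (1 - l * \<mu> b)) *\<^sub>R b)" for h
  define E where "E u = (norm u)\<^sup>2 - l * s u u" for u
  from qc obtain K \<epsilon> where W: "subspace W" and \<Gamma>: "bilinear \<Gamma>" and \<Gamma>sym: "\<And>u w. \<Gamma> u w = \<Gamma> w u"
    and K: "K > 0" and \<epsilon>: "\<epsilon> > 0"
    and ex1: "\<And>y. y \<in> C \<Longrightarrow> norm (y - x) < \<epsilon> \<Longrightarrow> \<exists>w\<in>W. norm w \<le> K * norm (y - x) \<and> norm (y - x - w - \<Gamma> w w) \<le> K * norm w ^ 3"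
    and ex2: "\<And>w. w \<in> W \<Longrightarrow> norm w < \<epsilon> \<Longrightarrow> \<exists>y\<in>C. norm (y - x - w - \<Gamma> w w) \<le> K * norm w ^ 3"
    unfolding quadratic_contact_def by metis
  have orth: "v \<bullet> w = 0" and sle: "s w w \<le> (norm w)\<^sup>2" if "w \<in> W" for w
    using nearest_point_first_second_order[OF qc near that] by (auto simp: s_def)
  have s: "bilinear s"
    unfolding s_def using bilinear_ladd[OF \<Gamma>] bilinear_radd[OF \<Gamma>] bilinear_lmul[OF \<Gamma>] bilinear_rmul[OF \<Gamma>]
    by (auto simp: bilinear_def linear_iff inner_add_right algebra_simps)
  have ssym: "s u w = s w u" for u w
    by (simp add: s_def \<Gamma>sym[of u w])
  have fB: "finite B" by (rule onb_finite[OF B])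
  have \<mu>1: "1 - l * \<mu> b > 0" if "b \<in> B" for b
  proof -
    have "\<mu> b \<le> 1"
      using sle[of b] onb_subset[OF B that] B that by (auto simp: s_def \<mu>_def onb_def)
    then have "l * \<mu> b \<le> l * 1" using l by (intro mult_left_mono) auto
    then show ?thesis using l by linarith
  qed
  have sb: "s b u = \<mu> b * (u \<bullet> b)" if b: "b \<in> B" and u: "u \<in> W" for b u
  proof -
    have "s b u = s b (\<Sum>c\<in>B. (u \<bullet> c) *\<^sub>R c)"
      using onb_expand[OF B u] by simp
    also have "\<dots> = (\<Sum>c\<in>B. (u \<bullet> c) * s b c)"
      using s unfolding bilinear_def by (simp add: linear_sum linear_cmul)
    also have "\<dots> = (\<Sum>c\<in>B. if c = b then (u \<bullet> c) * s b c else 0)"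
      using diag b by (intro sum.cong) (auto simp: s_def)
    also have "\<dots> = (u \<bullet> b) * s b b"
      using fB b by simp
    finally show ?thesis by (simp add: s_def \<mu>_def)
  qed
  have MW: "M h \<in> W" for h
    unfolding M_def using W onb_subset[OF B] by (intro subspace_sum) (auto intro: subspace_scale)
  have linM: "linear M"
    unfolding M_def by (auto simp: linear_iff inner_add_left add_divide_distrib scaleR_add_left sum.distrib scaleR_sum_right)
  then have blM: "bounded_linear M" by (simp add: linear_conv_bounded_linear)
  \<comment> \<open>The Euler equation of the quadratic model.\<close>
  have Meq: "M h \<bullet> u - l * s (M h) u = h \<bullet> u" if u: "u \<in> W" for h u
  proof -
    have "s (M h) u = (\<Sum>b\<in>B. (h \<bullet> b) / (1 - l * \<mu> b) * (\<mu> b * (u \<bullet> b)))"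
      using s sb[OF _ u] unfolding bilinear_def M_def by (simp add: linear_sum[of "\<lambda>x. s x u"] linear_cmul[of "\<lambda>x. s x u"])
    moreover have "M h \<bullet> u = (\<Sum>b\<in>B. (h \<bullet> b) / (1 - l * \<mu> b) * (u \<bullet> b))"
      by (simp add: M_def inner_sum_left inner_commute[of u])
    ultimately have "M h \<bullet> u - l * s (M h) u = (\<Sum>b\<in>B. (h \<bullet> b) / (1 - l * \<mu> b) * (u \<bullet> b) - l * ((h \<bullet> b) / (1 - l * \<mu> b) * (\<mu> b * (u \<bullet> b))))"
      by (simp add: sum_subtractf sum_distrib_left)
    also have "\<dots> = (\<Sum>b\<in>B. (h \<bullet> b) * (u \<bullet> b))"
      using \<mu>1 by (intro sum.cong refl resolvent_identity) force
    also have "\<dots> = h \<bullet> (\<Sum>b\<in>B. (u \<bullet> b) *\<^sub>R b)"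
      by (simp add: inner_sum_right mult.commute)
    also have "\<dots> = h \<bullet> u"
      by (simp add: onb_expand[OF B u])
    finally show ?thesis .
  qed
  have Elow: "(1 - l) * (norm u)\<^sup>2 \<le> E u" if "u \<in> W" for u
    using mult_left_mono[OF sle[OF that], of l] l by (simp add: E_def algebra_simps)
  obtain KM where KM: "\<And>h. norm (M h) \<le> norm h * KM" "KM > 0"
    using bounded_linear.pos_bounded[OF blM] by blast
  obtain K\<Gamma> where K\<Gamma>: "\<And>u w. norm (\<Gamma> u w) \<le> K\<Gamma> * norm u * norm w" "K\<Gamma> > 0"
    using bilinear_bounded_pos[OF \<Gamma>] by blast
  have pz: "p z = x"
    using nearest_point_unique[OF near x, of l "p z"] l p S by (auto simp: z_def)
  define c1 where "c1 = 2 / (1 - l)"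
  have c1: "c1 > 0" using l by (simp add: c1_def)
  \<comment> \<open>An a priori Lipschitz bound at z, from the stability of the nearest point x of z.\<close>
  have lip: "norm (p y - x) \<le> c1 * norm (y - z)" if y: "y \<in> S" for y
  proof -
    let ?d = "p y - x" and ?h = "y - z"
    have "(norm (y - p y))\<^sup>2 \<le> (norm (y - x))\<^sup>2"
      using p(2)[OF y x] by (simp add: power_mono)
    moreover have "y - p y = (z - p y) + ?h" "y - x = (z - x) + ?h" by auto
    ultimately have "(norm (z - p y))\<^sup>2 + 2 * (?h \<bullet> (z - p y)) \<le> (norm (z - x))\<^sup>2 + 2 * (?h \<bullet> (z - x))"
      by (simp only: power2_norm_eq_inner inner_add_left inner_add_right inner_commute)
    moreover have "l\<^sup>2 * (norm v)\<^sup>2 + (1 - l) * (norm ?d)\<^sup>2 \<le> (norm (z - p y))\<^sup>2"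
      using nearest_point_stability[OF near p(1)[OF y], of l] l by (simp add: z_def)
    moreover have "(norm (z - x))\<^sup>2 = l\<^sup>2 * (norm v)\<^sup>2"
      by (simp add: z_def power_mult_distrib)
    moreover have "?h \<bullet> (z - x) - ?h \<bullet> (z - p y) = ?h \<bullet> ?d"
      by (simp add: inner_diff_right)
    ultimately have "(1 - l) * (norm ?d)\<^sup>2 \<le> 2 * (?h \<bullet> ?d)" by linarith
    also have "\<dots> \<le> 2 * (norm ?h * norm ?d)"
      using norm_cauchy_schwarz[of ?h ?d] by simp
    finally have "norm ?d * ((1 - l) * norm ?d) \<le> norm ?d * (2 * norm ?h)"
      by (simp add: power2_eq_square mult_ac)
    then have "(1 - l) * norm ?d \<le> 2 * norm ?h"
      by (cases "norm ?d = 0") (auto simp: mult_le_cancel_left)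
    then show ?thesis
      using l by (simp add: c1_def field_simps)
  qed
  define c where "c = max (K * c1) KM"
  have c: "c > 0" using KM by (auto simp: c_def)
  define k where "k = K\<Gamma> * c\<^sup>2 + K * c ^ 3"
  have k: "k > 0" using K\<Gamma> K c by (simp add: k_def add_pos_pos)
  define c3 where "c3 = 2 * c * k + k\<^sup>2 + 2 * l * norm v * (K * c ^ 3) + 2 * k"
  have c3: "c3 \<ge> 0" using c k K l by (simp add: c3_def)
  \<comment> \<open>Replacing the point x + d of C by its tangential part w costs O(|h|^3) in the squared
    distance to z + h; the constants only collect the bounds used.\<close>
  have approx: "norm g \<le> k * (norm h)\<^sup>2 \<and>
      \<bar>((norm d)\<^sup>2 - 2 * ((l *\<^sub>R v + h) \<bullet> d)) - (E w - 2 * (h \<bullet> w))\<bar> \<le> c3 * norm h ^ 3"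
    if w: "w \<in> W" "norm w \<le> c * norm h" and h: "norm h \<le> 1" and d: "d = w + g" and g: "g = \<Gamma> w w + e"
      and e: "norm e \<le> K * norm w ^ 3" for w h d g e
  proof -
    have h3: "norm h ^ 3 \<le> (norm h)\<^sup>2"
      using power_decreasing[of 2 3 "norm h"] h by simp
    have h4: "((norm h)\<^sup>2)\<^sup>2 \<le> norm h ^ 3"
      using power_decreasing[of 3 4 "norm h"] h by simp
    have "norm w ^ 3 \<le> c ^ 3 * norm h ^ 3"
      using power_mono[OF w(2), of 3] by (simp add: power_mult_distrib)
    then have e3: "norm e \<le> K * c ^ 3 * norm h ^ 3"
      using e mult_left_mono[of "norm w ^ 3" "c ^ 3 * norm h ^ 3" K] K by linarith
    have "norm (\<Gamma> w w) \<le> K\<Gamma> * (norm w)\<^sup>2"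
      using K\<Gamma>(1)[of w w] by (simp add: power2_eq_square mult.assoc)
    also have "\<dots> \<le> K\<Gamma> * (c * norm h)\<^sup>2"
      using w K\<Gamma> by (intro mult_left_mono power_mono) auto
    finally have "norm (\<Gamma> w w) \<le> K\<Gamma> * c\<^sup>2 * (norm h)\<^sup>2"
      by (simp add: power_mult_distrib)
    moreover have "norm e \<le> K * c ^ 3 * (norm h)\<^sup>2"
    proof -
      have "K * c ^ 3 * norm h ^ 3 \<le> K * c ^ 3 * (norm h)\<^sup>2"
        using h3 K c by (intro mult_left_mono) auto
      then show ?thesis using e3 by linarith
    qed
    ultimately have gle: "norm g \<le> k * (norm h)\<^sup>2"
      using norm_triangle_ineq[of "\<Gamma> w w" e] by (simp add: g k_def algebra_simps)
    have "v \<bullet> d = v \<bullet> \<Gamma> w w + v \<bullet> e"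
      using orth[OF w(1)] by (simp add: d g inner_add_right)
    then have "((norm d)\<^sup>2 - 2 * ((l *\<^sub>R v + h) \<bullet> d)) - (E w - 2 * (h \<bullet> w))
        = 2 * (w \<bullet> g) + (norm g)\<^sup>2 - 2 * (l * (v \<bullet> e)) - 2 * (h \<bullet> g)"
      by (simp add: E_def s_def inner_add_left d power2_norm_eq_inner inner_add_right inner_commute algebra_simps)
    moreover have "\<bar>w \<bullet> g\<bar> \<le> c * k * norm h ^ 3"
    proof -
      have "\<bar>w \<bullet> g\<bar> \<le> norm w * norm g" by (rule Cauchy_Schwarz_ineq2)
      also have "\<dots> \<le> (c * norm h) * (k * (norm h)\<^sup>2)"
        using w gle c by (intro mult_mono) auto
      finally show ?thesis by (simp add: power2_eq_square power3_eq_cube mult_ac)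
    qed
    moreover have "\<bar>h \<bullet> g\<bar> \<le> k * norm h ^ 3"
    proof -
      have "\<bar>h \<bullet> g\<bar> \<le> norm h * norm g" by (rule Cauchy_Schwarz_ineq2)
      also have "\<dots> \<le> norm h * (k * (norm h)\<^sup>2)"
        using gle by (intro mult_left_mono) auto
      finally show ?thesis by (simp add: power2_eq_square power3_eq_cube mult_ac)
    qed
    moreover have "\<bar>l * (v \<bullet> e)\<bar> \<le> l * norm v * (K * c ^ 3) * norm h ^ 3"
    proof -
      have "\<bar>l * (v \<bullet> e)\<bar> = l * \<bar>v \<bullet> e\<bar>" using l by (simp add: abs_mult)
      also have "\<dots> \<le> l * (norm v * norm e)"
        using l Cauchy_Schwarz_ineq2[of v e] by simp
      also have "\<dots> \<le> l * (norm v * (K * c ^ 3 * norm h ^ 3))"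
        using e3 l by (intro mult_left_mono) auto
      finally show ?thesis by (simp add: mult_ac)
    qed
    moreover have "(norm g)\<^sup>2 \<le> k\<^sup>2 * norm h ^ 3"
    proof -
      have "(norm g)\<^sup>2 \<le> (k * (norm h)\<^sup>2)\<^sup>2"
        using gle by (intro power_mono) auto
      also have "\<dots> = k\<^sup>2 * ((norm h)\<^sup>2)\<^sup>2" by (simp add: power_mult_distrib)
      finally show ?thesis
        using mult_left_mono[OF h4 zero_le_power2[of k]] by linarith
    qed
    moreover have "0 \<le> (norm g)\<^sup>2" by simp
    moreover have c3: "c3 * norm h ^ 3 = 2 * (c * k * norm h ^ 3) + k\<^sup>2 * norm h ^ 3
        + 2 * (l * norm v * (K * c ^ 3) * norm h ^ 3) + 2 * (k * norm h ^ 3)"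
      by (simp add: c3_def algebra_simps)
    ultimately have "\<bar>((norm d)\<^sup>2 - 2 * ((l *\<^sub>R v + h) \<bullet> d)) - (E w - 2 * (h \<bullet> w))\<bar> \<le> c3 * norm h ^ 3"
      unfolding c3 by linarith
    then show ?thesis using gle by simp
  qed
  define \<delta> where "\<delta> = min 1 (min (\<epsilon> / c1) (\<epsilon> / KM))"
  have \<delta>: "\<delta> > 0" using \<epsilon> c1 KM by (simp add: \<delta>_def)
  define b where "b = 2 * c3 / (1 - l)"
  have b: "b \<ge> 0" using c3 l by (simp add: b_def)
  have main: "norm (p y - x - M (y - z)) \<le> norm (y - z) * (sqrt (b * norm (y - z)) + k * norm (y - z))"
    if y: "y \<in> S" and small: "norm (y - z) < \<delta>" for y
  proof -
    define h where "h = y - z"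
    have h: "norm h \<le> 1" "c1 * norm h < \<epsilon>" "norm h * KM < \<epsilon>"
      using small c1 KM by (auto simp: \<delta>_def h_def pos_less_divide_eq mult.commute)
    have "norm (p y - x) < \<epsilon>" using lip[OF y] h by (simp add: h_def)
    then obtain w where w: "w \<in> W" "norm w \<le> K * norm (p y - x)"
      and e: "norm (p y - x - w - \<Gamma> w w) \<le> K * norm w ^ 3"
      using ex1[OF p(1)[OF y]] by blast
    have "K * norm (p y - x) \<le> K * c1 * norm h"
      using mult_left_mono[OF lip[OF y], of K] K by (simp add: h_def)
    also have "\<dots> \<le> c * norm h"
      by (intro mult_right_mono) (auto simp: c_def)
    finally have wc: "norm w \<le> c * norm h" using w by simp
    have wh: "norm (M h) < \<epsilon>" using KM(1)[of h] h by simp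
    \<comment> \<open>The competitor for p y: a point of C with tangential part M h.\<close>
    from ex2[OF MW this] obtain y' where y': "y' \<in> C"
      and e': "norm (y' - x - M h - \<Gamma> (M h) (M h)) \<le> K * norm (M h) ^ 3" by blast
    have mc: "norm (M h) \<le> c * norm h"
    proof -
      have "norm h * KM \<le> norm h * c" by (intro mult_left_mono) (auto simp: c_def)
      then show ?thesis using KM(1)[of h] by (simp add: mult.commute)
    qed
    define d where "d = p y - x"
    define d' where "d' = y' - x"
    note A1 = approx[OF w(1) wc h(1), of d "d - w" "d - w - \<Gamma> w w"]
    note A2 = approx[OF MW mc h(1), of d' "d' - M h" "d' - M h - \<Gamma> (M h) (M h)"]
    have "(norm (y - p y))\<^sup>2 \<le> (norm (y - y'))\<^sup>2"
      using p(2)[OF y y'] by (simp add: power_mono)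
    moreover have "y - p y = (l *\<^sub>R v + h) - d" "y - y' = (l *\<^sub>R v + h) - d'"
      by (auto simp: h_def z_def d_def d'_def)
    moreover have sq: "(norm (a - d))\<^sup>2 = (norm a)\<^sup>2 + ((norm d)\<^sup>2 - 2 * (a \<bullet> d))" for a d :: 'a
      by (simp add: power2_norm_eq_inner inner_diff_left inner_diff_right inner_commute)
    ultimately have cmp: "(norm d)\<^sup>2 - 2 * ((l *\<^sub>R v + h) \<bullet> d) \<le> (norm d')\<^sup>2 - 2 * ((l *\<^sub>R v + h) \<bullet> d')"
      by simp
    have g1: "norm (d - w) \<le> k * (norm h)\<^sup>2"
      and a1: "\<bar>((norm d)\<^sup>2 - 2 * ((l *\<^sub>R v + h) \<bullet> d)) - (E w - 2 * (h \<bullet> w))\<bar> \<le> c3 * norm h ^ 3"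
      using A1 e by (auto simp: d_def)
    have a2: "\<bar>((norm d')\<^sup>2 - 2 * ((l *\<^sub>R v + h) \<bullet> d')) - (E (M h) - 2 * (h \<bullet> M h))\<bar> \<le> c3 * norm h ^ 3"
      using A2 e' by (auto simp: d'_def)
    \<comment> \<open>Completing the square.\<close>
    have "E w - 2 * (h \<bullet> w) - (E (M h) - 2 * (h \<bullet> M h)) = E (w - M h)"
    proof -
      have "E (w - M h) = E w + E (M h) - 2 * (M h \<bullet> w - l * s (M h) w)"
        using s ssym[of w "M h"]
        by (simp add: E_def power2_norm_eq_inner inner_diff_left inner_diff_right inner_commute
            bilinear_lsub bilinear_rsub algebra_simps)
      also have "E (M h) = h \<bullet> M h"
        using Meq[OF MW[of h], of h] by (simp add: E_def power2_norm_eq_inner)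
      finally show ?thesis
        using Meq[OF w(1), of h] Meq[OF MW[of h], of h] by (simp add: E_def power2_norm_eq_inner)
    qed
    then have "E (w - M h) \<le> 2 * c3 * norm h ^ 3"
      using cmp a1 a2 by linarith
    then have "(1 - l) * (norm (w - M h))\<^sup>2 \<le> 2 * c3 * norm h ^ 3"
      using Elow[OF subspace_diff[OF W w(1) MW]] order_trans by blast
    then have "(norm (w - M h))\<^sup>2 \<le> b * norm h ^ 3"
      using l by (simp add: b_def field_simps)
    then have "norm (w - M h) \<le> norm h * sqrt (b * norm h)"
      using b by (intro cube_sqrt_bound) auto
    moreover have "norm (d - M h) \<le> norm (d - w) + norm (w - M h)"
      using norm_triangle_ineq[of "d - w" "w - M h"] by simp
    ultimately have "norm (d - M h) \<le> norm h * sqrt (b * norm h) + k * (norm h)\<^sup>2"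
      using g1 by simp
    then show ?thesis
      by (simp add: d_def h_def power2_eq_square algebra_simps)
  qed
  have "(p has_derivative M) (at z within S)"
    unfolding has_derivative_within_alt
  proof (intro conjI allI impI blM)
    fix \<eta> :: real assume \<eta>: "\<eta> > 0"
    have "((\<lambda>r. sqrt (b * r) + k * r) \<longlongrightarrow> sqrt (b * 0) + k * 0) (at (0::real))"
      by (intro tendsto_intros)
    then have "\<forall>\<^sub>F r in at (0::real). sqrt (b * r) + k * r < \<eta>"
      using \<eta> by (intro order_tendstoD(2)) auto
    then obtain \<rho> where \<rho>: "\<rho> > 0" "\<And>r. r \<noteq> 0 \<Longrightarrow> \<bar>r\<bar> < \<rho> \<Longrightarrow> sqrt (b * r) + k * r < \<eta>"
      unfolding eventually_at by (auto simp: dist_real_def)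
    show "\<exists>d>0. \<forall>y\<in>S. norm (y - z) < d \<longrightarrow> norm (p y - p z - M (y - z)) \<le> \<eta> * norm (y - z)"
    proof (intro exI[of _ "min \<delta> \<rho>"] conjI ballI impI)
      show "0 < min \<delta> \<rho>" using \<delta> \<rho> by simp
      fix y assume y: "y \<in> S" "norm (y - z) < min \<delta> \<rho>"
      have "sqrt (b * norm (y - z)) + k * norm (y - z) \<le> \<eta>"
        using \<rho>(2)[of "norm (y - z)"] y \<eta> by (cases "y = z") auto
      then have "norm (y - z) * (sqrt (b * norm (y - z)) + k * norm (y - z)) \<le> norm (y - z) * \<eta>"
        by (intro mult_left_mono) auto
      then show "norm (p y - p z - M (y - z)) \<le> \<eta> * norm (y - z)"
        using main[OF y(1)] y(2) by (simp add: pz mult.commute)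
    qed
  qed
  moreover have "M = (\<lambda>h. \<Sum>b\<in>B. ((h \<bullet> b) / (1 - l * (2 * (v \<bullet> \<Gamma> b b)))) *\<^sub>R b)"
    by (rule ext) (simp add: M_def \<mu>_def)
  ultimately show ?thesis
    by (simp add: z_def)
qed


section \<open>Contraction along the normals of a complex set\<close>

text \<open>
  Each factor is at most \<open>exp (- (1 - l) * \<mu> b)\<close>, and these exponents add up to 0.
\<close>

lemma prod_focal_ratio_le_1:
  fixes \<mu> :: "'b \<Rightarrow> real"
  assumes fin: "finite B" and l: "0 < l" "l < 1" and \<mu>: "\<And>b. b \<in> B \<Longrightarrow> \<mu> b \<le> 1" and tr: "(\<Sum>b\<in>B. \<mu> b) = 0"
  shows "0 \<le> (\<Prod>b\<in>B. (1 - \<mu> b) / (1 - l * \<mu> b))" "(\<Prod>b\<in>B. (1 - \<mu> b) / (1 - l * \<mu> b)) \<le> 1"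
proof -
  have pos: "0 < 1 - l * \<mu> b" if "b \<in> B" for b
  proof -
    have "l * \<mu> b \<le> l * 1" using l \<mu>[OF that] by (intro mult_left_mono) auto
    then show ?thesis using l by linarith
  qed
  have nn: "0 \<le> (1 - \<mu> b) / (1 - l * \<mu> b)" if "b \<in> B" for b
    using pos[OF that] \<mu>[OF that] by simp
  show "0 \<le> (\<Prod>b\<in>B. (1 - \<mu> b) / (1 - l * \<mu> b))"
    using nn by (intro prod_nonneg) auto
  have le: "(1 - \<mu> b) / (1 - l * \<mu> b) \<le> exp (- (1 - l) * \<mu> b)" if "b \<in> B" for b
  proof -
    let ?q = "1 - l * \<mu> b"
    have "(1 - \<mu> b) = ?q * (1 - (1 - l) * \<mu> b) - l * (1 - l) * (\<mu> b)\<^sup>2"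
      by (simp add: algebra_simps power2_eq_square)
    moreover have "0 \<le> l * (1 - l) * (\<mu> b)\<^sup>2" using l by simp
    ultimately have "1 - \<mu> b \<le> (1 - (1 - l) * \<mu> b) * ?q"
      by (simp add: mult.commute)
    then have "(1 - \<mu> b) / ?q \<le> 1 - (1 - l) * \<mu> b"
      using pos[OF that] by (simp add: pos_divide_le_eq)
    also have "\<dots> \<le> exp (- (1 - l) * \<mu> b)"
      using exp_ge_add_one_self[of "- (1 - l) * \<mu> b"] by (simp add: algebra_simps)
    finally show ?thesis .
  qed
  have "(\<Prod>b\<in>B. (1 - \<mu> b) / (1 - l * \<mu> b)) \<le> (\<Prod>b\<in>B. exp (- (1 - l) * \<mu> b))"
    using nn le by (intro prod_mono) auto
  also have "\<dots> = exp (\<Sum>b\<in>B. - (1 - l) * \<mu> b)"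
    using fin by (simp add: exp_sum)
  also have "\<dots> = exp (- (1 - l) * (\<Sum>b\<in>B. \<mu> b))"
    by (simp only: sum_distrib_left)
  also have "\<dots> = 1" by (simp add: tr)
  finally show "(\<Prod>b\<in>B. (1 - \<mu> b) / (1 - l * \<mu> b)) \<le> 1" .
qed

text \<open>
  \<open>J\<close> stands for multiplication by \<open>\<i>\<close>, and \<open>d\<close> is an upper bound for the real codimension.  The last
  condition is what distinguishes complex submanifolds: their second fundamental form is complex
  bilinear, hence changes its sign when both arguments are multiplied by \<open>\<i>\<close>, and has trace 0.
\<close>

definition complex_quadratic_contact ::
  "('a::euclidean_space \<Rightarrow> 'a) \<Rightarrow> nat \<Rightarrow> 'a set \<Rightarrow> 'a \<Rightarrow> bool" where
  "complex_quadratic_contact J d C x \<longleftrightarrow>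
     (\<exists>W \<Gamma>. quadratic_contact C x W \<Gamma> \<and> DIM('a) \<le> dim W + d \<and> (\<forall>w\<in>W. J w \<in> W) \<and> (\<forall>w. \<Gamma> (J w) (J w) = - \<Gamma> w w))"

lemma onb_image_complex_structure:
  assumes B: "onb B W" and W: "subspace W" and J: "linear J" "\<And>x. norm (J x) = norm x" "\<And>w. w \<in> W \<Longrightarrow> J w \<in> W"
  shows "onb (J ` B) W" "inj_on J B"
proof -
  have "orthogonal_transformation J"
    unfolding orthogonal_transformation using J(1,2) by simp
  then have ip: "J x \<bullet> J y = x \<bullet> y" for x y
    by (simp add: orthogonal_transformation_def)
  have inj: "inj J"
    unfolding linear_injective_0[OF J(1)] using J(2) by (metis norm_eq_zero)
  then show "inj_on J B" by (rule inj_on_subset) simp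
  have JW: "J ` W = W"
  proof (rule subspace_dim_equal)
    show "subspace (J ` W)" using J(1) W by (rule linear_subspace_image)
    show "J ` W \<subseteq> W" using J(3) by auto
    show "dim W \<le> dim (J ` W)" using dim_image_eq[OF J(1), of W] inj_on_subset[OF inj] by simp
  qed (rule W)
  have "span (J ` B) = W"
    using B JW unfolding onb_def linear_span_image[OF J(1)] by simp
  then show "onb (J ` B) W"
    using B J(2) unfolding onb_def pairwise_def orthogonal_def by (auto simp: ip)
qed

text \<open>
  The eigenvalue of the expansion inverse to the contraction, on a tangent vector where the
  derivative of the nearest point map has eigenvalue \<open>1 / (1 - l * m)\<close>.
\<close>

lemma expansion_eigenvalue:
  fixes l m :: real
  assumes "l \<noteq> 0" "1 - l * m \<noteq> 0"
  shows "1 / l - (1 - l) / l * (1 / (1 - l * m)) = (1 - m) / (1 - l * m)"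
proof -
  have "1 / l - (1 - l) / l * (1 / q) = (q - (1 - l)) / (l * q)" if "q \<noteq> 0" for q
    using that assms(1) by (simp add: field_simps)
  from this[OF assms(2)] have "1 / l - (1 - l) / l * (1 / (1 - l * m)) = (l * (1 - m)) / (l * (1 - l * m))"
    by (simp add: algebra_simps)
  then show ?thesis
    using assms by (metis mult_divide_mult_cancel_left)
qed

text \<open>
  \<open>Z\<close> consists of pairs of a point \<open>x\<close> of \<open>C\<close> and a vector \<open>v\<close> such that \<open>x\<close> is nearest to \<open>x + v\<close>.  Shrinking
  \<open>v\<close> to \<open>l *\<^sub>R v\<close> can be undone, since \<open>x\<close> is recovered as the nearest point of \<open>x + l *\<^sub>R v\<close>.  The inverse
  expands normal directions by \<open>1 / l\<close>; in the tangent directions it has the eigenvalues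
  \<open>(1 - \<mu> b) / (1 - l * \<mu> b)\<close>, whose product is at most 1 because the \<open>\<mu> b\<close> are at most 1 and have sum 0.
\<close>

theorem contraction_volume_bound:
  fixes C :: "'a::euclidean_space set" and J :: "'a \<Rightarrow> 'a"
  assumes dim: "DIM('a) = CARD('m::{finite,wellorder})"
    and J: "linear J" "\<And>x. norm (J x) = norm x"
    and l: "0 < l" "l < 1"
    and Z: "compact Z" and ZC: "\<And>x v. (x, v) \<in> Z \<Longrightarrow> x \<in> C"
    and near: "\<And>x v y. (x, v) \<in> Z \<Longrightarrow> y \<in> C \<Longrightarrow> norm v \<le> norm (x + v - y)"
    and contact: "\<And>x v. (x, v) \<in> Z \<Longrightarrow> complex_quadratic_contact J d C x"
  shows "emeasure lborel ((\<lambda>(x, v). x + v) ` Z)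
    \<le> ennreal ((1 / l) ^ d) * emeasure lborel ((\<lambda>(x, v). x + l *\<^sub>R v) ` Z)"
proof -
  define S where "S = (\<lambda>(x, v). x + l *\<^sub>R v) ` Z"
  \<comment> \<open>Any choice of nearest points will do: on S the nearest point is unique.\<close>
  define p where "p y = (SOME x. x \<in> C \<and> (\<forall>x'\<in>C. norm (y - x) \<le> norm (y - x')))" for y
  \<comment> \<open>R inverts the contraction, since p (x + l v) = x.\<close>
  define R where "R y = (1 / l) *\<^sub>R y - ((1 - l) / l) *\<^sub>R p y" for y
  have near': "norm (x + l *\<^sub>R v - x) \<le> norm (x + l *\<^sub>R v - y)" if "(x, v) \<in> Z" "y \<in> C" for x v y
  proof -
    have "l\<^sup>2 * (norm v)\<^sup>2 + (1 - l) * (norm (y - x))\<^sup>2 \<le> (norm (x + l *\<^sub>R v - y))\<^sup>2"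
      using nearest_point_stability[OF near[OF that(1)] that(2), of l] l by simp
    moreover have "0 \<le> (1 - l) * (norm (y - x))\<^sup>2" using l by simp
    ultimately have "(norm (x + l *\<^sub>R v - x))\<^sup>2 \<le> (norm (x + l *\<^sub>R v - y))\<^sup>2"
      by (simp add: power_mult_distrib)
    then show ?thesis by (rule power2_le_imp_le) simp
  qed
  have p: "p y \<in> C" "\<And>y'. y' \<in> C \<Longrightarrow> norm (y - p y) \<le> norm (y - y')" if yS: "y \<in> S" for y
  proof -
    have "\<exists>x. x \<in> C \<and> (\<forall>x'\<in>C. norm (y - x) \<le> norm (y - x'))"
    proof -
      obtain x v where "(x, v) \<in> Z" "y = x + l *\<^sub>R v"
        using yS by (auto simp: S_def)
      then show ?thesis
        using near' ZC by blast
    qed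
    from someI_ex[OF this] show "p y \<in> C" "\<And>y'. y' \<in> C \<Longrightarrow> norm (y - p y) \<le> norm (y - y')"
      by (auto simp: p_def)
  qed
  have pS: "p (x + l *\<^sub>R v) = x" if "(x, v) \<in> Z" for x v
  proof (rule nearest_point_unique[OF near[OF that] ZC[OF that], of l])
    have "x + l *\<^sub>R v \<in> S" using that by (auto simp: S_def intro!: image_eqI[of _ _ "(x, v)"])
    then show "p (x + l *\<^sub>R v) \<in> C" "\<And>y'. y' \<in> C \<Longrightarrow> norm (x + l *\<^sub>R v - p (x + l *\<^sub>R v)) \<le> norm (x + l *\<^sub>R v - y')"
      using p by auto
  qed (use l in auto)
  have RS: "R (x + l *\<^sub>R v) = x + v" if "(x, v) \<in> Z" for x v
  proof -
    have "R (x + l *\<^sub>R v) = (1 / l - (1 - l) / l) *\<^sub>R x + (1 / l * l) *\<^sub>R v"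
      by (simp add: R_def pS[OF that] algebra_simps)
    also have "1 / l - (1 - l) / l = 1" using l by (simp add: field_simps)
    finally show ?thesis using l by simp
  qed
  have img: "R ` S = (\<lambda>(x, v). x + v) ` Z"
    unfolding S_def image_image using RS by (intro image_cong) auto
  have cS: "compact S"
    unfolding S_def case_prod_beta by (intro compact_continuous_image Z continuous_intros)
  \<comment> \<open>Eigenvalues of the derivative of R: 1 / l on normal vectors, and the focal ratios on
    an eigenbasis B of the second fundamental form in direction v.\<close>
  have "\<exists>D. (R has_derivative D) (at y within S) \<and>
     (\<exists>B e. onb B UNIV \<and> (\<forall>b\<in>B. D b = e b *\<^sub>R b) \<and> \<bar>\<Prod>b\<in>B. e b\<bar> \<le> (1 / l) ^ d)"
    if yS: "y \<in> S" for y
  proof -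
    obtain x v where Zxv: "(x, v) \<in> Z" and y: "y = x + l *\<^sub>R v"
      using yS by (auto simp: S_def)
    from contact[OF Zxv] obtain W \<Gamma> where qc: "quadratic_contact C x W \<Gamma>" and dW: "DIM('a) \<le> dim W + d"
      and JW: "\<And>w. w \<in> W \<Longrightarrow> J w \<in> W" and J\<Gamma>: "\<And>w. \<Gamma> (J w) (J w) = - \<Gamma> w w"
      unfolding complex_quadratic_contact_def by blast
    have W: "subspace W" and \<Gamma>: "bilinear \<Gamma>" and \<Gamma>sym: "\<And>u w. \<Gamma> u w = \<Gamma> w u"
      using qc unfolding quadratic_contact_def by auto
    define s where "s u w = 2 * (v \<bullet> \<Gamma> u w)" for u w
    have s: "bilinear s"
      unfolding s_def using bilinear_ladd[OF \<Gamma>] bilinear_radd[OF \<Gamma>] bilinear_lmul[OF \<Gamma>] bilinear_rmul[OF \<Gamma>]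
      by (auto simp: bilinear_def linear_iff inner_add_right algebra_simps)
    have ssym: "s u w = s w u" for u w
      by (simp add: s_def \<Gamma>sym[of u w])
    obtain B where B: "onb B W" and diag: "\<And>b c. b \<in> B \<Longrightarrow> c \<in> B \<Longrightarrow> b \<noteq> c \<Longrightarrow> s b c = 0"
      using diagonalizing_basis_exists[OF s ssym W] by blast
    define \<mu> where "\<mu> b = 2 * (v \<bullet> \<Gamma> b b)" for b
    have \<mu>1: "\<mu> b \<le> 1" if "b \<in> B" for b
      using nearest_point_first_second_order(2)[OF qc near[OF Zxv] onb_subset[OF B that]] B that
      by (auto simp: \<mu>_def onb_def)
    \<comment> \<open>The bases B and J B give the same trace, but J changes its sign.\<close>
    have tr: "(\<Sum>b\<in>B. \<mu> b) = 0"
    proof -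
      note JB = onb_image_complex_structure[OF B W J JW]
      have "(\<Sum>b\<in>B. s b b) = (\<Sum>c\<in>J ` B. s c c)"
        using trace_basis_independent[OF s B diag JB(1)] by simp
      also have "\<dots> = (\<Sum>b\<in>B. s (J b) (J b))"
        using JB(2) by (simp add: sum.reindex)
      also have "\<dots> = - (\<Sum>b\<in>B. s b b)"
        by (simp add: s_def J\<Gamma> sum_negf)
      finally show ?thesis by (simp add: s_def \<mu>_def)
    qed
    define M where "M h = (\<Sum>b\<in>B. ((h \<bullet> b) / (1 - l * \<mu> b)) *\<^sub>R b)" for h
    have Meq: "M = (\<lambda>h. \<Sum>b\<in>B. ((h \<bullet> b) / (1 - l * (2 * (v \<bullet> \<Gamma> b b)))) *\<^sub>R b)"
      by (rule ext) (simp add: M_def \<mu>_def)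
    have dp: "(p has_derivative M) (at y within S)"
      unfolding Meq y
    proof (rule nearest_point_has_derivative[OF qc ZC[OF Zxv] near[OF Zxv] l B])
      show "v \<bullet> \<Gamma> b c = 0" if "b \<in> B" "c \<in> B" "b \<noteq> c" for b c
        using diag[OF that] by (simp add: s_def)
      show "x + l *\<^sub>R v \<in> S" using \<open>y \<in> S\<close> y by simp
    qed (use p in auto)
    define D where "D h = (1 / l) *\<^sub>R h - ((1 - l) / l) *\<^sub>R M h" for h
    have dR: "(R has_derivative D) (at y within S)"
      unfolding R_def D_def by (intro derivative_intros dp)
    obtain B' where B': "onb B' (W\<^sup>\<bottom>)"
      using onb_exists[OF subspace_orthogonal_comp] by blast
    note BB = onb_union[OF B W B']
    define e where "e b = (if b \<in> B then (1 - \<mu> b) / (1 - l * \<mu> b) else 1 / l)" for b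
    have fB: "finite B" "finite B'" using onb_finite B B' by auto
    have De: "D b = e b *\<^sub>R b" if "b \<in> B \<union> B'" for b
    proof (cases "b \<in> B")
      case True
      have "M b = (\<Sum>c\<in>B. if c = b then (1 / (1 - l * \<mu> b)) *\<^sub>R b else 0)"
        unfolding M_def using onb_inner[OF B True] by (intro sum.cong) auto
      also have "\<dots> = (1 / (1 - l * \<mu> b)) *\<^sub>R b"
        using fB True by simp
      finally have Mb: "M b = (1 / (1 - l * \<mu> b)) *\<^sub>R b" .
      have "l * \<mu> b \<le> l * 1" using l \<mu>1[OF True] by (intro mult_left_mono) auto
      then have q: "1 - l * \<mu> b > 0" using l by linarith
      have "1 / l - (1 - l) / l * (1 / (1 - l * \<mu> b)) = (1 - \<mu> b) / (1 - l * \<mu> b)"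
        using l q by (intro expansion_eigenvalue) auto
      then show ?thesis
        unfolding D_def Mb scaleR_scaleR scaleR_left_diff_distrib[symmetric] using True
        by (simp only: e_def if_True)
    next
      case False
      then have "b \<in> W\<^sup>\<bottom>" using that onb_subset[OF B'] by auto
      then have "b \<bullet> c = 0" if "c \<in> B" for c
        using onb_subset[OF B that] by (auto simp: orthogonal_comp_def orthogonal_def inner_commute)
      then have "M b = 0" unfolding M_def by simp
      then show ?thesis using False by (simp add: D_def e_def)
    qed
    have "card B' \<le> d"
    proof -
      have "card (B \<union> B') = DIM('a)" using onb_card[OF BB(1)] by simp
      then show ?thesis
        using card_Un_disjoint[OF fB BB(2)] onb_card[OF B] dW by simp
    qed
    then have "(1 / l) ^ card B' \<le> (1 / l) ^ d"
      using l by (intro power_increasing) auto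
    moreover have "(\<Prod>b\<in>B \<union> B'. e b) = (\<Prod>b\<in>B. (1 - \<mu> b) / (1 - l * \<mu> b)) * (\<Prod>b\<in>B'. 1 / l)"
    proof -
      have "(\<Prod>b\<in>B. e b) = (\<Prod>b\<in>B. (1 - \<mu> b) / (1 - l * \<mu> b))"
        by (intro prod.cong) (auto simp: e_def)
      moreover have "(\<Prod>b\<in>B'. e b) = (\<Prod>b\<in>B'. 1 / l)"
        using BB(2) by (intro prod.cong) (auto simp: e_def)
      ultimately show ?thesis
        using prod.union_disjoint[OF fB BB(2), of e] by simp
    qed
    moreover have "\<bar>\<Prod>b\<in>B. (1 - \<mu> b) / (1 - l * \<mu> b)\<bar> * (1 / l) ^ card B' \<le> 1 * (1 / l) ^ card B'"
      using prod_focal_ratio_le_1[OF fB(1) l \<mu>1 tr] l by (intro mult_right_mono) auto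
    moreover have "\<bar>A * (\<Prod>b\<in>B'. 1 / l)\<bar> = \<bar>A\<bar> * (1 / l) ^ card B'" for A :: real
      using l by (simp add: abs_mult)
    ultimately have "\<bar>\<Prod>b\<in>B \<union> B'. e b\<bar> \<le> (1 / l) ^ d"
      by (simp only: mult_1_left)
    then show ?thesis
      using dR BB(1) De by blast
  qed
  then have "\<forall>y\<in>S. \<exists>D. (R has_derivative D) (at y within S) \<and>
     (\<exists>B e. onb B UNIV \<and> (\<forall>b\<in>B. D b = e b *\<^sub>R b) \<and> \<bar>\<Prod>b\<in>B. e b\<bar> \<le> (1 / l) ^ d)"
    by (rule ballI)
  from bchoice[OF this] obtain R' where R': "\<forall>y\<in>S. (R has_derivative R' y) (at y within S) \<and>
     (\<exists>B e. onb B UNIV \<and> (\<forall>b\<in>B. R' y b = e b *\<^sub>R b) \<and> \<bar>\<Prod>b\<in>B. e b\<bar> \<le> (1 / l) ^ d)"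
    by (rule exE)
  have "emeasure lborel (R ` S) \<le> ennreal ((1 / l) ^ d) * emeasure lborel S"
  proof (rule emeasure_image_le_eigenvalue_bound[OF dim cS])
    show "0 \<le> (1 / l) ^ d" using l by simp
    fix y assume "y \<in> S"
    from bspec[OF R' this] show "(R has_derivative R' y) (at y within S)"
      "\<exists>B e. onb B UNIV \<and> (\<forall>b\<in>B. R' y b = e b *\<^sub>R b) \<and> \<bar>\<Prod>b\<in>B. e b\<bar> \<le> (1 / l) ^ d"
      by (rule conjunct1, rule conjunct2)
  qed
  then show ?thesis
    unfolding img by (simp add: S_def)
qed


section \<open>Second-order expansion of holomorphic functions of several variables\<close>

lemma norm_vec_smult: "norm (c *s v) = cmod c * norm (v :: complex^'n)"
  by (simp add: norm_vec_def L2_set_def norm_mult power_mult_distrib sum_distrib_left[symmetric] real_sqrt_mult)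

lemma scaleR_eq_smult: "r *\<^sub>R (v :: complex^'n) = complex_of_real r *s v"
  by (simp add: vec_eq_iff scaleR_conv_of_real[where 'a=complex])

lemma bounded_linear_smult_left: "bounded_linear (\<lambda>c. c *s (v :: complex^'n))"
  by (rule bounded_linear_intro[of _ "norm v"])
    (auto simp: vec_eq_iff norm_vec_smult algebra_simps scaleR_conv_of_real[where 'a=complex])

lemma bounded_linear_smult_right: "bounded_linear (\<lambda>v :: complex^'n. c *s v)"
  by (rule bounded_linear_intro[of _ "cmod c"])
    (auto simp: vec_eq_iff norm_vec_smult algebra_simps scaleR_conv_of_real[where 'a=complex])

definition complex_differentiable_on :: "(complex^'n::finite \<Rightarrow> complex) \<Rightarrow> (complex^'n) set \<Rightarrow> bool" where
  "complex_differentiable_on F S \<longleftrightarrow>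
     (\<forall>y\<in>S. \<exists>D. (F has_derivative D) (at y) \<and> (\<forall>c v. D (c *s v) = c * D v))"

lemma complex_differentiable_on_line:
  assumes F: "complex_differentiable_on F S" and sub: "\<And>\<zeta>. \<zeta> \<in> T \<Longrightarrow> x + \<zeta> *s u \<in> S"
  shows "(\<lambda>\<zeta>. F (x + \<zeta> *s u)) holomorphic_on T"
proof (rule holomorphic_onI)
  fix \<zeta> assume "\<zeta> \<in> T"
  from F sub[OF this] obtain D where D: "(F has_derivative D) (at (x + \<zeta> *s u))" and lin: "\<And>c v. D (c *s v) = c * D v"
    unfolding complex_differentiable_on_def by blast
  have "((\<lambda>\<zeta>. x + \<zeta> *s u) has_derivative (\<lambda>h. h *s u)) (at \<zeta>)"
    using has_derivative_add[OF has_derivative_const bounded_linear_imp_has_derivative[OF bounded_linear_smult_left]]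
    by fastforce
  from has_derivative_compose[OF this D] have "((\<lambda>\<zeta>. F (x + \<zeta> *s u)) has_derivative (\<lambda>h. h * D u)) (at \<zeta>)"
    by (simp add: lin)
  then have "((\<lambda>\<zeta>. F (x + \<zeta> *s u)) has_field_derivative D u) (at \<zeta>)"
    unfolding has_field_derivative_def mult_commute_abs .
  then show "(\<lambda>\<zeta>. F (x + \<zeta> *s u)) field_differentiable at \<zeta> within T"
    using field_differentiable_at_within field_differentiable_def by blast
qed

lemma complex_differentiable_on_continuous:
  "complex_differentiable_on F S \<Longrightarrow> continuous_on S F"
  unfolding complex_differentiable_on_def
  by (metis continuous_at_imp_continuous_on has_derivative_continuous)

text \<open>
  Cauchy's inequality on circles of radius \<open>r / 4\<close> bounds the third derivative by
  \<open>fact 3 * M / (r / 4) ^ 3 = 384 * M / r ^ 3\<close>, and the Taylor remainder divides this by \<open>fact 2\<close>.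
\<close>

lemma holomorphic_second_order_Taylor:
  assumes r: "0 < r" and g: "g holomorphic_on ball 0 r" and M: "\<And>z. cmod z \<le> r / 2 \<Longrightarrow> cmod (g z) \<le> M"
    and z: "cmod z < r / 4"
  shows "cmod (g z - (g 0 + deriv g 0 * z + (deriv ^^ 2) g 0 / 2 * z\<^sup>2)) \<le> 192 * M / r ^ 3 * cmod z ^ 3"
proof -
  let ?S = "ball (0::complex) (r / 4)"
  have *: "cmod ((deriv ^^ 0) g z - (\<Sum>i\<le>2. (deriv ^^ i) g 0 * (z - 0) ^ i / fact i)) \<le> (384 * M / r ^ 3) * cmod (z - 0) ^ Suc 2 / fact 2"
  proof (rule complex_Taylor[of ?S 2 "\<lambda>i. (deriv ^^ i) g"])
    fix i x assume x: "x \<in> ?S" 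
    have "(deriv ^^ i) g holomorphic_on ball 0 r"
      by (rule holomorphic_higher_deriv[OF g]) simp
    then have "((deriv ^^ i) g has_field_derivative deriv ((deriv ^^ i) g) x) (at x)"
      using x r by (intro holomorphic_derivI[of _ "ball 0 r"]) auto
    then show "((deriv ^^ i) g has_field_derivative (deriv ^^ Suc i) g x) (at x within ?S)"
      by (simp add: has_field_derivative_at_within)
  next
    fix x assume x: "x \<in> ?S"
    have sub: "ball x (r / 4) \<subseteq> ball 0 r" "cball x (r / 4) \<subseteq> ball 0 r"
      using x r by (auto simp: subset_iff dist_norm) (smt (verit) norm_triangle_sub norm_minus_commute)+
    have "cmod ((deriv ^^ 3) g x) \<le> fact 3 * M / (r / 4) ^ 3"
    proof (rule Cauchy_inequality)
      show "g holomorphic_on ball x (r / 4)" using g sub(1) by (rule holomorphic_on_subset)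
      show "continuous_on (cball x (r / 4)) g"
        using holomorphic_on_subset[OF g sub(2)] by (rule holomorphic_on_imp_continuous_on)
      show "cmod (g y) \<le> M" if "cmod (x - y) = r / 4" for y
      proof (rule M)
        have "cmod y \<le> cmod x + cmod (x - y)"
          by (metis norm_minus_commute norm_triangle_sub)
        then show "cmod y \<le> r / 2" using x that by simp
      qed
    qed (use r in simp)
    also have "fact 3 * M / (r / 4) ^ 3 = 384 * M / r ^ 3"
      by (simp add: fact_numeral power_divide)
    finally show "cmod ((deriv ^^ Suc 2) g x) \<le> 384 * M / r ^ 3"
      by (simp add: numeral_3_eq_3 numeral_2_eq_2)
  qed (use z r in auto)
  have "(\<Sum>i\<le>2. (deriv ^^ i) g 0 * (z - 0) ^ i / fact i) = g 0 + deriv g 0 * z + (deriv ^^ 2) g 0 / 2 * z\<^sup>2"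
    by (simp add: numeral_2_eq_2)
  moreover have "(384 * M / r ^ 3) * cmod (z - 0) ^ Suc 2 / fact 2 = 192 * M / r ^ 3 * cmod z ^ 3"
    by (simp add: numeral_3_eq_3 numeral_2_eq_2)
  ultimately show ?thesis using * by simp
qed

text \<open>
  Three nonzero arguments determine a quadratic polynomial.
\<close>

lemma quadratic_polynomials_agree:
  fixes a b :: "nat \<Rightarrow> complex"
  assumes "\<And>\<eta>. \<eta> \<noteq> 0 \<Longrightarrow> b 0 + b 1 * \<eta> + b 2 * \<eta>\<^sup>2 = a 2 + a 1 * \<eta> + a 0 * \<eta>\<^sup>2"
  shows "b 0 = a 2"
proof -
  have "b 0 + b 1 + b 2 = a 2 + a 1 + a 0" "b 0 - b 1 + b 2 = a 2 - a 1 + a 0"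
    "b 0 + 2 * b 1 + 4 * b 2 = a 2 + 2 * a 1 + 4 * a 0"
    using assms[of 1] assms[of "-1"] assms[of 2] by (auto simp: mult_ac)
  then have "6 * (b 0 - a 2) = 0" by algebra
  then show ?thesis by simp
qed

text \<open>
  On every complex line through \<open>x\<close> the function is holomorphic in one variable, so it has a
  second-order Taylor expansion along the line, with an error that is uniform in the direction.  It
  remains to see that the second-order coefficient \<open>Q\<close> is a quadratic form.  On a complex line \<open>Q\<close> is a
  locally uniform limit of holomorphic functions, hence entire, and it grows at most quadratically,
  hence is a polynomial of degree at most 2 by Liouville.  Together with homogeneity this gives the
  parallelogram law, and polarisation gives the bilinear form \<open>b\<close>.
\<close>

theorem complex_differentiable_second_order:
  fixes F :: "complex^'n::finite \<Rightarrow> complex"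
  assumes r: "r > 0" and F: "complex_differentiable_on F (ball x r)"
    and D: "(F has_derivative D) (at x)" and Dlin: "\<And>c v. D (c *s v) = c * D v"
  shows "\<exists>b K \<rho>. (\<forall>h k. b h k = b k h) \<and> (\<forall>h k l. b h (k + l) = b h k + b h l) \<and> (\<forall>h c k. b h (c *s k) = c * b h k)
     \<and> 0 < K \<and> 0 < \<rho> \<and> (\<forall>h. norm h < \<rho> \<longrightarrow> cmod (F (x + h) - F x - D h - b h h) \<le> K * norm h ^ 3)"
proof -
  have D0: "D 0 = 0" using Dlin[of 0 0] by simp
  have linD: "linear D" using D by (rule has_derivative_linear)
  obtain M where M: "\<And>y. y \<in> cball x (r / 2) \<Longrightarrow> cmod (F y) \<le> M"
  proof -
    have "continuous_on (cball x (r / 2)) F"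
      using complex_differentiable_on_continuous[OF F] r by (rule_tac continuous_on_subset) auto
    then have "bounded (F ` cball x (r / 2))"
      using compact_continuous_image compact_cball compact_imp_bounded by blast
    then obtain M where "\<forall>y\<in>F ` cball x (r / 2). cmod y \<le> M"
      unfolding bounded_iff by blast
    then show ?thesis using that by blast
  qed
  have M0: "0 \<le> M" using M[of x] r norm_ge_zero order_trans by (metis centre_in_cball half_gt_zero_iff less_eq_real_def)
  \<comment> \<open>The second-order difference quotient on the complex line through x in direction u.\<close>
  define A where "A u t = (F (x + t *s u) - F x - t * D u) / t\<^sup>2" for u t
  define \<rho> where "\<rho> = r / 4"
  define K where "K = 192 * M / r ^ 3 + 1"
  have K: "K > 0" using M0 r by (simp add: K_def add_nonneg_pos)
  have \<rho>: "\<rho> > 0" using r by (simp add: \<rho>_def)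
  define g where "g u \<zeta> = F (x + \<zeta> *s u)" for u \<zeta>
  \<comment> \<open>On unit directions the one-variable Taylor bound has a constant independent of the direction.\<close>
  have unit: "cmod (A u t - (deriv ^^ 2) (g u) 0 / 2) \<le> K * cmod t"
    if u: "norm u \<le> 1" and t: "t \<noteq> 0" "cmod t < \<rho>" for u t
  proof -
    have nu: "cmod \<zeta> * norm u \<le> cmod \<zeta>" for \<zeta> using u by (simp add: mult_left_le)
    have hol: "g u holomorphic_on ball 0 r"
      unfolding g_def by (rule complex_differentiable_on_line[OF F])
        (use nu in \<open>auto simp: dist_norm norm_vec_smult intro: le_less_trans\<close>)
    have bd: "cmod (g u \<zeta>) \<le> M" if "cmod \<zeta> \<le> r / 2" for \<zeta>
      unfolding g_def using that nu[of \<zeta>] by (intro M) (auto simp: dist_norm norm_vec_smult)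
    have "(g u has_field_derivative D u) (at 0)"
    proof -
      have "((\<lambda>\<zeta>. x + \<zeta> *s u) has_derivative (\<lambda>h. h *s u)) (at 0)"
        using has_derivative_add[OF has_derivative_const bounded_linear_imp_has_derivative[OF bounded_linear_smult_left]]
        by fastforce
      moreover have "(F has_derivative D) (at (x + 0 *s u))" using D by simp
      ultimately have "(g u has_derivative (\<lambda>h. h * D u)) (at 0)"
        unfolding g_def Dlin[symmetric] by (rule has_derivative_compose)
      then show ?thesis unfolding has_field_derivative_def mult_commute_abs .
    qed
    then have d: "deriv (g u) 0 = D u" by (rule DERIV_imp_deriv)
    have "cmod (g u t - (g u 0 + deriv (g u) 0 * t + (deriv ^^ 2) (g u) 0 / 2 * t\<^sup>2)) \<le> 192 * M / r ^ 3 * cmod t ^ 3"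
      using t by (intro holomorphic_second_order_Taylor[OF r hol bd]) (auto simp: \<rho>_def)
    also have "\<dots> \<le> K * cmod t ^ 3" by (intro mult_right_mono) (auto simp: K_def)
    finally have le: "cmod (g u t - (g u 0 + deriv (g u) 0 * t + (deriv ^^ 2) (g u) 0 / 2 * t\<^sup>2)) \<le> K * cmod t ^ 3" .
    have "A u t - (deriv ^^ 2) (g u) 0 / 2 = (g u t - (g u 0 + deriv (g u) 0 * t + (deriv ^^ 2) (g u) 0 / 2 * t\<^sup>2)) / t\<^sup>2"
      using t by (simp add: A_def g_def d field_simps del: funpow.simps)
    then have "cmod (A u t - (deriv ^^ 2) (g u) 0 / 2) \<le> K * cmod t ^ 3 / cmod t ^ 2"
      using le by (simp add: norm_divide norm_power divide_right_mono del: funpow.simps)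
    also have "\<dots> = K * cmod t" using t by (simp add: power3_eq_cube power2_eq_square)
    finally show ?thesis .
  qed
  have Ahom: "A (c *s u) t = c\<^sup>2 * A u (c * t)" if "c \<noteq> 0" "t \<noteq> 0" for c u t
    using that by (simp add: A_def Dlin vector_smult_assoc mult.commute field_simps)
  \<comment> \<open>The limit of A u t as t tends to 0, written on the normalised direction so that the
    uniform bound applies; at u = 0 the first factor is 0.\<close>
  define Q where "Q u = (complex_of_real (norm u))\<^sup>2 * ((deriv ^^ 2) (g (inverse (complex_of_real (norm u)) *s u)) 0 / 2)" for u
  have AQ: "cmod (A u t - Q u) \<le> K * norm u ^ 3 * cmod t" if u: "u \<noteq> 0" and t: "t \<noteq> 0" "cmod t * norm u < \<rho>" for u t
  proof -
    define N where "N = complex_of_real (norm u)"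
    define u' where "u' = inverse N *s u"
    have N: "N \<noteq> 0" "cmod N = norm u" using u by (auto simp: N_def)
    have uu: "u = N *s u'" using N by (simp add: u'_def vector_smult_assoc)
    have nu': "norm u' \<le> 1" using N u by (simp add: u'_def norm_vec_smult norm_inverse)
    have "A u t = N\<^sup>2 * A u' (N * t)" using Ahom[OF N(1) t(1), of u'] uu by simp
    moreover have "Q u = N\<^sup>2 * ((deriv ^^ 2) (g u') 0 / 2)" by (simp add: Q_def N_def u'_def)
    ultimately have "cmod (A u t - Q u) = (norm u)\<^sup>2 * cmod (A u' (N * t) - (deriv ^^ 2) (g u') 0 / 2)"
      by (simp only: right_diff_distrib[symmetric] norm_mult norm_power N)
    also have "\<dots> \<le> (norm u)\<^sup>2 * (K * cmod (N * t))"
      using nu' N t by (intro mult_left_mono unit) (auto simp: norm_mult mult.commute)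
    finally show ?thesis by (simp add: norm_mult N power2_eq_square power3_eq_cube mult_ac)
  qed
  have Q0: "Q 0 = 0" by (simp add: Q_def)
  have A0: "A 0 t = 0" for t by (simp add: A_def D0)
  have AQ': "cmod (A u t - Q u) \<le> K * R ^ 3 * cmod t" if "norm u \<le> R" "t \<noteq> 0" "cmod t * R < \<rho>" for u t R
  proof (cases "u = 0")
    case True
    then show ?thesis using that K norm_ge_zero[of u] by (simp add: Q0 A0)
  next
    case False
    have "cmod t * norm u < \<rho>" using that mult_left_mono[OF that(1) norm_ge_zero[of t]] by linarith
    then have "cmod (A u t - Q u) \<le> K * norm u ^ 3 * cmod t" using that False by (intro AQ)
    also have "\<dots> \<le> K * R ^ 3 * cmod t"
      using that K by (intro mult_right_mono mult_left_mono power_mono) auto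
    finally show ?thesis .
  qed
  have limQ: "((\<lambda>t. A u t) \<longlongrightarrow> Q u) (at 0)" for u
  proof -
    have "((\<lambda>t. A u t - Q u) \<longlongrightarrow> 0) (at 0)"
    proof (rule Lim_null_comparison)
      have "\<forall>\<^sub>F t in at 0. cmod t < \<rho> / (norm u + 1) \<and> t \<noteq> 0"
        unfolding eventually_at using \<rho> by (intro exI[of _ "\<rho> / (norm u + 1)"]) (auto simp: add_nonneg_pos)
      then show "\<forall>\<^sub>F t in at 0. cmod (A u t - Q u) \<le> K * (norm u + 1) ^ 3 * cmod t"
        by eventually_elim (intro AQ', auto simp: pos_less_divide_eq add_nonneg_pos)
      have "((\<lambda>t. K * (norm u + 1) ^ 3 * cmod t) \<longlongrightarrow> K * (norm u + 1) ^ 3 * cmod 0) (at 0)"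
        by (intro tendsto_intros)
      then show "((\<lambda>t. K * (norm u + 1) ^ 3 * cmod t) \<longlongrightarrow> 0) (at (0::complex))" by simp
    qed
    then show ?thesis by (simp add: LIM_zero_iff)
  qed
  have Qhom: "Q (c *s u) = c\<^sup>2 * Q u" for c u
  proof (cases "c = 0")
    case True then show ?thesis by (simp add: Q0)
  next
    case False
    have "((\<lambda>t. c * t) \<longlongrightarrow> c * 0) (at 0)" by (intro tendsto_intros)
    moreover have "\<forall>\<^sub>F t in at (0::complex). c * t \<noteq> 0"
      using False eventually_neq_at_within[of 0] by (auto elim: eventually_mono)
    ultimately have "filterlim (\<lambda>t. c * t) (at 0) (at 0)"
      by (simp add: filterlim_at)
    from filterlim_compose[OF limQ this] have "((\<lambda>t. c\<^sup>2 * A u (c * t)) \<longlongrightarrow> c\<^sup>2 * Q u) (at 0)"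
      by (intro tendsto_intros)
    then have "((\<lambda>t. A (c *s u) t) \<longlongrightarrow> c\<^sup>2 * Q u) (at 0)"
    proof (rule Lim_transform_eventually)
      have "\<forall>\<^sub>F t in at (0::complex). t \<noteq> 0"
        by (rule eventually_neq_at_within)
      then show "\<forall>\<^sub>F t in at 0. c\<^sup>2 * A u (c * t) = A (c *s u) t"
        by eventually_elim (simp add: Ahom[OF False])
    qed
    with limQ show ?thesis by (rule tendsto_unique[OF at_neq_bot])
  qed
  obtain K2 where K2: "\<And>u. cmod (Q u) \<le> K2 * (norm u)\<^sup>2" "0 \<le> K2"
  proof -
    define t where "t = complex_of_real (\<rho> / 2)"
    have t: "t \<noteq> 0" "cmod t < \<rho>" using \<rho> by (auto simp: t_def)
    have "cmod (Q u) \<le> (2 * M + cmod t * onorm D) / cmod t ^ 2 + K * cmod t" if "norm u \<le> 1" for u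
    proof -
      have "norm (t *s u) \<le> cmod t" using that by (simp add: norm_vec_smult mult_left_le)
      then have "cmod (F (x + t *s u)) \<le> M" "cmod (F x) \<le> M"
        using t r by (auto intro!: M simp: dist_norm \<rho>_def)
      moreover have "cmod (t * D u) \<le> cmod t * onorm D"
      proof -
        have "cmod (D u) \<le> onorm D * norm u" using D by (intro onorm) (auto intro: has_derivative_bounded_linear)
        also have "\<dots> \<le> onorm D" using that D by (intro mult_right_le_one_le onorm_pos_le) (auto intro: has_derivative_bounded_linear)
        finally show ?thesis by (simp add: norm_mult mult_left_mono)
      qed
      ultimately have "cmod (F (x + t *s u) - F x - t * D u) \<le> 2 * M + cmod t * onorm D"
        using norm_triangle_ineq4[of "F (x + t *s u) - F x" "t * D u"] norm_triangle_ineq4[of "F (x + t *s u)" "F x"] by linarith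
      then have "cmod (A u t) \<le> (2 * M + cmod t * onorm D) / cmod t ^ 2"
        by (simp add: A_def norm_divide norm_power divide_right_mono)
      moreover have "cmod (A u t - Q u) \<le> K * cmod t" using AQ'[of u 1 t] that t by simp
      ultimately show ?thesis
        using norm_triangle_ineq4[of "A u t" "A u t - Q u"] by simp
    qed
    then obtain K2 where K2: "\<And>u. norm u \<le> 1 \<Longrightarrow> cmod (Q u) \<le> K2" by blast
    have "cmod (Q u) \<le> K2 * (norm u)\<^sup>2" for u
    proof (cases "u = 0")
      case False
      define N where "N = complex_of_real (norm u)"
      have N: "N \<noteq> 0" "cmod N = norm u" using False by (auto simp: N_def)
      have "u = N *s (inverse N *s u)" using N by (simp add: vector_smult_assoc)
      then have "Q u = N\<^sup>2 * Q (inverse N *s u)" using Qhom by metis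
      then show ?thesis using K2[of "inverse N *s u"] N False
        by (simp add: norm_mult norm_power norm_vec_smult norm_inverse mult.commute mult_left_mono)
    qed (simp add: Q0)
    moreover have "0 \<le> K2" using K2[of 0] by (simp add: Q0)
    ultimately show ?thesis using that by blast
  qed
  have poly: "\<exists>a. Q h = a 0 \<and> (\<forall>\<zeta>. Q (h + \<zeta> *s k) = a 0 + a 1 * \<zeta> + a (2::nat) * \<zeta>\<^sup>2)" for h k
  proof -
    \<comment> \<open>A locally uniform limit of holomorphic difference quotients is entire; as it grows at
      most quadratically, it is a polynomial of degree at most 2.\<close>
    define q where "q \<zeta> = Q (h + \<zeta> *s k)" for \<zeta>
    have "q holomorphic_on ball 0 N" if N: "N > 0" for N
    proof -
      define R where "R = norm h + N * norm k + 1"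
      have R: "R > 0" using N by (simp add: R_def add_nonneg_pos)
      \<comment> \<open>Steps tending to 0, so short that all points x + t n (h + z k) with |z| < N stay in
        the domain.\<close>
      define t where "t n = complex_of_real (\<rho> / (2 * R) / (real n + 1))" for n :: nat
      have t: "t n \<noteq> 0" "cmod (t n) = \<rho> / (2 * R) / (real n + 1)" for n
        using \<rho> R by (auto simp: t_def norm_divide simp del: of_real_divide)
      have tR: "cmod (t n) * R < \<rho>" for n
      proof -
        have "cmod (t n) * R = \<rho> / 2 / (real n + 1)" using R by (simp add: t)
        also have "\<dots> \<le> \<rho> / 2" using \<rho> by (simp add: divide_le_eq)
        finally show ?thesis using \<rho> by simp
      qed
      have nb: "norm (h + \<zeta> *s k) \<le> R" if "cmod \<zeta> \<le> N" for \<zeta>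
        using norm_triangle_ineq[of h "\<zeta> *s k"] mult_right_mono[OF that norm_ge_zero[of k]]
        by (simp add: R_def norm_vec_smult)
      have t0: "(\<lambda>n. cmod (t n)) \<longlonglongrightarrow> 0"
        unfolding t by real_asymp
      show ?thesis
      proof (rule holomorphic_uniform_sequence[of "ball 0 N" "\<lambda>n \<zeta>. A (h + \<zeta> *s k) (t n)"])
        show "(\<lambda>\<zeta>. A (h + \<zeta> *s k) (t n)) holomorphic_on ball 0 N" for n
        proof -
          have "(\<lambda>\<zeta>. F ((x + t n *s h) + \<zeta> *s (t n *s k))) holomorphic_on ball 0 N"
          proof (rule complex_differentiable_on_line[OF F])
            fix \<zeta> :: complex assume "\<zeta> \<in> ball 0 N"
            then have "norm (h + \<zeta> *s k) \<le> R" by (intro nb) auto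
            then have "cmod (t n) * norm (h + \<zeta> *s k) \<le> cmod (t n) * R" by (intro mult_left_mono) auto
            then have "norm (t n *s (h + \<zeta> *s k)) < r" using tR[of n] r unfolding norm_vec_smult \<rho>_def by linarith
            moreover have "(x + t n *s h) + \<zeta> *s (t n *s k) = x + t n *s (h + \<zeta> *s k)"
              by (simp add: vec_eq_iff algebra_simps)
            moreover have "x + w \<in> ball x r" if "norm w < r" for w
              using that by (simp add: dist_norm)
            ultimately show "(x + t n *s h) + \<zeta> *s (t n *s k) \<in> ball x r" by metis
          qed
          moreover have "A (h + \<zeta> *s k) (t n) = (F ((x + t n *s h) + \<zeta> *s (t n *s k)) - F x - t n * (D h + \<zeta> * D k)) / (t n)\<^sup>2" for \<zeta>
          proof -
            have "x + t n *s (h + \<zeta> *s k) = (x + t n *s h) + \<zeta> *s (t n *s k)"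
              by (simp add: vec_eq_iff algebra_simps)
            moreover have "D (h + \<zeta> *s k) = D h + \<zeta> * D k"
              by (simp only: linear_add[OF linD] Dlin)
            ultimately show ?thesis by (simp only: A_def)
          qed
          ultimately show ?thesis
            by (simp only:) (intro holomorphic_intros, auto simp: t)
        qed
        fix \<zeta> :: complex assume \<zeta>: "\<zeta> \<in> ball 0 N"
        then obtain d where d: "d > 0" "cball \<zeta> d \<subseteq> ball 0 N" using open_contains_cball open_ball by blast
        have "uniform_limit (cball \<zeta> d) (\<lambda>n \<zeta>. A (h + \<zeta> *s k) (t n)) q sequentially"
          unfolding uniform_limit_sequentially_iff
        proof (intro allI impI)
          fix e :: real assume e: "e > 0"
          have "(\<lambda>n. K * R ^ 3 * cmod (t n)) \<longlonglongrightarrow> K * R ^ 3 * 0"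
            by (intro tendsto_intros t0)
          then have "\<forall>\<^sub>F n in sequentially. K * R ^ 3 * cmod (t n) < e"
            using e by (intro order_tendstoD(2)) auto
          then obtain n0 where n0: "\<And>n. n \<ge> n0 \<Longrightarrow> K * R ^ 3 * cmod (t n) < e"
            by (auto simp: eventually_sequentially)
          show "\<exists>N. \<forall>n\<ge>N. \<forall>x\<in>cball \<zeta> d. dist (A (h + x *s k) (t n)) (q x) < e"
          proof (intro exI[of _ n0] allI impI ballI)
            fix n w assume "n \<ge> n0" "w \<in> cball \<zeta> d"
            then have "norm (h + w *s k) \<le> R" using d by (intro nb) auto
            then show "dist (A (h + w *s k) (t n)) (q w) < e"
              using AQ'[of "h + w *s k" R "t n"] t tR n0[OF \<open>n \<ge> n0\<close>] by (simp add: dist_norm q_def)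
          qed
        qed
        then show "\<exists>d>0. cball \<zeta> d \<subseteq> ball 0 N \<and> uniform_limit (cball \<zeta> d) (\<lambda>n \<zeta>. A (h + \<zeta> *s k) (t n)) q sequentially"
          using d by blast
      qed simp
    qed
    then have "q field_differentiable at \<zeta>" for \<zeta>
      using holomorphic_on_imp_differentiable_at[of q "ball 0 (cmod \<zeta> + 1)" \<zeta>] by (simp add: add_nonneg_pos)
    then have "q holomorphic_on UNIV" by (simp add: holomorphic_on_def)
    moreover have "cmod (q \<zeta>) \<le> K2 * (norm h + norm k)\<^sup>2 * cmod \<zeta> ^ 2" if "1 \<le> cmod \<zeta>" for \<zeta>
    proof -
      have "norm (h + \<zeta> *s k) \<le> norm h + cmod \<zeta> * norm k"
        using norm_triangle_ineq[of h "\<zeta> *s k"] by (simp add: norm_vec_smult)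
      also have "norm h \<le> cmod \<zeta> * norm h" using mult_right_mono[OF that norm_ge_zero[of h]] by simp
      finally have "norm (h + \<zeta> *s k) \<le> (norm h + norm k) * cmod \<zeta>" by (simp add: algebra_simps)
      then have "K2 * (norm (h + \<zeta> *s k))\<^sup>2 \<le> K2 * ((norm h + norm k) * cmod \<zeta>)\<^sup>2"
        using K2 by (intro mult_left_mono power_mono) auto
      then show ?thesis using K2(1)[of "h + \<zeta> *s k"] by (simp add: q_def power_mult_distrib mult.assoc)
    qed
    ultimately have "q \<zeta> = (\<Sum>j\<le>2. (deriv ^^ j) q 0 / fact j * \<zeta> ^ j)" for \<zeta>
      by (rule Liouville_polynomial)
    moreover have "(\<Sum>j\<le>2. c j) = c 0 + c 1 + c 2" for c :: "nat \<Rightarrow> complex"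
      by (simp add: numeral_2_eq_2)
    ultimately have "q \<zeta> = (deriv ^^ 0) q 0 / fact 0 * \<zeta> ^ 0 + (deriv ^^ 1) q 0 / fact 1 * \<zeta> ^ 1
        + (deriv ^^ 2) q 0 / fact 2 * \<zeta>\<^sup>2" for \<zeta>
      by (simp only:)
    then have "\<forall>\<zeta>. q \<zeta> = c 0 + c 1 * \<zeta> + c 2 * \<zeta>\<^sup>2" if "c = (\<lambda>j. (deriv ^^ j) q 0 / fact j)" for c
      unfolding that by (simp only: power_0 power_one_right mult_1_right simp_thms)
    then obtain c where c: "\<And>\<zeta>. q \<zeta> = c 0 + c 1 * \<zeta> + c (2::nat) * \<zeta>\<^sup>2" by blast
    have "Q h = q 0" by (simp add: q_def)
    also have "\<dots> = c 0" by (simp add: c)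
    finally show ?thesis
      using c unfolding q_def by blast
  qed
  define b where "b h k = (Q (h + k) - Q h - Q k) / 2" for h k
  \<comment> \<open>The leading coefficient is Q k: homogeneity of degree 2 turns the polynomial around,
    exchanging the roles of h and k.\<close>
  have Qexp: "Q (h + \<zeta> *s k) = Q h + 2 * \<zeta> * b h k + \<zeta>\<^sup>2 * Q k" for h k \<zeta>
  proof -
    from poly[of h k] obtain a where a: "Q h = a 0" "\<And>\<zeta>. Q (h + \<zeta> *s k) = a 0 + a 1 * \<zeta> + a (2::nat) * \<zeta>\<^sup>2" by blast
    from poly[of k h] obtain a' where a': "Q k = a' 0" "\<And>\<zeta>. Q (k + \<zeta> *s h) = a' 0 + a' 1 * \<zeta> + a' (2::nat) * \<zeta>\<^sup>2" by blast
    have "a' 0 + a' 1 * \<eta> + a' 2 * \<eta>\<^sup>2 = a 2 + a 1 * \<eta> + a 0 * \<eta>\<^sup>2" if "\<eta> \<noteq> 0" for \<eta>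
    proof -
      have "k + \<eta> *s h = \<eta> *s (h + inverse \<eta> *s k)" using that by (simp add: vec_eq_iff field_simps)
      then have "Q (k + \<eta> *s h) = \<eta>\<^sup>2 * Q (h + inverse \<eta> *s k)" using Qhom by metis
      moreover have "\<eta>\<^sup>2 * (c0 + c1 * inverse \<eta> + c2 * (inverse \<eta>)\<^sup>2) = c2 + c1 * \<eta> + c0 * \<eta>\<^sup>2" for c0 c1 c2
        using that by (simp add: field_simps power2_eq_square)
      ultimately show ?thesis unfolding a(2) a'(2) by (simp only:)
    qed
    then have "a' 0 = a 2" by (rule quadratic_polynomials_agree)
    then have a2: "a 2 = Q k" by (simp add: a')
    have "2 * b h k = a 1" using a(2)[of 1] by (simp add: b_def a(1) a2)
    then show ?thesis unfolding a(2) by (simp add: a(1)[symmetric] a2 mult_ac)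
  qed
  have bsym: "b h k = b k h" for h k by (simp add: b_def add.commute)
  have bhom: "b h (c *s k) = c * b h k" for h c k
    using Qexp[of h c k] by (simp add: b_def Qhom)
  have bdiff: "b h k = (Q (h + k) - Q (h - k)) / 4" for h k
    using Qexp[of h 1 k] Qexp[of h "-1" k] by (simp add: algebra_simps)
  have par: "Q (h + k) + Q (h - k) = 2 * Q h + 2 * Q k" for h k
    using Qexp[of h 1 k] Qexp[of h "-1" k] by (simp add: algebra_simps)
  have badd: "b h (p + q) = b h p + b h q" for h p q
  proof -
    \<comment> \<open>With p = k + l and q = k - l, additivity is the parallelogram law at h + k and h - k.\<close>
    define k where "k = (1/2 :: complex) *s (p + q)"
    define l where "l = (1/2 :: complex) *s (p - q)"
    have p: "p = k + l" and q: "q = k - l" by (auto simp: k_def l_def vec_eq_iff field_simps)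
    have "h + (k + l) = (h + k) + l" "h - (k + l) = (h - k) - l" "h + (k - l) = (h + k) - l" "h - (k - l) = (h - k) + l"
      by auto
    then have "b h p + b h q = 2 * b h k"
      unfolding p q bdiff using par[of "h + k" l] par[of "h - k" l] by (simp add: field_simps) algebra
    also have "\<dots> = b h (2 *s k)" by (simp add: bhom)
    also have "2 *s k = p + q" by (simp add: k_def vec_eq_iff)
    finally show ?thesis ..
  qed
  have bQ: "b h h = Q h" for h
  proof -
    have "h + h = 2 *s h" by (simp add: vec_eq_iff)
    then have "Q (h + h) = 4 * Q h" using Qhom[of 2 h] by simp
    then show ?thesis by (simp add: b_def)
  qed
  have "cmod (F (x + h) - F x - D h - b h h) \<le> K * norm h ^ 3" if h: "norm h < \<rho>" for h
  proof (cases "h = 0")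
    case True then show ?thesis by (simp add: D0 bQ Q0)
  next
    case False
    have "cmod (A h 1 - Q h) \<le> K * norm h ^ 3 * cmod 1" using h False by (intro AQ) auto
    then show ?thesis by (simp add: A_def bQ)
  qed
  then show ?thesis using bsym badd bhom K \<rho> by blast
qed


section \<open>Zero sets of holomorphic functions\<close>

text \<open>
  By induction on \<open>m\<close>: a vector that separates \<open>D m\<close> from the earlier functionals is corrected by the
  vectors found so far.
\<close>

lemma dual_basis_exists:
  fixes D :: "nat \<Rightarrow> complex^'n::finite \<Rightarrow> complex"
  assumes "\<And>j x y. j < m \<Longrightarrow> D j (x + y) = D j x + D j y" "\<And>j c v. j < m \<Longrightarrow> D j (c *s v) = c * D j v"
    and "\<And>a. (\<And>v. (\<Sum>j<m. a j * D j v) = 0) \<Longrightarrow> \<forall>j<m. a j = 0"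
  shows "\<exists>e. \<forall>i<m. \<forall>j<m. D i (e j) = (if i = j then 1 else 0)"
  using assms
proof (induction m)
  case (Suc m)
  have ind: "\<forall>j<m. a j = 0" if "\<And>v. (\<Sum>j<m. a j * D j v) = 0" for a
    using Suc.prems(3)[of "\<lambda>j. if j < m then a j else 0"] that by simp (metis less_SucI)
  obtain e where e: "\<And>i j. i < m \<Longrightarrow> j < m \<Longrightarrow> D i (e j) = (if i = j then 1 else 0)"
    using Suc.IH[OF _ _ ind] Suc.prems(1,2) by (metis less_SucI)
  have sum: "D i (\<Sum>j<m. c j *s e j) = (\<Sum>j<m. c j * D i (e j))" if "i < Suc m" for i c
  proof -
    have D0: "D i 0 = 0" using Suc.prems(2)[OF that, of 0 0] by simp
    have "D i (\<Sum>j\<in>J. c j *s e j) = (\<Sum>j\<in>J. c j * D i (e j))" if "finite J" for J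
      using that by induction (simp_all add: D0 Suc.prems(1,2)[OF \<open>i < Suc m\<close>])
    then show ?thesis by simp
  qed
  have diff: "D i (x - y) = D i x - D i y" if "i < Suc m" for i x y
    using Suc.prems(1)[OF that, of "x - y" y] by simp
  \<comment> \<open>Otherwise D m would be a combination of the earlier functionals.\<close>
  obtain v where v: "D m v - (\<Sum>j<m. D m (e j) * D j v) \<noteq> 0"
  proof (rule ccontr)
    assume "\<not> thesis"
    then have *: "D m v - (\<Sum>j<m. D m (e j) * D j v) = 0" for v using that by blast
    have "\<forall>j<Suc m. (if j = m then 1 else - D m (e j)) = 0"
    proof (rule Suc.prems(3))
      fix v
      have "(\<Sum>j<m. (if j = m then 1 else - D m (e j)) * D j v) = - (\<Sum>j<m. D m (e j) * D j v)"
        unfolding sum_negf[symmetric] by (intro sum.cong) auto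
      then show "(\<Sum>j<Suc m. (if j = m then 1 else - D m (e j)) * D j v) = 0"
        using *[of v] by simp
    qed
    then show False by (metis lessI zero_neq_one)
  qed
  define q where "q = D m v - (\<Sum>j<m. D m (e j) * D j v)"
  define u where "u = inverse q *s (v - (\<Sum>j<m. D j v *s e j))"
  have "D m u = inverse q * (D m v - (\<Sum>j<m. D j v * D m (e j)))"
    unfolding u_def by (simp add: Suc.prems(2) diff sum right_diff_distrib)
  also have "\<dots> = inverse q * q"
    by (simp add: q_def mult.commute)
  finally have um: "D m u = 1"
    using v by (simp add: q_def)
  have ui: "D i u = 0" if "i < m" for i
  proof -
    have "(\<Sum>j<m. D j v * D i (e j)) = (\<Sum>j<m. if j = i then D j v else 0)"
      using e[OF that] by (intro sum.cong) auto
    also have "\<dots> = D i v" using that by simp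
    finally show ?thesis using that by (simp add: u_def Suc.prems(2) diff sum)
  qed
  define e' where "e' j = (if j = m then u else e j - D m (e j) *s u)" for j
  have "D i (e' j) = (if i = j then 1 else 0)" if "i < Suc m" "j < Suc m" for i j
    using that um ui e by (auto simp: e'_def diff Suc.prems(2) less_Suc_eq)
  then show ?case by blast
qed simp

text \<open>
  The holomorphic implicit function theorem to second order.  The tangent space is the common kernel
  \<open>W\<close> of the differentials; if the \<open>e j\<close> are dual to the differentials and \<open>b j\<close> is the second-order
  term of \<open>F j\<close>, then \<open>- (\<Sum>j<m. b j w w *s e j)\<close> is the displacement that makes all \<open>F j\<close> vanish to
  second order.  That there are points of \<open>C\<close> over every small \<open>w\<close> follows from Brouwer's fixed point
  theorem.  Since \<open>b j\<close> is complex bilinear, the sign condition of complex contact holds.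
\<close>

theorem zero_set_quadratic_contact:
  fixes F :: "nat \<Rightarrow> complex^'n::finite \<Rightarrow> complex"
  assumes r: "r > 0"
    and F: "\<And>j. j < m \<Longrightarrow> complex_differentiable_on (F j) (ball x r)"
    and Fx: "\<And>j. j < m \<Longrightarrow> F j x = 0"
    and D: "\<And>j. j < m \<Longrightarrow> (F j has_derivative D j) (at x)"
    and Dlin: "\<And>j c v. j < m \<Longrightarrow> D j (c *s v) = c * D j v"
    and ind: "\<And>a. (\<And>v. (\<Sum>j<m. a j * D j v) = 0) \<Longrightarrow> \<forall>j<m. a j = 0"
    and C: "\<And>y. y \<in> ball x r \<Longrightarrow> y \<in> C \<longleftrightarrow> (\<forall>j<m. F j y = 0)"
  shows "complex_quadratic_contact ((*s) \<i>) (2 * m) C x"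
proof -
  have linD: "linear (D j)" if "j < m" for j using D[OF that] by (rule has_derivative_linear)
  have Dadd: "D j (u + w) = D j u + D j w" if "j < m" for j u w
    using linD[OF that] by (rule linear_add)
  obtain e where e: "\<And>i j. i < m \<Longrightarrow> j < m \<Longrightarrow> D i (e j) = (if i = j then 1 else 0)"
    using dual_basis_exists[of m D, OF Dadd Dlin ind] by metis
  \<comment> \<open>The Taylor data of F j packed into one triple, so that they can be chosen for all j at once.\<close>
  define good where "good j p \<longleftrightarrow> (\<forall>h k. fst p h k = fst p k h) \<and> (\<forall>h k l. fst p h (k + l) = fst p h k + fst p h l)
      \<and> (\<forall>h c k. fst p h (c *s k) = c * fst p h k) \<and> 0 < fst (snd p) \<and> 0 < snd (snd p) \<and>
      (\<forall>h. norm h < snd (snd p) \<longrightarrow> cmod (F j (x + h) - F j x - D j h - fst p h h) \<le> fst (snd p) * norm h ^ 3)"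
    for j and p :: "(complex^'n \<Rightarrow> complex^'n \<Rightarrow> complex) \<times> real \<times> real"
  have "\<exists>p. good j p" if j: "j < m" for j
  proof -
    from complex_differentiable_second_order[OF r F[OF j] D[OF j] Dlin[OF j]] obtain b K \<rho>
      where "(\<forall>h k. b h k = b k h) \<and> (\<forall>h k l. b h (k + l) = b h k + b h l) \<and> (\<forall>h c k. b h (c *s k) = c * b h k)
       \<and> 0 < K \<and> 0 < \<rho> \<and> (\<forall>h. norm h < \<rho> \<longrightarrow> cmod (F j (x + h) - F j x - D j h - b h h) \<le> K * norm h ^ 3)"
      by (elim exE)
    then have "good j (b, K, \<rho>)" unfolding good_def fst_conv snd_conv by simp
    then show ?thesis ..
  qed
  then obtain P where P: "\<And>j. j < m \<Longrightarrow> good j (P j)" by metis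
  define b where "b j = fst (P j)" for j
  define Kf where "Kf j = fst (snd (P j))" for j
  define \<rho>f where "\<rho>f j = snd (snd (P j))" for j
  have bsym: "b j h k = b j k h" and badd: "b j h (k + l) = b j h k + b j h l" and bhom: "b j h (c *s k) = c * b j h k"
    and Kf: "0 < Kf j" and \<rho>f: "0 < \<rho>f j"
    and Tay: "norm h < \<rho>f j \<Longrightarrow> cmod (F j (x + h) - D j h - b j h h) \<le> Kf j * norm h ^ 3"
    if "j < m" for j h k l c
    using P[OF that] Fx[OF that] by (auto simp: good_def b_def Kf_def \<rho>f_def)
  have badd': "b j (k + l) h = b j k h + b j l h" and bhom': "b j (c *s k) h = c * b j k h" if "j < m" for j h k l c
    using badd[OF that, of h k l] bhom[OF that, of h c k] bsym[OF that, of _ h] by auto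
  have bil: "bilinear (b j)" if "j < m" for j
    unfolding bilinear_def using badd[OF that] badd'[OF that] bhom[OF that] bhom'[OF that]
    by (auto intro!: linearI simp: scaleR_eq_smult scaleR_conv_of_real[where 'a=complex])
  define \<rho> where "\<rho> = Min (insert r (\<rho>f ` {..<m}))"
  have \<rho>: "\<rho> > 0" "\<rho> \<le> r" "\<And>j. j < m \<Longrightarrow> \<rho> \<le> \<rho>f j"
    using r \<rho>f by (auto simp: \<rho>_def)
  define K0 where "K0 = (\<Sum>j<m. Kf j)"
  have K0: "K0 \<ge> 0" "\<And>j. j < m \<Longrightarrow> Kf j \<le> K0"
    using Kf by (auto simp: K0_def less_imp_le intro!: sum_nonneg member_le_sum)
  have "\<forall>j\<in>{..<m}. \<exists>k>0. \<forall>u w. cmod (b j u w) \<le> k * norm u * norm w"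
    using bilinear_bounded_pos[OF bil] by (metis lessThan_iff)
  from bchoice[OF this] obtain kb where kb: "\<And>j. j < m \<Longrightarrow> kb j > 0" "\<And>j u w. j < m \<Longrightarrow> cmod (b j u w) \<le> kb j * norm u * norm w"
    by auto
  define KB where "KB = (\<Sum>j<m. kb j)"
  have KB0: "KB \<ge> 0" using kb(1) by (auto simp: KB_def less_imp_le intro!: sum_nonneg)
  have KB: "cmod (b j u w) \<le> KB * norm u * norm w" if "j < m" for j u w
  proof -
    have "kb j \<le> KB"
      using kb(1) that by (auto simp: KB_def less_imp_le intro!: member_le_sum)
    then have "kb j * norm u * norm w \<le> KB * norm u * norm w"
      by (intro mult_right_mono) auto
    then show ?thesis using kb(2)[OF that, of u w] by linarith
  qed
  define E where "E = (\<Sum>j<m. norm (e j))"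
  have E0: "E \<ge> 0" by (simp add: E_def sum_nonneg)
  have Esum: "norm (\<Sum>j<m. c j *s e j) \<le> E * M" if "\<And>j. j < m \<Longrightarrow> cmod (c j) \<le> M" for c M
  proof -
    have "norm (\<Sum>j<m. c j *s e j) \<le> (\<Sum>j<m. M * norm (e j))"
      using that by (intro sum_norm_le) (auto simp: norm_vec_smult intro!: mult_right_mono)
    then show ?thesis by (simp add: E_def sum_distrib_left[symmetric] mult.commute)
  qed
  have Dsum: "D i (\<Sum>j<m. c j *s e j) = c i" if "i < m" for i c
  proof -
    have "D i (\<Sum>j<m. c j *s e j) = (\<Sum>j<m. c j * D i (e j))"
      using that by (simp add: linear_sum[OF linD] Dlin)
    also have "\<dots> = (\<Sum>j<m. if j = i then c j else 0)"
      using e[OF that] by (intro sum.cong) auto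
    finally show ?thesis using that by simp
  qed
  \<comment> \<open>The projection along W onto the complement spanned by the e j.\<close>
  define \<Phi> where "\<Phi> h = (\<Sum>j<m. D j h *s e j)" for h
  have D\<Phi>: "D i (\<Phi> h) = D i h" if "i < m" for i h
    unfolding \<Phi>_def using that by (rule Dsum)
  have \<Phi>sum: "\<Phi> (\<Sum>j<m. c j *s e j) = (\<Sum>j<m. c j *s e j)" for c
    unfolding \<Phi>_def by (intro sum.cong refl) (simp add: Dsum)
  define W where "W = {w. \<forall>j<m. D j w = 0}"
  define \<Gamma> where "\<Gamma> u w = - (\<Sum>j<m. b j u w *s e j)" for u w
  have W: "subspace W"
    unfolding subspace_def W_def by (auto simp: Dadd linear_0[OF linD] Dlin scaleR_eq_smult)
  have \<Gamma>bil: "bilinear \<Gamma>"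
    unfolding bilinear_def \<Gamma>_def
    by (auto intro!: linearI simp: badd badd' bhom bhom' scaleR_eq_smult sum.distrib vec.scale_left_distrib
        vec.scale_sum_right vector_smult_assoc cong: sum.cong_simp)
  have \<Gamma>sym: "\<Gamma> u w = \<Gamma> w u" for u w
    unfolding \<Gamma>_def by (auto intro!: sum.cong simp: bsym)
  define K1 where "K1 = E * (KB + K0)"
  have K1: "K1 \<ge> 0" using E0 KB0 K0 by (simp add: K1_def)
  define \<epsilon> where "\<epsilon> = min \<rho> (min 1 (1 / (2 * K1 + 1)))"
  have \<epsilon>: "\<epsilon> > 0" "\<epsilon> \<le> \<rho>" "\<epsilon> \<le> 1" "2 * K1 * \<epsilon> \<le> 1"
  proof -
    have "\<epsilon> \<le> 1 / (2 * K1 + 1)" by (simp add: \<epsilon>_def)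
    then have "\<epsilon> * (2 * K1 + 1) \<le> 1" using K1 by (simp add: pos_le_divide_eq)
    moreover show "\<epsilon> > 0" using \<rho> K1 by (simp add: \<epsilon>_def)
    ultimately show "2 * K1 * \<epsilon> \<le> 1" by (simp add: algebra_simps)
  qed (auto simp: \<epsilon>_def)
  define K2 where "K2 = K0 + KB * K1 * (2 + K1)"
  have K2: "K2 \<ge> 0" using K0 KB0 K1 by (simp add: K2_def)
  define K where "K = 1 + K1 + 8 * E * K2"
  have K: "K > 0" "1 + K1 \<le> K" "8 * E * K2 \<le> K" using K1 E0 K2 by (auto simp: K_def add_pos_nonneg)
  have Tay': "cmod (F j (x + h) - D j h - b j h h) \<le> K0 * norm h ^ 3" if "j < m" "norm h < \<rho>" for j h
  proof -
    have "cmod (F j (x + h) - D j h - b j h h) \<le> Kf j * norm h ^ 3"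
      using that \<rho>(3)[OF that(1)] by (intro Tay) auto
    also have "\<dots> \<le> K0 * norm h ^ 3" using K0(2)[OF that(1)] by (intro mult_right_mono) auto
    finally show ?thesis .
  qed
  have DF: "cmod (D j h - F j (x + h)) \<le> (KB + K0) * (norm h)\<^sup>2" if "j < m" "norm h < \<epsilon>" for j h
  proof -
    have h3: "norm h ^ 3 \<le> (norm h)\<^sup>2"
      using power_decreasing[of 2 3 "norm h"] that \<epsilon> by simp
    have "cmod (F j (x + h) - D j h) \<le> cmod (F j (x + h) - D j h - b j h h) + cmod (b j h h)"
      by (rule norm_triangle_sub[of "F j (x + h) - D j h" "b j h h", unfolded add.commute[of "cmod (b j h h)"]])
    also have "\<dots> \<le> K0 * norm h ^ 3 + KB * norm h * norm h"
      using Tay'[OF that(1), of h] KB[OF that(1), of h h] that \<epsilon> by linarith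
    also have "\<dots> \<le> K0 * (norm h)\<^sup>2 + KB * norm h * norm h"
      using h3 K0 by (intro add_right_mono mult_left_mono) auto
    finally show ?thesis by (simp add: norm_minus_commute algebra_simps power2_eq_square)
  qed
  \<comment> \<open>Points of C: the complementary part of h is quadratically small, and the equations
    determine it up to third order.\<close>
  have est: "h - \<Phi> h \<in> W \<and> norm (h - \<Phi> h) \<le> K * norm h \<and>
      norm (h - (h - \<Phi> h) - \<Gamma> (h - \<Phi> h) (h - \<Phi> h)) \<le> K * norm (h - \<Phi> h) ^ 3"
    if h: "norm h < \<epsilon>" and hC: "x + h \<in> C" for h
  proof -
    have "x + h \<in> ball x r" using h \<epsilon> \<rho> by (simp add: dist_norm)
    then have F0: "F j (x + h) = 0" if "j < m" for j using C hC that by blast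
    define w where "w = h - \<Phi> h"
    have wW: "w \<in> W" unfolding w_def W_def by (auto simp: linear_diff[OF linD] D\<Phi>)
    have \<Phi>h: "norm (\<Phi> h) \<le> K1 * (norm h)\<^sup>2"
      using Esum[of "\<lambda>j. D j h" "(KB + K0) * (norm h)\<^sup>2"] DF[OF _ h] F0 by (simp add: \<Phi>_def K1_def mult.assoc)
    also have "\<dots> \<le> K1 * (norm h * 1)"
      unfolding power2_eq_square using h \<epsilon> K1 by (intro mult_left_mono) auto
    finally have \<Phi>1: "norm (\<Phi> h) \<le> K1 * norm h" by simp
    have wh: "norm w \<le> (1 + K1) * norm h"
      using norm_triangle_ineq4[of h "\<Phi> h"] \<Phi>1 by (simp add: w_def algebra_simps)
    have "K1 * norm h \<le> K1 * \<epsilon>" using h K1 by (intro mult_left_mono) auto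
    then have "K1 * norm h \<le> 1 / 2" using \<epsilon>(4) by linarith
    then have "K1 * norm h * norm h \<le> 1 / 2 * norm h" by (intro mult_right_mono) auto
    then have "norm (\<Phi> h) \<le> norm h / 2" using \<Phi>h by (simp add: power2_eq_square mult.assoc)
    then have hw: "norm h \<le> 2 * norm w"
      using norm_triangle_ineq2[of h "\<Phi> h"] by (simp add: w_def)
    have coeff: "cmod (D j h + b j w w) \<le> K2 * norm h ^ 3" if j: "j < m" for j
    proof -
      have "b j (h - w) (h + w) = b j h h - b j w w"
        using bilinear_lsub[OF bil[OF j]] badd[OF j] bsym[OF j, of h w] by simp
      then have "D j h + b j w w = - (F j (x + h) - D j h - b j h h) - b j (h - w) (h + w)"
        using F0[OF j] by simp
      then have "cmod (D j h + b j w w) \<le> cmod (F j (x + h) - D j h - b j h h) + cmod (b j (h - w) (h + w))"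
        using norm_triangle_ineq4[of "- (F j (x + h) - D j h - b j h h)" "b j (h - w) (h + w)"]
        by (simp only: norm_minus_cancel)
      moreover have "cmod (F j (x + h) - D j h - b j h h) \<le> K0 * norm h ^ 3"
        using Tay'[OF j] h \<epsilon> by simp
      moreover have "cmod (b j (h - w) (h + w)) \<le> KB * K1 * (2 + K1) * norm h ^ 3"
      proof -
        have "norm (h - w) \<le> K1 * (norm h)\<^sup>2" using \<Phi>h by (simp add: w_def)
        moreover have "norm (h + w) \<le> (2 + K1) * norm h"
          using norm_triangle_ineq[of h w] wh by (simp add: algebra_simps)
        ultimately have "norm (h - w) * norm (h + w) \<le> (K1 * (norm h)\<^sup>2) * ((2 + K1) * norm h)"
          using K1 by (intro mult_mono) auto
        then have "KB * (norm (h - w) * norm (h + w)) \<le> KB * ((K1 * (norm h)\<^sup>2) * ((2 + K1) * norm h))"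
          using KB0 by (intro mult_left_mono)
        then show ?thesis
          using KB[OF j, of "h - w" "h + w"] by (simp add: power2_eq_square power3_eq_cube mult_ac)
      qed
      ultimately show ?thesis by (simp add: K2_def algebra_simps)
    qed
    have "h - w - \<Gamma> w w = (\<Sum>j<m. (D j h + b j w w) *s e j)"
      by (simp add: w_def \<Phi>_def \<Gamma>_def sum.distrib vec.scale_left_distrib)
    then have "norm (h - w - \<Gamma> w w) \<le> E * (K2 * norm h ^ 3)"
      using Esum[of "\<lambda>j. D j h + b j w w", OF coeff] by simp
    also have "\<dots> \<le> E * (K2 * (2 * norm w) ^ 3)"
      using hw E0 K2 by (intro mult_left_mono power_mono) auto
    also have "\<dots> = (8 * E * K2) * norm w ^ 3"
      by (simp add: power_mult_distrib)
    also have "\<dots> \<le> K * norm w ^ 3" using K(3) by (intro mult_right_mono) auto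
    finally have "norm (h - w - \<Gamma> w w) \<le> K * norm w ^ 3" .
    moreover have "norm w \<le> K * norm h"
      using wh mult_right_mono[OF K(2) norm_ge_zero[of h]] by linarith
    ultimately show ?thesis using wW by (simp add: w_def)
  qed
  have ex: "\<exists>y\<in>C. norm (y - x - w - \<Gamma> w w) \<le> K * norm w ^ 3" if w: "w \<in> W" and wn: "norm w < \<epsilon> / 2" for w
  proof -
    \<comment> \<open>Points over w: a zero x + w + g of all F j with g in the complement is a fixed point of T,
      and T maps a small ball of the complement to itself.\<close>
    define S where "S = {g. \<Phi> g = g} \<inter> cball 0 (norm w)"
    define T where "T g = g - (\<Sum>j<m. F j (x + (w + g)) *s e j)" for g
    have lin\<Phi>: "linear \<Phi>"
      by (rule linearI) (auto simp: \<Phi>_def Dadd Dlin scaleR_eq_smult sum.distrib vec.scale_left_distrib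
          vec.scale_sum_right vector_smult_assoc cong: sum.cong_simp)
    have sub: "subspace {g. \<Phi> g = g}"
      unfolding subspace_def by (auto simp: linear_0[OF lin\<Phi>] linear_add[OF lin\<Phi>] linear_cmul[OF lin\<Phi>])
    have cS: "compact S"
      unfolding S_def by (intro closed_Int_compact closed_subspace sub compact_cball)
    have convS: "convex S"
      unfolding S_def by (intro convex_Int subspace_imp_convex sub convex_cball)
    have "0 \<in> S" by (auto simp: S_def linear_0[OF lin\<Phi>])
    have small: "norm (w + g) < \<epsilon>" "norm (w + g) \<le> 2 * norm w" if "g \<in> S" for g
      using that norm_triangle_ineq[of w g] wn by (auto simp: S_def)
    have inb: "x + (w + g) \<in> ball x r" if "g \<in> S" for g
    proof -
      have "x + u \<in> ball x r" if "norm u < \<epsilon>" for u using that \<epsilon> \<rho> by (simp add: dist_norm)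
      then show ?thesis using small(1)[OF that] by blast
    qed
    have DW: "D j (w + g) = D j g" if "j < m" for j g using w that by (simp add: W_def Dadd)
    have "continuous_on S T"
      unfolding T_def
    proof (intro continuous_intros)
      fix j assume "j \<in> {..<m}"
      then have "continuous_on (ball x r) (F j)" using F complex_differentiable_on_continuous by blast
      then have "continuous_on S (\<lambda>g. F j (x + (w + g)))"
        by (rule continuous_on_compose2) (auto intro!: continuous_intros inb simp del: mem_ball)
      then show "continuous_on S (\<lambda>g. F j (x + (w + g)) *s e j)"
        by (rule bounded_linear.continuous_on[OF bounded_linear_smult_left])
    qed
    moreover have "T g \<in> S" if g: "g \<in> S" for g
    proof -
      have "T g = \<Phi> g - (\<Sum>j<m. F j (x + (w + g)) *s e j)" using g by (simp add: T_def S_def)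
      also have "\<dots> = (\<Sum>j<m. (D j (w + g) - F j (x + (w + g))) *s e j)"
        by (simp add: \<Phi>_def DW sum_subtractf vec.scale_left_diff_distrib cong: sum.cong_simp)
      finally have T: "T g = (\<Sum>j<m. (D j (w + g) - F j (x + (w + g))) *s e j)" .
      have "norm (T g) \<le> E * ((KB + K0) * (norm (w + g))\<^sup>2)"
        unfolding T by (intro Esum DF small(1)[OF g])
      also have "\<dots> = K1 * (norm (w + g))\<^sup>2" by (simp add: K1_def)
      also have "\<dots> \<le> K1 * (2 * norm w)\<^sup>2"
        using small(2)[OF g] K1 by (intro mult_left_mono power_mono) auto
      also have "\<dots> = (4 * K1 * norm w) * norm w" by (simp add: power2_eq_square)
      also have "\<dots> \<le> 1 * norm w"
      proof (intro mult_right_mono)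
        have "K1 * norm w \<le> K1 * (\<epsilon> / 2)" using wn K1 by (intro mult_left_mono) auto
        then show "4 * K1 * norm w \<le> 1" using \<epsilon>(4) by linarith
      qed simp
      finally have "norm (T g) \<le> norm w" by simp
      moreover have "\<Phi> (T g) = T g" unfolding T by (rule \<Phi>sum)
      ultimately show ?thesis by (simp add: S_def)
    qed
    ultimately obtain g where g: "g \<in> S" "T g = g"
      using brouwer[OF cS convS, of T] \<open>0 \<in> S\<close> by blast
    then have "(\<Sum>j<m. F j (x + (w + g)) *s e j) = 0" by (simp add: T_def)
    then have "F i (x + (w + g)) = 0" if "i < m" for i
      using Dsum[OF that, of "\<lambda>j. F j (x + (w + g))"] linear_0[OF linD[OF that]] by simp
    then have inC: "x + (w + g) \<in> C" using C[OF inb[OF g(1)]] by blast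
    have "\<Phi> (w + g) = \<Phi> g" unfolding \<Phi>_def by (intro sum.cong) (auto simp: DW)
    then have "(w + g) - \<Phi> (w + g) = w" using g(1) by (simp add: S_def)
    then have "norm ((w + g) - w - \<Gamma> w w) \<le> K * norm w ^ 3"
      using est[OF small(1)[OF g(1)] inC] by metis
    then show ?thesis using inC by (intro bexI[of _ "x + (w + g)"]) (auto simp: algebra_simps)
  qed
  have "\<forall>y\<in>C. norm (y - x) < \<epsilon> / 2 \<longrightarrow>
      (\<exists>w\<in>W. norm w \<le> K * norm (y - x) \<and> norm (y - x - w - \<Gamma> w w) \<le> K * norm w ^ 3)"
  proof (intro ballI impI)
    fix y assume "y \<in> C" "norm (y - x) < \<epsilon> / 2"
    then show "\<exists>w\<in>W. norm w \<le> K * norm (y - x) \<and> norm (y - x - w - \<Gamma> w w) \<le> K * norm w ^ 3"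
      using est[of "y - x"] \<epsilon> by (intro bexI[of _ "(y - x) - \<Phi> (y - x)"]) auto
  qed
  moreover have "\<forall>w\<in>W. norm w < \<epsilon> / 2 \<longrightarrow> (\<exists>y\<in>C. norm (y - x - w - \<Gamma> w w) \<le> K * norm w ^ 3)"
    using ex by blast
  moreover have "0 < \<epsilon> / 2" using \<epsilon> by simp
  ultimately have "quadratic_contact C x W \<Gamma>"
    unfolding quadratic_contact_def using W \<Gamma>bil \<Gamma>sym K(1) by blast
  moreover have "DIM(complex^'n) \<le> dim W + 2 * m"
  proof -
    obtain B where B: "B \<subseteq> W" "independent B" "W \<subseteq> span B" "card B = dim W"
      using basis_exists by blast
    \<comment> \<open>The vectors e j and i e j span a complement of W.\<close>
    define G where "G = e ` {..<m} \<union> (\<lambda>j. \<i> *s e j) ` {..<m}"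
    have "v \<in> span (B \<union> G)" for v
    proof -
      have "v - \<Phi> v \<in> W" by (auto simp: W_def linear_diff[OF linD] D\<Phi>)
      then have "v - \<Phi> v \<in> span (B \<union> G)" using B span_mono[of B "B \<union> G"] by blast
      moreover have "\<Phi> v \<in> span (B \<union> G)"
        unfolding \<Phi>_def
      proof (intro span_sum)
        fix j assume j: "j \<in> {..<m}"
        have "D j v *s e j = Re (D j v) *\<^sub>R e j + Im (D j v) *\<^sub>R (\<i> *s e j)"
          by (simp add: vec_eq_iff scaleR_conv_of_real[where 'a=complex] complex_eq_iff)
        moreover have "e j \<in> span (B \<union> G)" "\<i> *s e j \<in> span (B \<union> G)"
          using j by (auto simp: G_def intro!: span_base)
        ultimately show "D j v *s e j \<in> span (B \<union> G)"
          by (simp only: span_add span_scale)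
      qed
      ultimately show ?thesis using span_add by fastforce
    qed
    then have "(UNIV :: (complex^'n) set) \<subseteq> span (B \<union> G)" by auto
    moreover have "finite (B \<union> G)" using B independent_imp_finite by (auto simp: G_def)
    ultimately have "DIM(complex^'n) \<le> card (B \<union> G)"
      using dim_le_card[of UNIV "B \<union> G"] by (simp add: dim_UNIV)
    also have "\<dots> \<le> card B + card G" by (rule card_Un_le)
    also have "card G \<le> m + m"
      unfolding G_def using card_image_le[of "{..<m}" e] card_image_le[of "{..<m}" "\<lambda>j. \<i> *s e j"]
      by (intro order_trans[OF card_Un_le] add_mono) auto
    finally show ?thesis using B by simp
  qed
  moreover have "\<i> *s w \<in> W" if "w \<in> W" for w using that by (auto simp: W_def Dlin)
  moreover have "\<Gamma> (\<i> *s w) (\<i> *s w) = - \<Gamma> w w" for w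
    by (simp add: \<Gamma>_def bhom bhom' sum_negf mult.assoc[symmetric] cong: sum.cong_simp)
  ultimately show ?thesis
    unfolding complex_quadratic_contact_def by blast
qed


section \<open>Lines and Hermitian products\<close>

lemma span_line: "z \<noteq> 0 \<Longrightarrow> vec.subspace (vec.span {z}) \<and> vec.dim (vec.span {z :: complex^'n}) = 1"
proof -
  assume "z \<noteq> 0"
  then have "vec.independent {z}" by (simp add: vec.dependent_single)
  then show ?thesis by (simp add: vec.dim_span_eq_card_independent)
qed

lemma line_of_proj: "z \<noteq> 0 \<Longrightarrow> line_of (proj z) = range (\<lambda>c. c *s z)"
  using span_line[of z] by (simp add: proj_def cproj_of_line_inverse vec.span_singleton)

lemma proj_surj:
  obtains z where "z \<noteq> 0" "p = proj z"
proof -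
  have l: "vec.subspace (line_of p)" "vec.dim (line_of p) = 1"
    using line_of[of p] by auto
  obtain B where B: "B \<subseteq> line_of p" "vec.independent B" "line_of p \<subseteq> vec.span B" "card B = vec.dim (line_of p)"
    using vec.basis_exists by blast
  then obtain z where z: "B = {z}" using l card_1_singletonE by metis
  have "z \<noteq> 0" using B z by (auto simp: vec.dependent_single)
  moreover have "line_of p = vec.span {z}"
    using B z vec.span_minimal[of B "line_of p"] l by auto
  ultimately show ?thesis using that[of z] by (metis line_of_inverse proj_def)
qed

lemma proj_smult: "c \<noteq> 0 \<Longrightarrow> z \<noteq> 0 \<Longrightarrow> proj (c *s z) = proj z"
proof -
  assume c: "c \<noteq> 0" and z: "z \<noteq> 0"
  have "range (\<lambda>d. d *s (c *s z)) = range (\<lambda>d. d *s z)"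
  proof (intro equalityI subsetI)
    fix x assume "x \<in> range (\<lambda>d. d *s z)"
    then obtain d where "x = d *s z" by auto
    then have "x = (d / c) *s (c *s z)" using c by (simp add: vector_smult_assoc)
    then show "x \<in> range (\<lambda>d. d *s (c *s z))" by (rule range_eqI)
  qed (auto simp: vector_smult_assoc)
  then have "line_of (proj (c *s z)) = line_of (proj z)"
    using c z by (simp add: line_of_proj)
  then show ?thesis by (simp add: line_of_inject)
qed

lemma proj_eqD: "proj z = proj w \<Longrightarrow> z \<noteq> 0 \<Longrightarrow> w \<noteq> 0 \<Longrightarrow> \<exists>c. c \<noteq> 0 \<and> z = c *s w"
proof -
  assume p: "proj z = proj w" "z \<noteq> 0" "w \<noteq> 0"
  have "z \<in> range (\<lambda>c. c *s z)" by (rule range_eqI[of _ _ 1]) simp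
  then have "z \<in> range (\<lambda>c. c *s w)" using p by (metis line_of_proj)
  then show ?thesis using p(2) by auto
qed

lemma hermitian_add: "hermitian (u + v) w = hermitian u w + hermitian v w"
  and hermitian_smult: "hermitian (c *s v) w = c * hermitian v w"
  and hermitian_diff: "hermitian (u - v) w = hermitian u w - hermitian v w"
  and hermitian_add_right: "hermitian w (u + v) = hermitian w u + hermitian w v"
  and hermitian_smult_right: "hermitian w (c *s v) = cnj c * hermitian w v"
  and hermitian_diff_right: "hermitian w (u - v) = hermitian w u - hermitian w v"
  by (simp_all add: hermitian_def algebra_simps sum.distrib sum_subtractf sum_distrib_left)

lemma cnj_hermitian: "cnj (hermitian v w) = hermitian w v"
  by (simp add: hermitian_def mult.commute)

lemma Re_hermitian: "Re (hermitian v w) = v \<bullet> w"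
  by (simp add: hermitian_def inner_vec_def inner_complex_def)

lemma hermitian_self: "hermitian v v = complex_of_real ((norm v)\<^sup>2)"
proof -
  have "Im (hermitian v v) = 0" using cnj_hermitian[of v v] by (metis Reals_cnj_iff complex_is_Real_iff)
  then show ?thesis by (simp add: complex_eq_iff Re_hermitian power2_norm_eq_inner)
qed

lemma norm_diff_projection:
  assumes "w \<noteq> 0"
  shows "(norm (z - (hermitian z w / hermitian w w) *s w))\<^sup>2 = (norm z)\<^sup>2 - (cmod (hermitian z w))\<^sup>2 / (norm w)\<^sup>2"
proof -
  define a where "a = hermitian z w"
  define N where "N = complex_of_real ((norm w)\<^sup>2)"
  have N: "N \<noteq> 0" using assms by (simp add: N_def)
  have "complex_of_real ((norm (z - (a / N) *s w))\<^sup>2) = hermitian z z - cnj (a / N) * a - (a / N) * (cnj a - cnj (a / N) * N)"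
    unfolding hermitian_self[symmetric] hermitian_diff hermitian_diff_right hermitian_smult hermitian_smult_right
    by (simp add: a_def cnj_hermitian N_def hermitian_self right_diff_distrib)
  also have "cnj (a / N) * N = cnj a" using N by (simp add: N_def)
  also have "cnj (a / N) * a = complex_of_real ((cmod a)\<^sup>2 / (norm w)\<^sup>2)"
    using complex_norm_square[of a] by (simp add: N_def mult.commute)
  finally have "complex_of_real ((norm (z - (a / N) *s w))\<^sup>2) = complex_of_real ((norm z)\<^sup>2 - (cmod a)\<^sup>2 / (norm w)\<^sup>2)"
    by (simp add: hermitian_self)
  then show ?thesis
    unfolding of_real_eq_iff by (simp add: a_def N_def hermitian_self)
qed

lemma hermitian_Cauchy_Schwarz: "cmod (hermitian z w) \<le> norm z * norm w"
proof (cases "w = 0")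
  case True then show ?thesis by (simp add: hermitian_def)
next
  case False
  have "0 \<le> (norm z)\<^sup>2 - (cmod (hermitian z w))\<^sup>2 / (norm w)\<^sup>2"
    unfolding norm_diff_projection[OF False, symmetric] by simp
  then have "(cmod (hermitian z w))\<^sup>2 \<le> (norm z * norm w)\<^sup>2"
    using False by (simp add: field_simps power_mult_distrib)
  then show ?thesis by (rule power2_le_imp_le) simp
qed

text \<open>
  The left-hand side is the squared distance of \<open>z\<close> from the complex line of \<open>w\<close>.
\<close>

lemma projection_le_norm_diff:
  assumes "w \<noteq> 0"
  shows "(norm z)\<^sup>2 - (cmod (hermitian z w))\<^sup>2 / (norm w)\<^sup>2 \<le> (norm (z - w))\<^sup>2"
proof -
  define a where "a = hermitian z w / hermitian w w"
  have "z - w = (z - a *s w) + (a - 1) *s w"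
    by (simp add: vec.scale_left_diff_distrib)
  moreover have "hermitian (z - a *s w) w = 0"
    using assms by (simp add: hermitian_diff hermitian_smult a_def hermitian_self)
  then have "(z - a *s w) \<bullet> ((a - 1) *s w) = 0"
    unfolding Re_hermitian[symmetric] hermitian_smult_right by simp
  then have "(norm ((z - a *s w) + (a - 1) *s w))\<^sup>2 = (norm (z - a *s w))\<^sup>2 + (norm ((a - 1) *s w))\<^sup>2"
    by (intro norm_add_Pythagorean) (simp add: orthogonal_def)
  ultimately have "(norm (z - w))\<^sup>2 = (norm (z - a *s w))\<^sup>2 + (norm ((a - 1) *s w))\<^sup>2"
    by (simp only:)
  then show ?thesis
    using norm_diff_projection[OF assms, of z] by (simp add: a_def)
qed


section \<open>The Fubini--Study distance\<close>

text \<open>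
  The origin belongs to the cone, which makes the cone over a closed set closed.
\<close>

definition affine_cone :: "'n::finite cproj set \<Rightarrow> (complex^'n) set" where
  "affine_cone Y = {z. z = 0 \<or> proj z \<in> Y}"

definition curve_lengths :: "'n::finite cproj \<Rightarrow> 'n cproj \<Rightarrow> real set" where
  "curve_lengths p q = {l. \<exists>c :: real \<Rightarrow> complex ^ 'n.
     c piecewise_C1_differentiable_on {0..1} \<and> (\<forall>s\<in>{0..1}. c s \<noteq> 0) \<and>
     proj (c 0) = p \<and> proj (c 1) = q \<and>
     ((\<lambda>s. let v = vector_derivative c (at s) in sqrt (fs_metric (c s) v v)) has_integral l) {0..1}}"

lemma fs_dist_eq: "fs_dist p q = Inf (curve_lengths p q)"
  by (simp add: fs_dist_def curve_lengths_def)

lemma fs_metric_self: "fs_metric z v v = (norm (horizontal z v) / norm z)\<^sup>2"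
  by (simp add: fs_metric_def power_divide power2_norm_eq_inner)

lemma curve_lengths_nonneg: "l \<in> curve_lengths p q \<Longrightarrow> 0 \<le> l"
  unfolding curve_lengths_def Let_def by (auto simp: fs_metric_self dest!: has_integral_nonneg)

lemma curve_lengths_bdd: "bdd_below (curve_lengths p q)"
  using curve_lengths_nonneg by (intro bdd_belowI[of _ 0])

definition cos_angle :: "complex^'n::finite \<Rightarrow> complex^'n \<Rightarrow> real" where
  "cos_angle z w = cmod (hermitian z w) / (norm z * norm w)"

lemma cos_angle_bounds: "0 \<le> cos_angle z w" "cos_angle z w \<le> 1"
proof -
  show "0 \<le> cos_angle z w" by (simp add: cos_angle_def)
  show "cos_angle z w \<le> 1"
    using hermitian_Cauchy_Schwarz[of z w] by (auto simp: cos_angle_def divide_le_eq_1 less_le)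
qed

lemma norm_eq_1_of_power2: "(norm x)\<^sup>2 = 1 \<Longrightarrow> norm x = 1"
  using power2_eq_1_iff[of "norm x"] norm_ge_zero[of x] by linarith

lemma norm_sin_angle:
  assumes "z \<noteq> 0"
  shows "(norm z)\<^sup>2 * (1 - (cos_angle z w)\<^sup>2) = (norm z)\<^sup>2 - (cmod (hermitian z w))\<^sup>2 / (norm w)\<^sup>2"
  using assms by (simp add: cos_angle_def power_divide power_mult_distrib right_diff_distrib)

text \<open>
  After a change of phase of the second vector, the great circle through the two unit vectors is
  horizontal and has constant speed, so its projection has length equal to the angle.
\<close>

lemma geodesic_length:
  assumes z: "z \<noteq> 0" and w: "w \<noteq> 0"
  shows "arccos (cos_angle z w) \<in> curve_lengths (proj z) (proj w)"
proof -
  define \<kappa> where "\<kappa> = cos_angle z w"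
  define \<alpha> where "\<alpha> = arccos \<kappa>"
  have \<kappa>: "0 \<le> \<kappa>" "\<kappa> \<le> 1" unfolding \<kappa>_def by (rule cos_angle_bounds)+
  have cos: "cos \<alpha> = \<kappa>" unfolding \<alpha>_def using \<kappa> by (intro cos_arccos) auto
  have \<alpha>: "0 \<le> \<alpha>" "\<alpha> \<le> pi" unfolding \<alpha>_def using \<kappa> by (auto intro: arccos_lbound arccos_ubound)
  define z1 where "z1 = inverse (complex_of_real (norm z)) *s z"
  define w0 where "w0 = inverse (complex_of_real (norm w)) *s w"
  define h where "h = hermitian z1 w0"
  \<comment> \<open>The phase that makes the Hermitian product of z1 and w1 real and nonnegative.\<close>
  define u where "u = (if h = 0 then 1 else h / complex_of_real (cmod h))"
  define w1 where "w1 = u *s w0"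
  have nz1: "norm z1 = 1" and nw0: "norm w0 = 1"
    using z w by (auto simp: z1_def w0_def norm_vec_smult norm_inverse)
  have cu: "cmod u = 1" by (simp add: u_def norm_divide)
  then have u0: "u \<noteq> 0" by auto
  have nw1: "norm w1 = 1" by (simp add: w1_def norm_vec_smult cu nw0)
  have ch: "cmod h = \<kappa>"
    by (simp add: h_def z1_def w0_def hermitian_smult hermitian_smult_right norm_mult norm_inverse \<kappa>_def
        cos_angle_def divide_inverse mult_ac)
  have hzw: "hermitian z1 w1 = complex_of_real \<kappa>"
  proof (cases "h = 0")
    case True
    then show ?thesis using ch by (simp add: w1_def hermitian_smult_right h_def[symmetric])
  next
    case False
    have "hermitian z1 w1 = cnj u * h" by (simp add: w1_def hermitian_smult_right h_def)
    also have "\<dots> = complex_of_real ((cmod h)\<^sup>2) / complex_of_real (cmod h)"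
      using False complex_norm_square[of h] by (simp add: u_def mult.commute)
    also have "\<dots> = complex_of_real \<kappa>" using False ch by (simp add: power2_eq_square)
    finally show ?thesis .
  qed
  have hwz: "hermitian w1 z1 = complex_of_real \<kappa>"
    using cnj_hermitian[of z1 w1] hzw by simp
  \<comment> \<open>The initial direction of the geodesic; for equal end points sin \<alpha> = 0 and e = 0.\<close>
  define e where "e = inverse (complex_of_real (sin \<alpha>)) *s (w1 - complex_of_real \<kappa> *s z1)"
  have w1e: "w1 = complex_of_real (cos \<alpha>) *s z1 + complex_of_real (sin \<alpha>) *s e"
  proof (cases "sin \<alpha> = 0")
    case True
    then have "\<kappa> = 1" using cos \<kappa> sin_cos_squared_add[of \<alpha>] by (auto simp: power2_eq_1_iff)
    have "(norm (w1 - z1))\<^sup>2 = (norm w1)\<^sup>2 + (norm z1)\<^sup>2 - 2 * (w1 \<bullet> z1)"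
      unfolding power2_norm_eq_inner by (simp add: inner_diff_left inner_diff_right inner_commute)
    also have "w1 \<bullet> z1 = 1" using hwz \<open>\<kappa> = 1\<close> by (simp add: Re_hermitian[symmetric])
    finally have "w1 = z1" by (simp add: nw1 nz1)
    then show ?thesis using True \<open>\<kappa> = 1\<close> cos by simp
  next
    case False
    then show ?thesis by (simp add: e_def cos vector_smult_assoc)
  qed
  have hez: "hermitian e z1 = 0"
    by (simp add: e_def hermitian_smult hermitian_diff hwz hermitian_self nz1)
  have hze: "hermitian z1 e = 0" using cnj_hermitian[of e z1] hez by simp
  have ne: "sin \<alpha> \<noteq> 0 \<Longrightarrow> norm e = 1"
  proof -
    assume s: "sin \<alpha> \<noteq> 0"
    have "hermitian w1 w1 = complex_of_real (\<kappa>\<^sup>2) + complex_of_real ((sin \<alpha>)\<^sup>2) * hermitian e e"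
      by (subst (1 2) w1e, unfold hermitian_add hermitian_add_right hermitian_smult hermitian_smult_right hez hze)
        (simp add: hermitian_self nz1 cos power2_eq_square)
    then have "complex_of_real 1 = complex_of_real (\<kappa>\<^sup>2 + (sin \<alpha>)\<^sup>2 * (norm e)\<^sup>2)"
      by (simp add: hermitian_self nw1)
    then have "1 = \<kappa>\<^sup>2 + (sin \<alpha>)\<^sup>2 * (norm e)\<^sup>2" unfolding of_real_eq_iff .
    moreover have "\<kappa>\<^sup>2 = 1 - (sin \<alpha>)\<^sup>2" using cos_squared_eq[of \<alpha>] cos by simp
    ultimately have "(sin \<alpha>)\<^sup>2 * (norm e)\<^sup>2 = (sin \<alpha>)\<^sup>2 * 1" by simp
    then have "(norm e)\<^sup>2 = 1" using s by simp
    then show ?thesis by (rule norm_eq_1_of_power2)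
  qed
  define c where "c s = cos (s * \<alpha>) *\<^sub>R z1 + sin (s * \<alpha>) *\<^sub>R e" for s
  define c' where "c' s = \<alpha> *\<^sub>R (cos (s * \<alpha>) *\<^sub>R e - sin (s * \<alpha>) *\<^sub>R z1)" for s
  have dc: "(c has_vector_derivative c' s) (at s)" for s
    unfolding c_def c'_def by (auto intro!: derivative_eq_intros simp: algebra_simps)
  have vd: "vector_derivative c (at s) = c' s" for s
    using dc by (rule vector_derivative_at)
  have C1: "c C1_differentiable_on {0..1}"
    unfolding C1_differentiable_on_def
    by (intro exI[of _ c'] conjI ballI dc) (auto simp: c'_def intro!: continuous_intros)
  have zero: "\<alpha> = 0" if "sin \<alpha> = 0"
  proof -
    have "\<kappa> = 1" using that cos \<kappa> sin_cos_squared_add[of \<alpha>] by (auto simp: power2_eq_1_iff)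
    then show ?thesis by (simp add: \<alpha>_def)
  qed
  have nc: "norm (c s) = 1" for s
  proof (cases "sin \<alpha> = 0")
    case True
    then show ?thesis using zero by (simp add: c_def nz1)
  next
    case False
    have "(norm (c s))\<^sup>2 = (cos (s * \<alpha>))\<^sup>2 + (sin (s * \<alpha>))\<^sup>2"
      using hez ne[OF False] nz1 Re_hermitian[of e z1] unfolding power2_norm_eq_inner c_def
      by (simp add: inner_add_left inner_add_right inner_commute norm_eq_1 power2_eq_square)
    then show ?thesis by (intro norm_eq_1_of_power2) simp
  qed
  have speed: "sqrt (fs_metric (c s) (c' s) (c' s)) = \<alpha>" for s
  proof (cases "sin \<alpha> = 0")
    case True
    then show ?thesis using zero by (simp add: fs_metric_self c'_def horizontal_def hermitian_def)
  next
    case False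
    have "hermitian (c' s) (c s) = 0"
      unfolding c_def c'_def scaleR_eq_smult
      by (simp add: hermitian_add hermitian_add_right hermitian_smult hermitian_smult_right hermitian_diff
          hez hze hermitian_self nz1 ne[OF False])
    then have "horizontal (c s) (c' s) = c' s" by (simp add: horizontal_def)
    moreover have "norm (c' s) = \<alpha>"
    proof -
      have "(norm (cos (s * \<alpha>) *\<^sub>R e - sin (s * \<alpha>) *\<^sub>R z1))\<^sup>2 = (cos (s * \<alpha>))\<^sup>2 + (sin (s * \<alpha>))\<^sup>2"
        using hez ne[OF False] nz1 Re_hermitian[of e z1] unfolding power2_norm_eq_inner
        by (simp add: inner_diff_left inner_diff_right inner_commute norm_eq_1 power2_eq_square)
      then have "norm (cos (s * \<alpha>) *\<^sub>R e - sin (s * \<alpha>) *\<^sub>R z1) = 1" by (intro norm_eq_1_of_power2) simp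
      then show ?thesis using \<alpha> by (simp add: c'_def)
    qed
    ultimately show ?thesis using \<alpha> by (simp add: fs_metric_self nc)
  qed
  have "proj (c 0) = proj z" using z by (simp add: c_def z1_def proj_smult)
  moreover have "c 1 = w1" using w1e by (simp add: c_def scaleR_eq_smult)
  then have "proj (c 1) = proj w"
    using w u0 by (simp add: w1_def w0_def vector_smult_assoc proj_smult)
  moreover have "((\<lambda>s. let v = vector_derivative c (at s) in sqrt (fs_metric (c s) v v)) has_integral \<alpha>) {0..1}"
    using has_integral_const_real[of \<alpha> 0 1] by (simp add: vd speed)
  moreover have "c s \<noteq> 0" for s using nc[of s] by auto
  ultimately show ?thesis
    unfolding curve_lengths_def using C1 C1_differentiable_imp_piecewise by (auto simp: \<alpha>_def \<kappa>_def)
qed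

text \<open>
  Let \<open>h s\<close> be the squared cosine of the angle between \<open>c s\<close> and \<open>y\<close>.  Then \<open>\<bar>h'\<bar> \<le> 2 * sqrt (h * (1 - h)) * speed\<close>, so
  that \<open>arcsin (2 * h - 1) / 2\<close> grows at most as fast as the arc length.  At the end of the curve \<open>h = 1\<close>.
\<close>

lemma curve_lengths_ge:
  assumes l: "l \<in> curve_lengths (proj z) (proj y)" and z: "z \<noteq> 0" and y: "y \<noteq> 0" and small: "l \<le> pi / 2"
  shows "cos l ^ 2 \<le> (cos_angle z y)\<^sup>2"
proof -
  obtain c where pw: "c piecewise_C1_differentiable_on {0..1}" and c0: "\<And>s. s \<in> {0..1} \<Longrightarrow> c s \<noteq> 0"
    and ends: "proj (c 0) = proj z" "proj (c 1) = proj y"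
    and int: "((\<lambda>s. sqrt (fs_metric (c s) (vector_derivative c (at s)) (vector_derivative c (at s)))) has_integral l) {0..1}"
    using l unfolding curve_lengths_def Let_def by blast
  obtain S where S: "finite S" and C1: "c C1_differentiable_on {0..1} - S" and contc: "continuous_on {0..1} c"
    using pw unfolding piecewise_C1_differentiable_on_def by blast
  define v where "v s = vector_derivative c (at s)" for s
  have dv: "(c has_vector_derivative v s) (at s)" if "s \<in> {0..1} - S" for s
    using C1 that unfolding C1_differentiable_on_eq v_def by (simp add: vector_derivative_works)
  define f where "f s = hermitian (c s) y" for s
  define h where "h s = (cos_angle (c s) y)\<^sup>2" for s
  have h01: "0 \<le> h s" "h s \<le> 1" for s
    using cos_angle_bounds[of "c s" y] by (auto simp: h_def power_le_one)
  have h_eq: "h s = ((Re (f s))\<^sup>2 + (Im (f s))\<^sup>2) / ((c s \<bullet> c s) * (norm y)\<^sup>2)" for s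
    by (simp add: h_def cos_angle_def power_divide power_mult_distrib cmod_power2 f_def power2_norm_eq_inner)
  have blf: "bounded_linear (\<lambda>x. hermitian x y)"
  proof -
    have "linear (\<lambda>x. hermitian x y)"
      by (rule linearI) (simp_all add: hermitian_add scaleR_eq_smult hermitian_smult scaleR_conv_of_real[where 'a=complex])
    then show ?thesis by (simp add: linear_conv_bounded_linear)
  qed
  have conth: "continuous_on {0..1} h"
    unfolding h_eq f_def using c0 y
    by (intro continuous_intros bounded_linear.continuous_on[OF blf] contc) auto
  define speed where "speed s = norm (horizontal (c s) (v s)) / norm (c s)" for s
  have int': "(speed has_integral l) {0..1}"
    using int by (simp add: fs_metric_self v_def[symmetric] speed_def[abs_def])
  \<comment> \<open>Only the horizontal part of the velocity changes h, and it pairs with the part of y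
    orthogonal to c s, whose square norm is proportional to 1 - h.\<close>
  have deriv: "\<exists>h'. (h has_vector_derivative h') (at s) \<and> \<bar>h'\<bar> \<le> 2 * sqrt (h s * (1 - h s)) * speed s"
    if s: "s \<in> {0<..<1} - S" for s
  proof -
    have s': "s \<in> {0..1} - S" using s by auto
    define x where "x = c s"
    have x0: "x \<noteq> 0" using c0[of s] s' by (simp add: x_def)
    define \<beta> where "\<beta> = hermitian (v s) x / hermitian x x"
    define vh where "vh = horizontal x (v s)"
    have vs: "v s = vh + \<beta> *s x" by (simp add: vh_def horizontal_def \<beta>_def)
    have vhx: "hermitian vh x = 0"
      using x0 by (simp add: vh_def horizontal_def hermitian_diff hermitian_smult hermitian_self)
    define a where "a = hermitian x y"
    define a' where "a' = hermitian (v s) y"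
    have df: "(f has_vector_derivative a') (at s)"
      unfolding f_def a'_def by (rule bounded_linear.has_vector_derivative[OF blf dv[OF s']])
    have dR: "((\<lambda>s. Re (f s)) has_real_derivative Re a') (at s)" "((\<lambda>s. Im (f s)) has_real_derivative Im a') (at s)"
      using bounded_linear.has_vector_derivative[OF bounded_linear_Re df]
        bounded_linear.has_vector_derivative[OF bounded_linear_Im df]
      by (simp_all add: has_real_derivative_iff_has_vector_derivative)
    have dq: "((\<lambda>s. c s \<bullet> c s) has_real_derivative 2 * (x \<bullet> v s)) (at s)"
    proof -
      have "((\<lambda>s. c s \<bullet> c s) has_derivative (\<lambda>t. x \<bullet> (t *\<^sub>R v s) + (t *\<^sub>R v s) \<bullet> x)) (at s)"
        using has_derivative_inner[OF dv[OF s', unfolded has_vector_derivative_def] dv[OF s', unfolded has_vector_derivative_def]]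
        by (simp add: x_def)
      moreover have "(\<lambda>t. x \<bullet> (t *\<^sub>R v s) + (t *\<^sub>R v s) \<bullet> x) = (*) (2 * (x \<bullet> v s))"
        by (rule ext) (simp add: inner_commute)
      ultimately show ?thesis
        by (simp only: has_field_derivative_def)
    qed
    define q where "q = x \<bullet> x"
    have q: "q > 0" using x0 by (simp add: q_def)
    define Y where "Y = (norm y)\<^sup>2"
    have Y: "Y > 0" using y by (simp add: Y_def)
    define n' where "n' = 2 * Re a * Re a' + 2 * Im a * Im a'"
    define h' where "h' = (n' * (q * Y) - ((Re a)\<^sup>2 + (Im a)\<^sup>2) * (2 * (x \<bullet> v s) * Y)) / (q * Y)\<^sup>2"
    have fs: "f s = a" by (simp add: f_def a_def x_def)
    have "((\<lambda>s. (Re (f s))\<^sup>2 + (Im (f s))\<^sup>2) has_real_derivative n') (at s)"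
      by (rule derivative_eq_intros dR refl)+ (simp add: n'_def fs)
    moreover have "((\<lambda>s. (c s \<bullet> c s) * Y) has_real_derivative 2 * (x \<bullet> v s) * Y) (at s)"
      by (rule derivative_eq_intros dq refl)+ simp
    ultimately have "((\<lambda>s. ((Re (f s))\<^sup>2 + (Im (f s))\<^sup>2) / ((c s \<bullet> c s) * Y)) has_real_derivative
        (n' * ((c s \<bullet> c s) * Y) - ((Re (f s))\<^sup>2 + (Im (f s))\<^sup>2) * (2 * (x \<bullet> v s) * Y)) / (((c s \<bullet> c s) * Y) * ((c s \<bullet> c s) * Y))) (at s)"
      using q Y by (intro DERIV_divide) (auto simp: q_def x_def)
    then have dh: "(h has_vector_derivative h') (at s)"
      unfolding has_real_derivative_iff_has_vector_derivative[symmetric] h_eq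
      by (simp add: h'_def fs q_def x_def[symmetric] Y_def power2_eq_square)
    define b where "b = hermitian vh y"
    have a'b: "a' = b + \<beta> * a" by (simp add: a'_def vs hermitian_add hermitian_smult b_def a_def)
    have xv: "x \<bullet> v s = Re \<beta> * q"
    proof -
      have "hermitian (v s) x = \<beta> * hermitian x x" unfolding vs by (simp add: hermitian_add hermitian_smult vhx)
      then have "v s \<bullet> x = Re (\<beta> * complex_of_real q)"
        unfolding Re_hermitian[symmetric] by (simp add: hermitian_self q_def power2_norm_eq_inner)
      then show ?thesis by (simp add: inner_commute)
    qed
    have "n' = 2 * Re (b * cnj a) + 2 * Re \<beta> * ((Re a)\<^sup>2 + (Im a)\<^sup>2)"
      by (simp add: n'_def a'b algebra_simps power2_eq_square)
    then have "n' * (q * Y) - ((Re a)\<^sup>2 + (Im a)\<^sup>2) * (2 * (x \<bullet> v s) * Y) = (2 * Re (b * cnj a)) * (q * Y)"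
      unfolding xv by (simp add: algebra_simps)
    then have h'_eq: "h' = 2 * Re (b * cnj a) / (q * Y)"
      using q Y by (simp add: h'_def power2_eq_square)
    define y' where "y' = y - (hermitian y x / hermitian x x) *s x"
    have "hermitian vh y = hermitian vh y'" by (simp add: y'_def hermitian_diff_right hermitian_smult_right vhx)
    then have b_le: "cmod b \<le> norm vh * norm y'" using hermitian_Cauchy_Schwarz[of vh y'] by (simp add: b_def)
    have ca: "cmod (hermitian y x) = cmod a" using cnj_hermitian[of x y] by (metis a_def complex_mod_cnj)
    have hs: "h s = (cmod a)\<^sup>2 / (q * Y)"
      by (simp add: h_def cos_angle_def power_divide power_mult_distrib a_def x_def q_def Y_def power2_norm_eq_inner)
    have ny': "(norm y')\<^sup>2 = Y * (1 - h s)"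
    proof -
      have "(norm x)\<^sup>2 = q" by (simp add: q_def power2_norm_eq_inner)
      then have "(norm y')\<^sup>2 = Y - (cmod a)\<^sup>2 / q"
        using norm_diff_projection[OF x0, of y] by (simp only: y'_def ca Y_def)
      also have "(cmod a)\<^sup>2 / q = Y * h s" using q Y by (simp add: hs)
      finally show ?thesis by (simp add: algebra_simps)
    qed
    have "cmod a = sqrt (h s * (q * Y))" using q Y by (simp add: hs)
    moreover have "norm y' = sqrt (Y * (1 - h s))" unfolding ny'[symmetric] by simp
    ultimately have prod: "norm y' * cmod a = Y * sqrt q * sqrt (h s * (1 - h s))"
      using Y by (simp add: real_sqrt_mult[symmetric] mult_ac) (simp add: real_sqrt_mult power2_eq_square mult_ac)
    have "\<bar>h'\<bar> \<le> 2 * (cmod b * cmod a) / (q * Y)"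
      unfolding h'_eq using q Y abs_Re_le_cmod[of "b * cnj a"]
      by (simp add: abs_mult norm_mult divide_right_mono)
    also have "\<dots> \<le> 2 * (norm vh * (norm y' * cmod a)) / (q * Y)"
      using q Y mult_right_mono[OF b_le norm_ge_zero[of a]] by (intro divide_right_mono) (auto simp: mult.assoc)
    also have "\<dots> = 2 * sqrt (h s * (1 - h s)) * (norm vh / sqrt q)"
    proof -
      have "2 * (norm vh * (Y * sqrt q * R)) / (q * Y) = 2 * R * (norm vh / sqrt q)" for R
        using q Y by (simp add: field_simps)
      then show ?thesis unfolding prod by blast
    qed
    also have "norm vh / sqrt q = speed s"
      by (simp add: speed_def vh_def x_def q_def norm_eq_sqrt_inner)
    finally show ?thesis using dh by blast
  qed
  \<comment> \<open>With \<epsilon> = 0 the function \<Psi> would be arcsin (2 h - 1) / 2, which is not differentiable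
    where h is 0 or 1; \<epsilon> > 0 keeps the argument of arcsin inside (-1, 1).\<close>
  have main: "(arcsin ((1 - 1/2) / sqrt (1/4 + \<epsilon>)) - arcsin ((h 0 - 1/2) / sqrt (1/4 + \<epsilon>))) / 2 \<le> l" if \<epsilon>: "\<epsilon> > 0" for \<epsilon>
  proof -
    define R where "R = sqrt (1/4 + \<epsilon>)"
    have R: "R > 1/2" "R\<^sup>2 = 1/4 + \<epsilon>"
    proof -
      have "sqrt (1/4) < R" unfolding R_def using \<epsilon> by (simp del: real_sqrt_divide)
      moreover have "sqrt (1/4) = (1/2 :: real)" by (rule real_sqrt_unique) (auto simp: power2_eq_square)
      ultimately show "R > 1/2" by simp
      show "R\<^sup>2 = 1/4 + \<epsilon>" using \<epsilon> by (simp add: R_def)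
    qed
    define \<Psi> where "\<Psi> s = arcsin ((h s - 1/2) / R) / 2" for s
    have in1: "-1 < (h s - 1/2) / R" "(h s - 1/2) / R < 1" for s
      using h01[of s] R by (auto simp: field_simps)
    have cont: "continuous_on {0..1} \<Psi>"
      unfolding \<Psi>_def using in1 R
      by (intro continuous_intros conth) (auto intro: less_imp_le)
    have ex: "\<exists>d. (\<Psi> has_vector_derivative d) (at s) \<and> d \<le> speed s" if s: "s \<in> {0<..<1} - S" for s
    proof -
      from deriv[OF s] obtain h' where h': "(h has_real_derivative h') (at s)" and le: "\<bar>h'\<bar> \<le> 2 * sqrt (h s * (1 - h s)) * speed s"
        by (auto simp: has_real_derivative_iff_has_vector_derivative)
      define g where "g = (h s - 1/2) / R"
      have "((\<lambda>s. (h s - 1/2) / R) has_real_derivative h' / R) (at s)"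
        using h' R by (auto intro!: derivative_eq_intros)
      moreover have "DERIV arcsin g :> inverse (sqrt (1 - g\<^sup>2))"
        using in1[of s] by (intro DERIV_arcsin) (auto simp: g_def)
      ultimately have "((\<lambda>s. arcsin ((h s - 1/2) / R)) has_real_derivative inverse (sqrt (1 - g\<^sup>2)) * (h' / R)) (at s)"
        unfolding g_def by (intro DERIV_chain2)
      then have d\<Psi>: "(\<Psi> has_real_derivative inverse (sqrt (1 - g\<^sup>2)) * (h' / R) / 2) (at s)"
        unfolding \<Psi>_def by (rule DERIV_cdivide)
      define p where "p = h s * (1 - h s)"
      have p: "p \<ge> 0" using h01[of s] by (simp add: p_def)
      have "R\<^sup>2 * (1 - g\<^sup>2) = R\<^sup>2 - (h s - 1/2)\<^sup>2" 
      proof -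
        have "R * g = h s - 1/2" using R(1) by (simp add: g_def)
        then show ?thesis by (metis mult.right_neutral power_mult_distrib right_diff_distrib)
      qed
      also have "\<dots> = p + \<epsilon>" using R by (simp add: p_def power2_eq_square algebra_simps)
      finally have eq: "R\<^sup>2 * (1 - g\<^sup>2) = p + \<epsilon>" .
      have "R * sqrt (1 - g\<^sup>2) = sqrt (R\<^sup>2) * sqrt (1 - g\<^sup>2)"
        using R(1) by simp
      also have "\<dots> = sqrt (p + \<epsilon>)"
        by (simp only: real_sqrt_mult[symmetric] eq)
      finally have rs: "R * sqrt (1 - g\<^sup>2) = sqrt (p + \<epsilon>)" .
      have "inverse (sqrt (1 - g\<^sup>2)) * (h' / R) / 2 = h' / (2 * sqrt (p + \<epsilon>))"
      proof -
        have "inverse u * (h' / R) / 2 = h' / (2 * (R * u))" for u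
          by (simp add: divide_simps)
        then show ?thesis unfolding rs[symmetric] .
      qed
      also have "\<dots> \<le> (2 * sqrt p * speed s) / (2 * sqrt (p + \<epsilon>))"
        using le p \<epsilon> by (intro divide_right_mono) (auto simp: p_def)
      also have "\<dots> = (sqrt p / sqrt (p + \<epsilon>)) * speed s" by simp
      also have "\<dots> \<le> 1 * speed s"
        using p \<epsilon> by (intro mult_right_mono) (auto simp: speed_def divide_le_eq_1)
      finally show ?thesis using d\<Psi> by (auto simp: has_real_derivative_iff_has_vector_derivative)
    qed
    then have "\<forall>s\<in>{0<..<1} - S. \<exists>d. (\<Psi> has_vector_derivative d) (at s) \<and> d \<le> speed s"
      by (rule ballI)
    from bchoice[OF this] obtain d where d: "\<forall>s\<in>{0<..<1} - S. (\<Psi> has_vector_derivative d s) (at s) \<and> d s \<le> speed s"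
      by (rule exE)
    \<comment> \<open>The speed serves as default value at the finitely many points without derivative.\<close>
    define D where "D s = (if s \<in> {0<..<1} - S then d s else speed s)" for s
    have "(D has_integral (\<Psi> 1 - \<Psi> 0)) {0..1}"
    proof (rule fundamental_theorem_of_calculus_interior_strong[OF S _ _ cont])
      fix x assume "x \<in> {0<..<1} - S"
      then show "(\<Psi> has_vector_derivative D x) (at x)" using d by (simp add: D_def)
    qed simp
    from has_integral_le[OF this int'] have "\<Psi> 1 - \<Psi> 0 \<le> l"
      using d by (auto simp: D_def)
    moreover have "h 1 = 1"
    proof -
      obtain a where a: "a \<noteq> 0" "c 1 = a *s y" using proj_eqD[OF ends(2) c0 y] by auto
      then show ?thesis
        using y by (simp add: h_def cos_angle_def hermitian_smult hermitian_self norm_mult norm_vec_smult power2_eq_square)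
    qed
    ultimately show ?thesis by (simp add: \<Psi>_def R_def diff_divide_distrib)
  qed
  have lim: "((\<lambda>\<epsilon>. (arcsin ((1 - 1/2) / sqrt (1/4 + \<epsilon>)) - arcsin ((h 0 - 1/2) / sqrt (1/4 + \<epsilon>))) / 2) \<longlongrightarrow>
      (arcsin ((1 - 1/2) / sqrt (1/4 + 0)) - arcsin ((h 0 - 1/2) / sqrt (1/4 + 0))) / 2) (at 0 within {0..})"
  proof -
    have b: "-1 \<le> (u - 1/2) / sqrt (1/4 + \<epsilon>) \<and> (u - 1/2) / sqrt (1/4 + \<epsilon>) \<le> 1" if "0 \<le> u" "u \<le> 1" "\<epsilon> \<in> {0..}" for u \<epsilon> :: real
    proof -
      have "sqrt (1/4) \<le> sqrt (1/4 + \<epsilon>)" using that by (simp del: real_sqrt_divide)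
      moreover have "sqrt (1/4) = (1/2 :: real)" by (rule real_sqrt_unique) (auto simp: power2_eq_square)
      ultimately have "1/2 \<le> sqrt (1/4 + \<epsilon>)" by simp
      then show ?thesis using that by (auto simp: field_simps)
    qed
    have "continuous_on {0..} (\<lambda>\<epsilon>::real. (arcsin ((1 - 1/2) / sqrt (1/4 + \<epsilon>)) - arcsin ((h 0 - 1/2) / sqrt (1/4 + \<epsilon>))) / 2)"
    proof (intro continuous_on_divide continuous_on_diff continuous_on_const ballI)
      have cont: "continuous_on {0..} (\<lambda>\<epsilon>. arcsin ((u - 1/2) / sqrt (1/4 + \<epsilon>)))" if "0 \<le> u" "u \<le> 1" for u :: real
      proof (rule continuous_on_arcsin)
        show "continuous_on {0..} (\<lambda>\<epsilon>. (u - 1/2) / sqrt (1/4 + \<epsilon>))"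
          by (intro continuous_intros) (auto simp: add_pos_nonneg less_imp_neq[symmetric])
      qed (use b[OF that] in blast)
      show "continuous_on {0..} (\<lambda>\<epsilon>. arcsin ((1 - 1/2) / sqrt (1/4 + \<epsilon>)))" by (rule cont) auto
      show "continuous_on {0..} (\<lambda>\<epsilon>. arcsin ((h 0 - 1/2) / sqrt (1/4 + \<epsilon>)))" by (rule cont) (rule h01)+
    qed simp
    then show ?thesis unfolding continuous_on_def by (auto elim: ballE[of _ _ 0])
  qed
  have "(arcsin ((1 - 1/2) / sqrt (1/4 + 0)) - arcsin ((h 0 - 1/2) / sqrt (1/4 + 0))) / 2 \<le> l"
  proof (rule tendsto_upperbound[OF lim])
    show "\<forall>\<^sub>F \<epsilon> in at 0 within {0..}. (arcsin ((1 - 1/2) / sqrt (1/4 + \<epsilon>)) - arcsin ((h 0 - 1/2) / sqrt (1/4 + \<epsilon>))) / 2 \<le> l"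
      unfolding eventually_at
    proof (intro exI[of _ 1] conjI ballI impI)
      fix \<epsilon> :: real assume "\<epsilon> \<in> {0..}" "\<epsilon> \<noteq> 0 \<and> dist \<epsilon> 0 < 1"
      then show "(arcsin ((1 - 1/2) / sqrt (1/4 + \<epsilon>)) - arcsin ((h 0 - 1/2) / sqrt (1/4 + \<epsilon>))) / 2 \<le> l"
        by (intro main) auto
    qed simp
    show "at (0::real) within {0..} \<noteq> bot"
      by (simp add: at_within_Ici_at_right)
  qed
  moreover have "sqrt (1/4 + 0) = (1/2 :: real)" by (rule real_sqrt_unique) (auto simp: power2_eq_square)
  ultimately have "(arcsin 1 - arcsin (2 * h 0 - 1)) / 2 \<le> l" by (simp add: field_simps)
  then have "pi / 2 - 2 * l \<le> arcsin (2 * h 0 - 1)" by (simp add: field_simps)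
  moreover have "0 \<le> l" using l by (rule curve_lengths_nonneg)
  ultimately have "sin (pi / 2 - 2 * l) \<le> sin (arcsin (2 * h 0 - 1))"
    using small arcsin_bounded[of "2 * h 0 - 1"] h01[of 0] by (intro sin_monotone_2pi_le) auto
  then have "cos (2 * l) \<le> 2 * h 0 - 1"
    using h01[of 0] by (simp add: sin_diff)
  then have "(cos l)\<^sup>2 \<le> h 0" by (simp add: cos_double_cos)
  moreover have "h 0 = (cos_angle z y)\<^sup>2"
  proof -
    obtain a where a: "a \<noteq> 0" "c 0 = a *s z" using proj_eqD[OF ends(1) c0 z] by auto
    then show ?thesis
      by (simp add: h_def cos_angle_def hermitian_smult norm_mult norm_vec_smult)
  qed
  ultimately show ?thesis by simp
qed

lemma mem_affine_cone: "z \<noteq> 0 \<Longrightarrow> z \<in> affine_cone Y \<longleftrightarrow> proj z \<in> Y"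
  by (simp add: affine_cone_def)

lemma affine_cone_smult: "z \<in> affine_cone Y \<Longrightarrow> c *s z \<in> affine_cone Y"
  by (cases "c = 0 \<or> z = 0") (auto simp: affine_cone_def proj_smult)

lemma closed_affine_cone: "closed Y \<Longrightarrow> closed (affine_cone Y)"
proof -
  assume "closed Y"
  then have "open {z. z \<noteq> 0 \<and> proj z \<in> - Y}"
    by (simp add: closed_def open_cproj_def)
  moreover have "- affine_cone Y = {z. z \<noteq> 0 \<and> proj z \<in> - Y}" by (auto simp: affine_cone_def)
  ultimately show ?thesis by (simp add: closed_def)
qed

lemma zero_in_affine_cone: "0 \<in> affine_cone Y"
  by (simp add: affine_cone_def)

lemma fs_dist_nonneg: "0 \<le> fs_dist p q"
proof -
  obtain z w where "z \<noteq> 0" "p = proj z" "w \<noteq> 0" "q = proj w" using proj_surj by metis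
  then have "curve_lengths p q \<noteq> {}" using geodesic_length by blast
  then show ?thesis unfolding fs_dist_eq using curve_lengths_nonneg by (intro cInf_greatest) auto
qed

lemma fs_dist_le_arccos:
  assumes "z \<noteq> 0" "w \<noteq> 0"
  shows "fs_dist (proj z) (proj w) \<le> arccos (cos_angle z w)"
  unfolding fs_dist_eq using geodesic_length[OF assms] curve_lengths_bdd by (rule cInf_lower)

lemma fs_neighborhoodI:
  assumes "p \<in> Y" "fs_dist q p \<le> t"
  shows "q \<in> fs_neighborhood Y t"
proof -
  have "(INF p\<in>Y. fs_dist q p) \<le> fs_dist q p"
    using assms(1) fs_dist_nonneg by (intro cINF_lower bdd_belowI[of _ 0]) auto
  then show ?thesis using assms by (auto simp: fs_neighborhood_def)
qed

lemma fs_neighborhood_large: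
  assumes "Y \<noteq> {}" "pi / 2 \<le> t"
  shows "fs_neighborhood Y t = UNIV"
proof -
  have "q \<in> fs_neighborhood Y t" for q
  proof -
    obtain p where p: "p \<in> Y" using assms by blast
    obtain z w where zw: "z \<noteq> 0" "q = proj z" "w \<noteq> 0" "p = proj w" using proj_surj by metis
    have "arccos (cos_angle z w) \<le> arccos 0"
      using cos_angle_bounds[of z w] by (intro arccos_le_mono[THEN iffD2]) auto
    then have "fs_dist q p \<le> t" using fs_dist_le_arccos[OF zw(1,3)] zw assms(2) by simp
    then show ?thesis using p by (rule fs_neighborhoodI[rotated])
  qed
  then show ?thesis by auto
qed

text \<open>
  The squared distance from \<open>z\<close> to the complex line of \<open>x\<close> is \<open>(norm z)\<^sup>2\<close> times the squared sine of the
  angle, and the angle is the length of a curve; since \<open>sin t < 1\<close>, the nearest point is not the origin.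
\<close>

lemma fs_neighborhood_contains:
  assumes Y: "closed Y" and t: "0 < t" "t < pi / 2" and z: "z \<noteq> 0"
    and d: "infdist z (affine_cone Y) \<le> sin t * norm z"
  shows "proj z \<in> fs_neighborhood Y t"
proof -
  obtain x where x: "x \<in> affine_cone Y" "infdist z (affine_cone Y) = dist z x"
    using infdist_attains_inf[OF closed_affine_cone[OF Y]] zero_in_affine_cone by blast
  have st: "0 < sin t" using t by (intro sin_gt_zero) auto
  have ct: "0 < cos t" using t by (intro cos_gt_zero) auto
  have "(sin t)\<^sup>2 + (cos t)\<^sup>2 = 1" by (rule sin_cos_squared_add)
  then have st1: "(sin t)\<^sup>2 < 1" using ct by (smt (verit) zero_less_power)
  then have "sin t < 1" using st by (simp add: power_less_one_iff)
  have x0: "x \<noteq> 0"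
  proof
    assume "x = 0"
    then have "norm z \<le> sin t * norm z" using d x by (simp add: dist_norm)
    then show False using z \<open>sin t < 1\<close> by simp
  qed
  have "(norm z)\<^sup>2 - (cmod (hermitian z x))\<^sup>2 / (norm x)\<^sup>2 \<le> (norm (z - x))\<^sup>2"
    by (rule projection_le_norm_diff[OF x0])
  also have "\<dots> \<le> (sin t * norm z)\<^sup>2"
    using d x(2) by (intro power_mono) (auto simp: dist_norm)
  finally have "(norm z)\<^sup>2 * (1 - (cos_angle z x)\<^sup>2) \<le> (norm z)\<^sup>2 * (sin t)\<^sup>2"
    unfolding norm_sin_angle[OF z] by (simp add: power_mult_distrib mult.commute)
  then have "1 - (cos_angle z x)\<^sup>2 \<le> (sin t)\<^sup>2" using z by simp
  then have "(cos t)\<^sup>2 \<le> (cos_angle z x)\<^sup>2" by (simp add: sin_squared_eq)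
  then have "cos t \<le> cos_angle z x" by (rule power2_le_imp_le) (rule cos_angle_bounds)
  then have "arccos (cos_angle z x) \<le> arccos (cos t)"
    using cos_angle_bounds[of z x] by (intro arccos_le_mono[THEN iffD2]) (auto simp: abs_le_iff intro: order_trans[of _ 0] less_imp_le[OF ct])
  also have "arccos (cos t) = t" using t by (intro arccos_cos) auto
  finally show ?thesis
    using fs_dist_le_arccos[OF z x0] x(1) x0 by (intro fs_neighborhoodI[of "proj x"]) (auto simp: mem_affine_cone)
qed

text \<open>
  A short curve from \<open>proj z\<close> to a point of \<open>Y\<close> makes a small angle, hence the projection of \<open>z\<close> to the
  line of that point is a point of the cone close to \<open>z\<close>.
\<close>

lemma infdist_le_of_fs_neighborhood:
  assumes t: "0 < t" "t < pi / 2" and z: "z \<noteq> 0" and nb: "proj z \<in> fs_neighborhood Y t"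
  shows "infdist z (affine_cone Y) \<le> sin t * norm z"
proof -
  have Y: "Y \<noteq> {}" and inf: "(INF p\<in>Y. fs_dist (proj z) p) \<le> t" using nb by (auto simp: fs_neighborhood_def)
  \<comment> \<open>The infimum defining the neighbourhood need not be attained, so the bound is proved for
    every s > t and then passed to the limit.\<close>
  have step: "(infdist z (affine_cone Y))\<^sup>2 \<le> (norm z)\<^sup>2 * (1 - (cos s)\<^sup>2)" if s: "t < s" "s \<le> pi / 2" for s
  proof -
    have "(INF p\<in>Y. fs_dist (proj z) p) < s" using inf s by simp
    then obtain p where p: "p \<in> Y" "fs_dist (proj z) p < s"
    proof -
      have "bdd_below (fs_dist (proj z) ` Y)" using fs_dist_nonneg by (intro bdd_belowI[of _ 0]) auto
      with \<open>(INF p\<in>Y. fs_dist (proj z) p) < s\<close> show ?thesis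
        using that Y by (subst (asm) cINF_less_iff) auto
    qed
    obtain y where y: "y \<noteq> 0" "p = proj y" using proj_surj by metis
    have "Inf (curve_lengths (proj z) (proj y)) < s" using p y by (simp add: fs_dist_eq)
    moreover have "curve_lengths (proj z) (proj y) \<noteq> {}" using geodesic_length[OF z y(1)] by blast
    ultimately obtain l where l: "l \<in> curve_lengths (proj z) (proj y)" "l < s"
      by (metis cInf_lessD)
    have "cos s \<le> cos l"
      using curve_lengths_nonneg[OF l(1)] l s by (intro cos_monotone_0_pi_le) auto
    moreover have "0 \<le> cos s" using s t by (intro cos_ge_zero) auto
    ultimately have "(cos s)\<^sup>2 \<le> (cos l)\<^sup>2" by (simp add: power_mono)
    also have "\<dots> \<le> (cos_angle z y)\<^sup>2" using curve_lengths_ge[OF l(1) z y(1)] l s by simp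
    finally have "(norm z)\<^sup>2 * (1 - (cos_angle z y)\<^sup>2) \<le> (norm z)\<^sup>2 * (1 - (cos s)\<^sup>2)"
      by (intro mult_left_mono) auto
    moreover have "(norm z)\<^sup>2 * (1 - (cos_angle z y)\<^sup>2) = (norm (z - (hermitian z y / hermitian y y) *s y))\<^sup>2"
      unfolding norm_diff_projection[OF y(1)] norm_sin_angle[OF z] ..
    moreover have "(infdist z (affine_cone Y))\<^sup>2 \<le> (norm (z - (hermitian z y / hermitian y y) *s y))\<^sup>2"
    proof (intro power_mono infdist_nonneg)
      have "(hermitian z y / hermitian y y) *s y \<in> affine_cone Y"
        using y p by (intro affine_cone_smult) (simp add: mem_affine_cone)
      from infdist_le[OF this, of z] show "infdist z (affine_cone Y) \<le> norm (z - (hermitian z y / hermitian y y) *s y)"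
        by (simp add: dist_norm)
    qed
    ultimately show ?thesis by linarith
  qed
  have lim: "((\<lambda>s. (norm z)\<^sup>2 * (1 - (cos s)\<^sup>2)) \<longlongrightarrow> (norm z)\<^sup>2 * (1 - (cos t)\<^sup>2)) (at_right t)"
    by (intro tendsto_intros)
  have "(infdist z (affine_cone Y))\<^sup>2 \<le> (norm z)\<^sup>2 * (1 - (cos t)\<^sup>2)"
  proof (rule tendsto_lowerbound[OF lim])
    show "\<forall>\<^sub>F s in at_right t. (infdist z (affine_cone Y))\<^sup>2 \<le> (norm z)\<^sup>2 * (1 - (cos s)\<^sup>2)"
      unfolding eventually_at_right_field using t step by (intro exI[of _ "pi / 2"]) auto
  qed simp
  also have "\<dots> = (sin t * norm z)\<^sup>2" by (simp add: power_mult_distrib sin_squared_eq)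
  finally show ?thesis
  proof (rule power2_le_imp_le)
    have "0 < sin t" using t by (intro sin_gt_zero) auto
    then show "0 \<le> sin t * norm z" by simp
  qed
qed


section \<open>The Fubini--Study volume\<close>

text \<open>
  Padding a matrix on \<open>S\<close> by \<open>\<kappa>\<close> on the remaining diagonal: in the Leibniz formula only the permutations
  that fix the complement of \<open>S\<close> contribute.
\<close>

lemma det_on_eq_det:
  fixes A :: "'i::finite \<Rightarrow> 'i \<Rightarrow> real"
  shows "det (\<chi> a b. if a \<in> S \<and> b \<in> S then A a b else if a = b then \<kappa> else 0) = \<kappa> ^ card (- S) * det_on S A"
proof -
  let ?M = "\<lambda>a b. if a \<in> S \<and> b \<in> S then A a b else if a = b then \<kappa> else 0"
  have "det (\<chi> a b. ?M a b) = (\<Sum>p | p permutes UNIV. of_int (sign p) * (\<Prod>i\<in>UNIV. ?M i (p i)))"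
    by (simp add: det_def)
  also have "\<dots> = (\<Sum>p | p permutes S. of_int (sign p) * (\<Prod>i\<in>UNIV. ?M i (p i)))"
  proof (rule sum.mono_neutral_right)
    show "finite {p. p permutes (UNIV :: 'i set)}" by (rule finite_permutations) simp
    show "{p. p permutes S} \<subseteq> {p. p permutes UNIV}" by (auto intro: permutes_subset)
    show "\<forall>p\<in>{p. p permutes UNIV} - {p. p permutes S}. of_int (sign p) * (\<Prod>i\<in>UNIV. ?M i (p i)) = 0"
    proof
      fix p assume p: "p \<in> {p. p permutes (UNIV :: 'i set)} - {p. p permutes S}"
      then have "\<exists>a. a \<notin> S \<and> p a \<noteq> a"
        unfolding permutes_def by auto
      then obtain a where "a \<notin> S" "p a \<noteq> a" by blast
      then have "?M a (p a) = 0" by auto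
      then have "(\<Prod>i\<in>UNIV. ?M i (p i)) = 0" by (intro prod_zero bexI[of _ a]) (assumption | simp)+
      then show "of_int (sign p) * (\<Prod>i\<in>UNIV. ?M i (p i)) = 0" by simp
    qed
  qed
  also have "\<dots> = (\<Sum>p | p permutes S. \<kappa> ^ card (- S) * (of_int (sign p) * (\<Prod>a\<in>S. A a (p a))))"
  proof (intro sum.cong refl)
    fix p assume "p \<in> {p. p permutes S}"
    then have p: "p permutes S" by simp
    have "(\<Prod>i\<in>UNIV. ?M i (p i)) = (\<Prod>i\<in>S. ?M i (p i)) * (\<Prod>i\<in>- S. ?M i (p i))"
      using prod.union_disjoint[of S "- S" "\<lambda>i. ?M i (p i)"] by simp
    also have "(\<Prod>i\<in>S. ?M i (p i)) = (\<Prod>a\<in>S. A a (p a))"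
      using permutes_in_image[OF p] by (intro prod.cong) auto
    also have "(\<Prod>i\<in>- S. ?M i (p i)) = (\<Prod>i\<in>- S. \<kappa>)"
      using permutes_not_in[OF p] by (intro prod.cong) auto
    finally show "of_int (sign p) * (\<Prod>i\<in>UNIV. ?M i (p i)) = \<kappa> ^ card (- S) * (of_int (sign p) * (\<Prod>a\<in>S. A a (p a)))"
      by (simp add: mult_ac)
  qed
  finally show ?thesis by (simp add: det_on_def sum_distrib_left)
qed

lemma det_two_eigenspaces:
  fixes f :: "real^'m \<Rightarrow> real^'m"
  assumes f: "linear f" and W: "subspace W"
    and on: "\<And>v. v \<in> W \<Longrightarrow> f v = a *\<^sub>R v" and perp: "\<And>v. v \<in> W\<^sup>\<bottom> \<Longrightarrow> f v = b *\<^sub>R v"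
  shows "det (matrix f) = a ^ dim W * b ^ (CARD('m) - dim W)"
proof -
  obtain B where B: "onb B W" using onb_exists[OF W] .
  obtain C where C: "onb C (W\<^sup>\<bottom>)" using onb_exists[OF subspace_orthogonal_comp] .
  note BC = onb_union[OF B W C]
  have fin: "finite B" "finite C" using B C onb_finite by auto
  define e where "e v = (if v \<in> B then a else b)" for v
  have "det (matrix f) = (\<Prod>v\<in>B \<union> C. e v)"
    using onb_subset[OF B] onb_subset[OF C] on perp
    by (intro det_eq_prod_eigenvalues[OF f BC(1)]) (auto simp: e_def)
  also have "\<dots> = (\<Prod>v\<in>B. e v) * (\<Prod>v\<in>C. e v)"
    by (rule prod.union_disjoint[OF fin BC(2)])
  also have "(\<Prod>v\<in>B. e v) = a ^ card B" by (simp add: e_def)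
  also have "(\<Prod>v\<in>C. e v) = (\<Prod>v\<in>C. b)" using BC(2) by (intro prod.cong) (auto simp: e_def)
  finally have "det (matrix f) = a ^ card B * b ^ card C" by simp
  moreover have "card B + card C = CARD('m)"
    using onb_card[OF BC(1)] card_Un_disjoint[OF fin BC(2)] by simp
  ultimately show ?thesis using onb_card[OF B] by (metis diff_add_inverse)
qed

lemma horizontal_inner:
  assumes "z \<noteq> 0"
  shows "horizontal z u \<bullet> horizontal z v = u \<bullet> v - Re (hermitian u z * cnj (hermitian v z)) / (norm z)\<^sup>2"
proof -
  define a where "a = hermitian u z"
  define b where "b = hermitian v z"
  define N where "N = complex_of_real ((norm z)\<^sup>2)"
  have N: "N \<noteq> 0" "hermitian z z = N" using assms by (auto simp: N_def hermitian_self)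
  have "hermitian (u - (a / N) *s z) (v - (b / N) *s z)
      = hermitian u v - cnj (b / N) * a - (a / N) * (cnj b - cnj (b / N) * N)"
    by (simp only: hermitian_diff hermitian_diff_right hermitian_smult hermitian_smult_right N(2)
        a_def b_def cnj_hermitian) (simp only: algebra_simps)
  also have "cnj (b / N) * N = cnj b" using N by (simp add: N_def)
  also have "hermitian u v - cnj (b / N) * a - (a / N) * (cnj b - cnj b) = hermitian u v - (a * cnj b) / complex_of_real ((norm z)\<^sup>2)"
    by (simp add: N_def mult.commute)
  finally have "hermitian (horizontal z u) (horizontal z v) = hermitian u v - (a * cnj b) / complex_of_real ((norm z)\<^sup>2)"
    unfolding horizontal_def N(2) a_def b_def .
  from arg_cong[OF this, of Re] show ?thesis
    unfolding Re_hermitian minus_complex.simps Re_divide_of_real a_def b_def .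
qed

lemma hermitian_coord_vector: "hermitian (coord_vector (j, b)) z = (if b then \<i> else 1) * cnj (z $ j)"
proof -
  have "hermitian (axis j c) z = c * cnj (z $ j)" for c
  proof -
    have "hermitian (axis j c) z = (\<Sum>i\<in>UNIV. if i = j then c * cnj (z $ i) else 0)"
      unfolding hermitian_def by (intro sum.cong) (auto simp: axis_def)
    then show ?thesis by simp
  qed
  then show ?thesis by (simp add: coord_vector_def)
qed

lemma inner_coord_vector: "coord_vector a \<bullet> coord_vector b = (if a = b then 1 else 0)"
  by (cases a; cases b) (auto simp: coord_vector_def inner_axis_axis inner_complex_def)

text \<open>
  With \<open>r\<close> the squared norm of the lifted point, the metric in chart coordinates is \<open>1 / r\<close> times the
  identity minus a rank two term, namely \<open>1 / r\<^sup>2\<close> times the projections (up to length) to the orthogonal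
  vectors \<open>P\<close> and \<open>Q\<close> of square length \<open>r - 1\<close>.  Padding by \<open>1 / r\<close> in the two missing coordinates keeps
  this form and gives an operator with eigenvalue \<open>1 / r\<^sup>2\<close> on the span of \<open>P\<close> and \<open>Q\<close> and \<open>1 / r\<close>
  elsewhere.
\<close>

lemma fs_density_eq:
  fixes w :: "'n::finite \<Rightarrow> complex"
  shows "fs_density i w = 1 / norm (chart_lift i w) ^ (2 * CARD('n))"
proof -
  define z where "z = chart_lift i w"
  have zi: "z $ i = 1" by (simp add: z_def chart_lift_def)
  then have z0: "z \<noteq> 0" by auto
  define r where "r = (norm z)\<^sup>2"
  have r: "r > 0" using z0 by (simp add: r_def)
  define S :: "('n \<times> bool) set" where "S = (- {i}) \<times> UNIV"
  define \<eta> where "\<eta> a = hermitian (coord_vector a) z" for a :: "'n \<times> bool"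
  define P :: "real^('n \<times> bool)" where "P = (\<chi> a. if a \<in> S then Re (\<eta> a) else 0)"
  define Q :: "real^('n \<times> bool)" where "Q = (\<chi> a. if a \<in> S then Im (\<eta> a) else 0)"
  define f where "f v = (1 / r) *\<^sub>R v - ((P \<bullet> v) / r\<^sup>2) *\<^sub>R P - ((Q \<bullet> v) / r\<^sup>2) *\<^sub>R Q" for v
  have linf: "linear f"
    by (rule linearI) (simp_all add: f_def inner_add_right add_divide_distrib scaleR_add_left scaleR_add_right algebra_simps)
  have mat: "matrix f = (\<chi> a b. if a \<in> S \<and> b \<in> S then fs_metric z (coord_vector a) (coord_vector b) else if a = b then 1 / r else 0)"
  proof -
    have "matrix f $ a $ b = (if a \<in> S \<and> b \<in> S then fs_metric z (coord_vector a) (coord_vector b) else if a = b then 1 / r else 0)" for a b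
    proof -
      have "matrix f $ a $ b = (if a = b then 1 / r else 0) - (P $ a * P $ b + Q $ a * Q $ b) / r\<^sup>2"
      proof -
        have ax: "axis b (1::real) $ a = (if a = b then 1 else 0)" by (simp add: axis_def)
        show ?thesis by (simp add: matrix_def f_def inner_axis ax add_divide_distrib mult.commute)
      qed
      moreover have "fs_metric z (coord_vector a) (coord_vector b) = ((if a = b then 1 else 0) - (Re (\<eta> a) * Re (\<eta> b) + Im (\<eta> a) * Im (\<eta> b)) / r) / r"
        unfolding fs_metric_def horizontal_inner[OF z0] by (simp add: inner_coord_vector \<eta>_def r_def)
      ultimately show ?thesis
        by (auto simp: P_def Q_def diff_divide_distrib power2_eq_square)
    qed
    then show ?thesis by (simp add: vec_eq_iff)
  qed
  have sumS: "(\<Sum>a\<in>UNIV. if a \<in> S then g a else 0) = (\<Sum>j\<in>- {i}. g (j, False) + g (j, True))" for g :: "'n \<times> bool \<Rightarrow> real"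
  proof -
    have "(\<Sum>a\<in>UNIV. if a \<in> S then g a else 0) = (\<Sum>a\<in>S. g a)" by (simp add: sum.If_cases)
    also have "\<dots> = (\<Sum>j\<in>- {i}. \<Sum>b\<in>UNIV. g (j, b))" by (simp add: S_def sum.cartesian_product)
    finally show ?thesis by (simp add: UNIV_bool add.commute)
  qed
  have \<eta>: "\<eta> (j, False) = cnj (z $ j)" "\<eta> (j, True) = \<i> * cnj (z $ j)" for j
    by (simp_all add: \<eta>_def hermitian_coord_vector)
  have rsum: "r = 1 + (\<Sum>j\<in>- {i}. (Re (z $ j))\<^sup>2 + (Im (z $ j))\<^sup>2)"
  proof -
    have "r = (\<Sum>j\<in>UNIV. (cmod (z $ j))\<^sup>2)"
      by (simp add: r_def norm_vec_def L2_set_def sum_nonneg)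
    also have "\<dots> = (cmod (z $ i))\<^sup>2 + (\<Sum>j\<in>UNIV - {i}. (cmod (z $ j))\<^sup>2)" by (simp add: sum.remove[of UNIV i])
    finally show ?thesis by (simp add: zi cmod_power2 Compl_eq_Diff_UNIV)
  qed
  have PP: "P \<bullet> P = r - 1"
  proof -
    have "P \<bullet> P = (\<Sum>a\<in>UNIV. if a \<in> S then (Re (\<eta> a))\<^sup>2 else 0)"
      unfolding inner_vec_def by (intro sum.cong) (auto simp: P_def power2_eq_square)
    then show ?thesis unfolding sumS by (simp add: \<eta> rsum)
  qed
  have QQ: "Q \<bullet> Q = r - 1"
  proof -
    have "Q \<bullet> Q = (\<Sum>a\<in>UNIV. if a \<in> S then (Im (\<eta> a))\<^sup>2 else 0)"
      unfolding inner_vec_def by (intro sum.cong) (auto simp: Q_def power2_eq_square)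
    then show ?thesis unfolding sumS by (simp add: \<eta> rsum add.commute)
  qed
  have PQ: "P \<bullet> Q = 0"
  proof -
    have "P \<bullet> Q = (\<Sum>a\<in>UNIV. if a \<in> S then Re (\<eta> a) * Im (\<eta> a) else 0)"
      unfolding inner_vec_def by (intro sum.cong) (auto simp: P_def Q_def)
    then show ?thesis unfolding sumS by (simp add: \<eta>)
  qed
  have "det (matrix f) = (1 / r) ^ (2 * CARD('n) + 2)"
  proof (cases "r = 1")
    case True
    then have "P = 0" "Q = 0" using PP QQ by auto
    then have "f v = v" for v using True by (simp add: f_def)
    then have "f = id" by auto
    then have "matrix f = mat 1" by (simp add: matrix_id_mat_1)
    then show ?thesis using True by simp
  next
    case False
    then have PQ0: "P \<noteq> 0" "Q \<noteq> 0" using PP QQ by auto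
    have "P \<noteq> Q" using PQ PP False by auto
    have "independent {P, Q}"
    proof (rule pairwise_orthogonal_independent)
      show "pairwise orthogonal {P, Q}"
        using PQ by (auto simp: pairwise_def orthogonal_def inner_commute)
    qed (use PQ0 in auto)
    then have dim: "dim (span {P, Q}) = 2"
      using \<open>P \<noteq> Q\<close> by (simp add: dim_eq_card_independent)
    have "det (matrix f) = (1 / r\<^sup>2) ^ dim (span {P, Q}) * (1 / r) ^ (CARD('n \<times> bool) - dim (span {P, Q}))"
    proof (rule det_two_eigenspaces[OF linf])
      have e: "(1 / r) - (r - 1) / r\<^sup>2 = 1 / r\<^sup>2" using r by (simp add: field_simps power2_eq_square)
      have "f P = (1 / r\<^sup>2) *\<^sub>R P" "f Q = (1 / r\<^sup>2) *\<^sub>R Q"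
        using PP QQ PQ e by (simp_all add: f_def inner_commute[of Q P] flip: scaleR_left_diff_distrib)
      then show "f v = (1 / r\<^sup>2) *\<^sub>R v" if "v \<in> span {P, Q}" for v
        by (intro linear_eq_on_span[OF linf _ _ that, of "\<lambda>v. (1 / r\<^sup>2) *\<^sub>R v"]) (auto simp: linear_iff algebra_simps)
      show "f v = (1 / r) *\<^sub>R v" if "v \<in> (span {P, Q})\<^sup>\<bottom>" for v
      proof -
        have "P \<bullet> v = 0" "Q \<bullet> v = 0"
          using that span_base[of P "{P, Q}"] span_base[of Q "{P, Q}"]
          by (auto simp: orthogonal_comp_def orthogonal_def)
        then show ?thesis by (simp add: f_def)
      qed
    qed (rule subspace_span)
    also have "\<dots> = (1 / r) ^ (4 + (CARD('n) * 2 - 2))"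
    proof -
      have sq: "1 / r\<^sup>2 = (1 / r)\<^sup>2" by (simp add: power_one_over)
      have "CARD('n \<times> bool) = CARD('n) * 2" by simp
      then show ?thesis
        unfolding dim sq power_mult[symmetric] power_add[symmetric] by simp
    qed
    also have "4 + (CARD('n) * 2 - 2) = 2 * CARD('n) + 2"
      using zero_less_card_finite[where 'a='n] by linarith
    finally show ?thesis .
  qed
  moreover have "det (matrix f) = (1 / r) ^ card (- S) * det_on S (\<lambda>a b. fs_metric z (coord_vector a) (coord_vector b))"
    unfolding mat by (rule det_on_eq_det)
  moreover have "card (- S) = 2"
  proof -
    have "- S = {i} \<times> UNIV" by (auto simp: S_def)
    then show ?thesis by (simp add: card_cartesian_product)
  qed
  ultimately have "(1 / r) ^ 2 * det_on S (\<lambda>a b. fs_metric z (coord_vector a) (coord_vector b)) = (1 / r) ^ 2 * (1 / r) ^ (2 * CARD('n))"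
    by (simp only: power_add mult.commute)
  then have "det_on S (\<lambda>a b. fs_metric z (coord_vector a) (coord_vector b)) = ((1 / r) ^ CARD('n))\<^sup>2"
    using r by (simp add: power_mult[symmetric] mult.commute)
  then have "fs_density i w = (1 / r) ^ CARD('n)"
    using r by (simp add: fs_density_def S_def z_def)
  also have "\<dots> = 1 / norm z ^ (2 * CARD('n))"
    by (simp add: r_def power_mult power_one_over)
  finally show ?thesis by (simp add: z_def)
qed

lemma measurable_vec_lambda:
  "(\<lambda>w. \<chi> j. w j) \<in> Pi\<^sub>M UNIV (\<lambda>_. lborel :: complex measure) \<rightarrow>\<^sub>M (borel :: (complex^'n::finite) measure)"
proof (subst borel_measurable_euclidean_space, intro ballI)
  fix b :: "complex^'n" assume "b \<in> Basis"
  then obtain j u where b: "b = axis j u" "u \<in> Basis" by (auto simp: Basis_vec_def)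
  have "(\<lambda>w. w j \<bullet> u) \<in> borel_measurable (Pi\<^sub>M UNIV (\<lambda>_. lborel :: complex measure))"
    by measurable
  then show "(\<lambda>w. (\<chi> j. w j) \<bullet> b) \<in> borel_measurable (Pi\<^sub>M UNIV (\<lambda>_. lborel :: complex measure))"
    by (simp add: b inner_axis)
qed

lemma lborel_vec_eq_PiM:
  "(lborel :: (complex^'n::finite) measure) = distr (Pi\<^sub>M UNIV (\<lambda>_. lborel)) borel (\<lambda>w. \<chi> j. w j)"
proof (rule lborel_eqI)
  interpret product_sigma_finite "\<lambda>_::'n. lborel :: complex measure" by standard
  fix l u :: "complex^'n" assume le: "\<And>b. b \<in> Basis \<Longrightarrow> l \<bullet> b \<le> u \<bullet> b"
  have le': "l $ j \<bullet> c \<le> u $ j \<bullet> c" if "c \<in> Basis" for j c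
    using le[of "axis j c"] that by (simp add: inner_axis axis_in_Basis_iff)
  have box: "(\<lambda>w. \<chi> j. w j) -` box l u \<inter> space (Pi\<^sub>M UNIV (\<lambda>_. lborel :: complex measure)) = (\<Pi>\<^sub>E j\<in>UNIV. box (l $ j) (u $ j))"
    by (auto simp: mem_box Basis_vec_def inner_axis space_PiM PiE_iff)
  have "emeasure (distr (Pi\<^sub>M UNIV (\<lambda>_. lborel)) borel (\<lambda>w. \<chi> j. w j)) (box l u) =
      emeasure (Pi\<^sub>M UNIV (\<lambda>_. lborel :: complex measure)) (\<Pi>\<^sub>E j\<in>UNIV. box (l $ j) (u $ j))"
    by (subst emeasure_distr[OF measurable_vec_lambda]) (auto simp: box)
  also have "\<dots> = (\<Prod>j\<in>UNIV. emeasure lborel (box (l $ j) (u $ j)))"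
    by (rule emeasure_PiM) auto
  also have "\<dots> = (\<Prod>j\<in>UNIV. ennreal (\<Prod>c\<in>Basis. (u $ j - l $ j) \<bullet> c))"
    using le' by (intro prod.cong refl emeasure_lborel_box) auto
  also have "\<dots> = ennreal (\<Prod>j\<in>UNIV. \<Prod>c\<in>Basis. (u $ j - l $ j) \<bullet> c)"
    using le' by (intro prod_ennreal prod_nonneg) (auto simp: inner_diff_left)
  also have "(\<Prod>j\<in>UNIV. \<Prod>c\<in>Basis. (u $ j - l $ j) \<bullet> c) = (\<Prod>(j, c)\<in>UNIV \<times> Basis. (u $ j - l $ j) \<bullet> c)"
    by (rule prod.cartesian_product)
  also have "\<dots> = (\<Prod>b\<in>Basis. (u - l) \<bullet> b)"
  \<comment> \<open>The choice inverts the bijection (j, c) \<mapsto> axis j c onto the standard basis.\<close>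
  proof (rule prod.reindex_bij_witness[of _ "\<lambda>b. SOME p. snd p \<in> Basis \<and> b = axis (fst p) (snd p)" "\<lambda>(j, c). axis j c"])
    fix p :: "'n \<times> complex" assume p: "p \<in> UNIV \<times> Basis"
    show "(SOME q. snd q \<in> Basis \<and> (case p of (j, c) \<Rightarrow> axis j c) = axis (fst q) (snd q)) = p"
    proof (rule some_equality)
      fix q :: "'n \<times> complex" assume "snd q \<in> Basis \<and> (case p of (j, c) \<Rightarrow> axis j c) = axis (fst q) (snd q)"
      then show "q = p" using p by (auto simp: axis_eq_axis prod_eq_iff split: prod.splits)
    qed (use p in auto)
  next
    fix b :: "complex^'n" assume "b \<in> Basis"
    then have "\<exists>q. snd q \<in> Basis \<and> b = axis (fst q) (snd q)" by (auto simp: Basis_vec_def)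
    from someI_ex[OF this]
    show "(case SOME q. snd q \<in> Basis \<and> b = axis (fst q) (snd q) of (j, c) \<Rightarrow> axis j c) = b"
      and "(SOME q. snd q \<in> Basis \<and> b = axis (fst q) (snd q)) \<in> UNIV \<times> Basis"
      by (auto split: prod.splits simp: mem_Times_iff)
  qed (auto simp: inner_axis axis_in_Basis_iff)
  finally show "emeasure (distr (Pi\<^sub>M UNIV (\<lambda>_. lborel)) borel (\<lambda>w. \<chi> j. w j)) (box l u) = (\<Prod>b\<in>Basis. (u - l) \<bullet> b)" .
qed simp

text \<open>
  Multiplication by \<open>c\<close> is a rotation composed with a real dilation.
\<close>

lemma nn_integral_complex_scaling:
  fixes g :: "complex \<Rightarrow> ennreal"
  assumes c: "c \<noteq> 0" and [measurable]: "g \<in> borel_measurable borel"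
  shows "(\<integral>\<^sup>+z. g z \<partial>lborel) = ennreal ((cmod c)\<^sup>2) * (\<integral>\<^sup>+z. g (c * z) \<partial>lborel)"
proof -
  define u where "u = c / complex_of_real (cmod c)"
  have u: "cmod u = 1" using c by (simp add: u_def norm_divide)
  have dim: "DIM(complex) = CARD(2)" by simp
  have [measurable]: "(*) a \<in> borel \<rightarrow>\<^sub>M borel" for a :: complex by measurable
  have rot: "distr lborel borel ((*) u) = (lborel :: complex measure)"
    by (rule distr_lborel_isometry[OF dim]) (auto simp: linear_iff algebra_simps norm_mult u)
  have "(\<integral>\<^sup>+z. g z \<partial>lborel) = (\<integral>\<^sup>+z. g z \<partial>distr lborel borel ((*) u))" by (simp only: rot)
  also have "\<dots> = (\<integral>\<^sup>+z. g (u * z) \<partial>lborel)" by (simp add: nn_integral_distr)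
  also have "\<dots> = (\<integral>\<^sup>+z. g (u * z) \<partial>density (distr lborel borel (\<lambda>x. 0 + cmod c *\<^sub>R x)) (\<lambda>_. \<bar>cmod c\<bar> ^ DIM(complex)))"
    using lborel_affine[of "cmod c" "0 :: complex"] c by (simp only: norm_eq_zero not_False_eq_True)
  also have "\<dots> = ennreal ((cmod c)\<^sup>2) * (\<integral>\<^sup>+z. g (u * (cmod c *\<^sub>R z)) \<partial>lborel)"
    by (simp add: nn_integral_density nn_integral_distr nn_integral_cmult)
  also have "(\<lambda>z. g (u * (cmod c *\<^sub>R z))) = (\<lambda>z. g (c * z))"
    using c by (simp add: u_def scaleR_conv_of_real)
  finally show ?thesis .
qed

lemma measurable_scaling_PiM:
  "(\<lambda>w. \<lambda>j\<in>I. c * w j) \<in> Pi\<^sub>M I (\<lambda>_. lborel :: complex measure) \<rightarrow>\<^sub>M Pi\<^sub>M I (\<lambda>_. lborel :: complex measure)"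
  by (rule measurable_restrict) measurable

lemma nn_integral_PiM_scaling:
  fixes g :: "('i \<Rightarrow> complex) \<Rightarrow> ennreal"
  assumes c: "c \<noteq> 0" and I: "finite I" and g: "g \<in> borel_measurable (Pi\<^sub>M I (\<lambda>_. lborel))"
  shows "(\<integral>\<^sup>+w. g w \<partial>Pi\<^sub>M I (\<lambda>_. lborel)) = ennreal (cmod c ^ (2 * card I)) * (\<integral>\<^sup>+w. g (\<lambda>j\<in>I. c * w j) \<partial>Pi\<^sub>M I (\<lambda>_. lborel))"
  using I g
proof (induction I arbitrary: g)
  case empty
  then show ?case by (simp add: PiM_empty nn_integral_count_space_finite)
next
  case (insert i I)
  interpret product_sigma_finite "\<lambda>_::'i. lborel :: complex measure" by standard
  note [measurable] = insert.prems
  have mg: "(\<lambda>y. g (x(i := y))) \<in> borel_measurable borel" if "x \<in> space (Pi\<^sub>M I (\<lambda>_. lborel))" for x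
  proof -
    have "(\<lambda>y. x(i := y)) \<in> lborel \<rightarrow>\<^sub>M Pi\<^sub>M (insert i I) (\<lambda>_. lborel)"
      using that by measurable
    from measurable_compose[OF this insert.prems] show ?thesis unfolding measurable_lborel1 measurable_lborel2 .
  qed
  define G where "G x = (\<integral>\<^sup>+y. g (x(i := c * y)) \<partial>lborel)" for x
  have [measurable]: "G \<in> borel_measurable (Pi\<^sub>M I (\<lambda>_. lborel))"
    unfolding G_def by measurable
  have "(\<integral>\<^sup>+w. g w \<partial>Pi\<^sub>M (insert i I) (\<lambda>_. lborel)) = (\<integral>\<^sup>+x. \<integral>\<^sup>+y. g (x(i := y)) \<partial>lborel \<partial>Pi\<^sub>M I (\<lambda>_. lborel))"
    using insert by (intro product_nn_integral_insert) auto
  also have "\<dots> = (\<integral>\<^sup>+x. ennreal ((cmod c)\<^sup>2) * G x \<partial>Pi\<^sub>M I (\<lambda>_. lborel))"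
    unfolding G_def by (intro nn_integral_cong nn_integral_complex_scaling[OF c mg])
  also have "\<dots> = ennreal ((cmod c)\<^sup>2) * (\<integral>\<^sup>+x. G x \<partial>Pi\<^sub>M I (\<lambda>_. lborel))"
    by (rule nn_integral_cmult) measurable
  also have "(\<integral>\<^sup>+x. G x \<partial>Pi\<^sub>M I (\<lambda>_. lborel)) = ennreal (cmod c ^ (2 * card I)) * (\<integral>\<^sup>+x. G (\<lambda>j\<in>I. c * x j) \<partial>Pi\<^sub>M I (\<lambda>_. lborel))"
    by (rule insert.IH) measurable
  also have "(\<integral>\<^sup>+x. G (\<lambda>j\<in>I. c * x j) \<partial>Pi\<^sub>M I (\<lambda>_. lborel)) =
      (\<integral>\<^sup>+x. \<integral>\<^sup>+y. g (\<lambda>j\<in>insert i I. c * (x(i := y)) j) \<partial>lborel \<partial>Pi\<^sub>M I (\<lambda>_. lborel))"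
  proof -
    have "(\<lambda>j\<in>I. c * x j)(i := c * y) = (\<lambda>j\<in>insert i I. c * (x(i := y)) j)" for x y
      using insert by (auto simp: fun_eq_iff restrict_def)
    then show ?thesis by (simp only: G_def)
  qed
  also have "\<dots> = (\<integral>\<^sup>+w. g (\<lambda>j\<in>insert i I. c * w j) \<partial>Pi\<^sub>M (insert i I) (\<lambda>_. lborel))"
    using insert measurable_compose[OF measurable_scaling_PiM insert.prems]
    by (intro product_nn_integral_insert[symmetric]) auto
  also have "ennreal ((cmod c)\<^sup>2) * (ennreal (cmod c ^ (2 * card I)) * T) = ennreal (cmod c ^ (2 * card (insert i I))) * T" for T
    using insert.hyps by (simp add: ennreal_mult'[symmetric] mult.assoc[symmetric] power2_eq_square)
  finally show ?case .
qed

lemma measurable_chart_lift: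
  "(\<lambda>(\<zeta>, w). \<zeta> *s chart_lift i w) \<in> lborel \<Otimes>\<^sub>M Pi\<^sub>M (- {i}) (\<lambda>_. lborel :: complex measure) \<rightarrow>\<^sub>M (borel :: (complex^'n::finite) measure)"
proof (subst borel_measurable_euclidean_space, intro ballI)
  fix b :: "complex^'n" assume "b \<in> Basis"
  then obtain j u where b: "b = axis j u" "u \<in> Basis" by (auto simp: Basis_vec_def)
  show "(\<lambda>x. (case x of (\<zeta>, w) \<Rightarrow> \<zeta> *s chart_lift i w) \<bullet> b) \<in> borel_measurable (lborel \<Otimes>\<^sub>M Pi\<^sub>M (- {i}) (\<lambda>_. lborel :: complex measure))"
  proof (cases "j = i")
    case True
    have "(\<lambda>x. fst x \<bullet> u) \<in> borel_measurable (lborel \<Otimes>\<^sub>M Pi\<^sub>M (- {i}) (\<lambda>_. lborel :: complex measure))"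
      by measurable
    then show ?thesis using True by (simp add: b inner_axis chart_lift_def case_prod_beta)
  next
    case False
    then have [simp]: "j \<in> - {i}" by simp
    have [measurable]: "(\<lambda>x. snd x j) \<in> borel_measurable (lborel \<Otimes>\<^sub>M Pi\<^sub>M (- {i}) (\<lambda>_. lborel :: complex measure))"
      using measurable_compose[OF measurable_snd measurable_component_singleton[OF \<open>j \<in> - {i}\<close>, of "\<lambda>_. lborel"]]
      by simp
    have "(\<lambda>x. (fst x * snd x j) \<bullet> u) \<in> borel_measurable (lborel \<Otimes>\<^sub>M Pi\<^sub>M (- {i}) (\<lambda>_. lborel :: complex measure))"
      by measurable
    then show ?thesis using False by (simp add: b inner_axis chart_lift_def case_prod_beta)
  qed
qed

text \<open>
  Integration over complex lines: with \<open>\<zeta>\<close> the \<open>i\<close>-th coordinate, the remaining \<open>n\<close> coordinates are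
  rescaled by \<open>\<zeta>\<close>, which produces the factor \<open>cmod \<zeta> ^ (2 * n)\<close>.
\<close>

lemma nn_integral_lborel_chart:
  fixes K :: "complex^'n::finite \<Rightarrow> ennreal"
  assumes K[measurable]: "K \<in> borel_measurable borel"
  shows "(\<integral>\<^sup>+z. K z \<partial>lborel) =
    (\<integral>\<^sup>+w. \<integral>\<^sup>+\<zeta>. ennreal (cmod \<zeta> ^ (2 * (CARD('n) - 1))) * K (\<zeta> *s chart_lift i w) \<partial>lborel \<partial>Pi\<^sub>M (- {i}) (\<lambda>_. lborel))"
proof -
  interpret product_sigma_finite "\<lambda>_::'n. lborel :: complex measure" by standard
  have U: "UNIV = insert i (- {i})" by auto
  have mK: "(\<lambda>w. K (\<chi> j. w j)) \<in> borel_measurable (Pi\<^sub>M UNIV (\<lambda>_. lborel))"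
    using measurable_compose[OF measurable_vec_lambda K] .
  have mK': "(\<lambda>w. K (\<chi> j. w j)) \<in> borel_measurable (Pi\<^sub>M (insert i (- {i})) (\<lambda>_. lborel))"
    using mK unfolding U[symmetric] .
  have mch: "(\<lambda>x. ennreal (cmod (fst x) ^ (2 * (CARD('n) - 1))) * K (fst x *s chart_lift i (snd x)))
      \<in> borel_measurable (lborel \<Otimes>\<^sub>M Pi\<^sub>M (- {i}) (\<lambda>_. lborel))"
    using measurable_compose[OF measurable_chart_lift K] unfolding case_prod_beta by measurable
  have "(\<integral>\<^sup>+z. K z \<partial>lborel) = (\<integral>\<^sup>+w. K (\<chi> j. w j) \<partial>Pi\<^sub>M UNIV (\<lambda>_. lborel))"
    by (subst lborel_vec_eq_PiM) (simp add: nn_integral_distr[OF measurable_vec_lambda])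
  also have "\<dots> = (\<integral>\<^sup>+\<zeta>. \<integral>\<^sup>+u. K (\<chi> j. (u(i := \<zeta>)) j) \<partial>Pi\<^sub>M (- {i}) (\<lambda>_. lborel) \<partial>lborel)"
    using product_nn_integral_insert_rev[OF _ _ mK'] unfolding U[symmetric] by simp
  also have "\<dots> = (\<integral>\<^sup>+\<zeta>. \<integral>\<^sup>+w. ennreal (cmod \<zeta> ^ (2 * (CARD('n) - 1))) * K (\<zeta> *s chart_lift i w) \<partial>Pi\<^sub>M (- {i}) (\<lambda>_. lborel) \<partial>lborel)"
  proof (rule nn_integral_cong_AE)
    have "AE \<zeta> in lborel. \<zeta> \<noteq> (0::complex)" by (rule AE_lborel_singleton)
    then show "AE \<zeta> in lborel. (\<integral>\<^sup>+u. K (\<chi> j. (u(i := \<zeta>)) j) \<partial>Pi\<^sub>M (- {i}) (\<lambda>_. lborel)) =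
      (\<integral>\<^sup>+w. ennreal (cmod \<zeta> ^ (2 * (CARD('n) - 1))) * K (\<zeta> *s chart_lift i w) \<partial>Pi\<^sub>M (- {i}) (\<lambda>_. lborel))"
    proof eventually_elim
      case (elim \<zeta>)
      have "(\<lambda>u. u(i := \<zeta>)) \<in> Pi\<^sub>M (- {i}) (\<lambda>_. lborel) \<rightarrow>\<^sub>M Pi\<^sub>M (insert i (- {i})) (\<lambda>_. lborel :: complex measure)"
        by measurable
      from measurable_compose[OF this mK']
      have m: "(\<lambda>u. K (\<chi> j. (u(i := \<zeta>)) j)) \<in> borel_measurable (Pi\<^sub>M (- {i}) (\<lambda>_. lborel))" .
      have eq: "(\<chi> j. ((\<lambda>j\<in>- {i}. \<zeta> * w j)(i := \<zeta>)) j) = \<zeta> *s chart_lift i w" for w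
        by (auto simp: vec_eq_iff chart_lift_def)
      have m2: "(\<lambda>w. K (\<zeta> *s chart_lift i w)) \<in> borel_measurable (Pi\<^sub>M (- {i}) (\<lambda>_. lborel))"
        using measurable_compose[OF measurable_scaling_PiM[where c = \<zeta>] m] unfolding eq .
      have "(\<integral>\<^sup>+u. K (\<chi> j. (u(i := \<zeta>)) j) \<partial>Pi\<^sub>M (- {i}) (\<lambda>_. lborel)) =
          ennreal (cmod \<zeta> ^ (2 * card (- {i}))) * (\<integral>\<^sup>+w. K (\<zeta> *s chart_lift i w) \<partial>Pi\<^sub>M (- {i}) (\<lambda>_. lborel))"
        using nn_integral_PiM_scaling[OF elim _ m] unfolding eq by simp
      also have "card (- {i}) = CARD('n) - 1" by (simp add: Compl_eq_Diff_UNIV card_Diff_singleton)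
      finally show ?case by (simp add: nn_integral_cmult m2)
    qed
  qed
  also have "\<dots> = (\<integral>\<^sup>+w. \<integral>\<^sup>+\<zeta>. ennreal (cmod \<zeta> ^ (2 * (CARD('n) - 1))) * K (\<zeta> *s chart_lift i w) \<partial>lborel \<partial>Pi\<^sub>M (- {i}) (\<lambda>_. lborel))"
  proof -
    have sf: "sigma_finite_measure (Pi\<^sub>M (- {i}) (\<lambda>_. lborel :: complex measure))"
      by (rule sigma_finite) simp
    interpret pair_sigma_finite "lborel :: complex measure" "Pi\<^sub>M (- {i}) (\<lambda>_. lborel :: complex measure)"
      by (intro pair_sigma_finite.intro sf sigma_finite_lborel)
    show ?thesis
      using Fubini'[of "\<lambda>\<zeta> w. ennreal (cmod \<zeta> ^ (2 * (CARD('n) - 1))) * K (\<zeta> *s chart_lift i w)"] mch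
      by (simp add: case_prod_beta')
  qed
  finally show ?thesis .
qed

text \<open>
  The contribution of each complex line in the cone formula below.
\<close>

definition fiber_constant :: "nat \<Rightarrow> ennreal" where
  "fiber_constant n = (\<integral>\<^sup>+\<zeta>. ennreal (cmod \<zeta> ^ (2 * n)) * indicator {\<zeta>. cmod \<zeta> \<le> 1} \<zeta> \<partial>(lborel :: complex measure))"

lemma fiber_constant_finite: "fiber_constant n < \<infinity>"
proof -
  have "fiber_constant n \<le> (\<integral>\<^sup>+\<zeta>. indicator (cball 0 1) \<zeta> \<partial>(lborel :: complex measure))"
    unfolding fiber_constant_def
    by (intro nn_integral_mono) (auto simp: indicator_def power_le_one)
  also have "\<dots> = emeasure lborel (cball (0::complex) 1)" by simp
  also have "\<dots> < \<infinity>" by (rule emeasure_lborel_cball_finite)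
  finally show ?thesis .
qed

lemma fiber_constant_pos: "0 < fiber_constant n"
proof -
  have "fiber_constant n \<noteq> 0"
  proof
    assume "fiber_constant n = 0"
    then have "AE \<zeta> in (lborel :: complex measure). ennreal (cmod \<zeta> ^ (2 * n)) * indicator {\<zeta>. cmod \<zeta> \<le> 1} \<zeta> = 0"
      unfolding fiber_constant_def by (subst (asm) nn_integral_0_iff_AE) auto
    moreover have "AE \<zeta> in lborel. \<zeta> \<noteq> (0::complex)" by (rule AE_lborel_singleton)
    ultimately have "AE \<zeta> in (lborel :: complex measure). \<zeta> \<notin> ball 0 1"
      by eventually_elim (auto simp: indicator_def)
    then have "emeasure lborel (ball (0::complex) 1) = 0"
      by (subst (asm) AE_iff_measurable[of "ball 0 1"]) auto
    moreover have "0 < measure lborel (ball (0::complex) 1)" by (rule content_ball_pos) simp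
    ultimately show False by (simp add: measure_def)
  qed
  then show ?thesis by (simp add: zero_less_iff_neq_zero)
qed

text \<open>
  Integration over \<open>{z. N z \<le> 1}\<close> is carried out along complex lines.  The line through a lifted chart
  point \<open>z\<close> meets this set in the disc of radius \<open>1 / N z\<close>, on which \<open>cmod \<zeta> ^ (2 * n)\<close> integrates to the
  fibre constant times \<open>N z\<close> to the power \<open>- 2 (n + 1)\<close>.  The factor in the integrand cancels this and leaves
  \<open>norm z\<close> to the power \<open>- 2 (n + 1)\<close>, which is the Fubini--Study density.  The gauge \<open>N\<close> is arbitrary so
  that the volume can be computed both in the unit ball and in the region where the nearest point of
  a cone has norm at most 1.
\<close>

theorem fs_volume_cone_formula:
  fixes H :: "complex^'n::finite \<Rightarrow> ennreal" and N :: "complex^'n \<Rightarrow> real"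
  assumes H[measurable]: "H \<in> borel_measurable borel" and N[measurable]: "N \<in> borel_measurable borel"
    and Hhom: "\<And>\<zeta> z. \<zeta> \<noteq> 0 \<Longrightarrow> H (\<zeta> *s z) = H z"
    and Nhom: "\<And>\<zeta> z. N (\<zeta> *s z) = cmod \<zeta> * N z"
    and H0: "\<And>z. N z \<le> 0 \<Longrightarrow> H z = 0"
  shows "(\<integral>\<^sup>+z. H z * ennreal ((N z / norm z) ^ (2 * CARD('n))) * indicator {z. N z \<le> 1} z \<partial>lborel) =
    fiber_constant (CARD('n) - 1) * (\<Sum>i\<in>UNIV. \<integral>\<^sup>+w. H (chart_lift i w) *
      ennreal ((cmod (chart_lift i w $ i) / norm (chart_lift i w))\<^sup>2 * fs_density i w) \<partial>Pi\<^sub>M (- {i}) (\<lambda>_. lborel))"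
proof -
  define F where "F z = H z * ennreal ((N z / norm z) ^ (2 * CARD('n))) * indicator {z. N z \<le> 1} z" for z
  have [measurable]: "F \<in> borel_measurable borel" unfolding F_def by measurable
  \<comment> \<open>The share of the i-th chart under the partition of unity.\<close>
  define K where "K i z = F z * ennreal ((cmod (z $ i) / norm z)\<^sup>2)" for i z
  have mK: "K i \<in> borel_measurable borel" for i
  proof -
    have [measurable]: "(\<lambda>z::complex^'n. z $ i) \<in> borel_measurable borel" "(norm :: complex^'n \<Rightarrow> real) \<in> borel_measurable borel"
      by (intro borel_measurable_continuous_onI continuous_intros)+
    show ?thesis unfolding K_def by measurable
  qed
  have sumK: "F z = (\<Sum>i\<in>UNIV. K i z)" for z
  proof (cases "z = 0")
    case True
    have "N 0 = 0" using Nhom[of 0 0] by simp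
    then show ?thesis using True H0[of 0] by (simp add: K_def F_def)
  next
    case False
    have "(\<Sum>i\<in>UNIV. (cmod (z $ i) / norm z)\<^sup>2) = (\<Sum>i\<in>UNIV. (cmod (z $ i))\<^sup>2) / (norm z)\<^sup>2"
      by (simp add: power_divide sum_divide_distrib)
    also have "(\<Sum>i\<in>UNIV. (cmod (z $ i))\<^sup>2) = (norm z)\<^sup>2" by (simp add: norm_vec_def L2_set_def sum_nonneg)
    finally have "(\<Sum>i\<in>UNIV. (cmod (z $ i) / norm z)\<^sup>2) = 1" using False by simp
    then show ?thesis
      unfolding K_def sum_distrib_left[symmetric] by (simp add: sum_ennreal)
  qed
  have inner: "(\<integral>\<^sup>+\<zeta>. ennreal (cmod \<zeta> ^ (2 * (CARD('n) - 1))) * K i (\<zeta> *s chart_lift i w) \<partial>lborel) =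
      fiber_constant (CARD('n) - 1) * (H (chart_lift i w) *
      ennreal ((cmod (chart_lift i w $ i) / norm (chart_lift i w))\<^sup>2 * fs_density i w))" for i w
  proof -
    define z where "z = chart_lift i w"
    have zi: "z $ i = 1" by (simp add: z_def chart_lift_def)
    then have z0: "norm z > 0" by auto
    define M where "M = N z"
    let ?m = "CARD('n) - 1"
    show ?thesis
    proof (cases "M > 0")
      case False
      then have "H z = 0" using H0[of z] by (simp add: M_def)
      then have "K i (\<zeta> *s z) = 0" for \<zeta>
      proof (cases "\<zeta> = 0")
        case True
        then show ?thesis using H0[of 0] Nhom[of 0 0] by (simp add: K_def F_def)
      qed (simp add: K_def F_def Hhom \<open>H z = 0\<close>)
      then show ?thesis using \<open>H z = 0\<close> by (simp add: z_def[symmetric])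
    next
      case M: True
      have Kz: "K i (\<zeta> *s z) = H z * ennreal (((M / norm z) ^ (2 * CARD('n))) * (1 / norm z)\<^sup>2) * indicator {\<zeta>. cmod \<zeta> \<le> 1} (complex_of_real M * \<zeta>)"
        if "\<zeta> \<noteq> 0" for \<zeta>
        using that M z0
        by (auto simp: K_def F_def Hhom Nhom M_def[symmetric] norm_vec_smult zi norm_mult ennreal_mult'[symmetric] indicator_def mult_ac
            power_divide power_mult_distrib)
      have "(\<integral>\<^sup>+\<zeta>. ennreal (cmod \<zeta> ^ (2 * ?m)) * K i (\<zeta> *s z) \<partial>lborel) =
          (\<integral>\<^sup>+\<zeta>. (H z * ennreal (((M / norm z) ^ (2 * CARD('n))) * (1 / norm z)\<^sup>2)) *
            (ennreal (cmod \<zeta> ^ (2 * ?m)) * indicator {\<zeta>. cmod \<zeta> \<le> 1} (complex_of_real M * \<zeta>)) \<partial>lborel)"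
      proof (rule nn_integral_cong_AE)
        have "AE \<zeta> in lborel. \<zeta> \<noteq> (0::complex)" by (rule AE_lborel_singleton)
        then show "AE \<zeta> in lborel. ennreal (cmod \<zeta> ^ (2 * ?m)) * K i (\<zeta> *s z) =
            (H z * ennreal (((M / norm z) ^ (2 * CARD('n))) * (1 / norm z)\<^sup>2)) *
            (ennreal (cmod \<zeta> ^ (2 * ?m)) * indicator {\<zeta>. cmod \<zeta> \<le> 1} (complex_of_real M * \<zeta>))"
          by eventually_elim (simp add: Kz mult_ac)
      qed
      also have "\<dots> = (H z * ennreal (((M / norm z) ^ (2 * CARD('n))) * (1 / norm z)\<^sup>2)) *
          (\<integral>\<^sup>+\<zeta>. ennreal (cmod \<zeta> ^ (2 * ?m)) * indicator {\<zeta>. cmod \<zeta> \<le> 1} (complex_of_real M * \<zeta>) \<partial>lborel)"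
        by (rule nn_integral_cmult) measurable
      also have "ennreal (((M / norm z) ^ (2 * CARD('n))) * (1 / norm z)\<^sup>2)
          = ennreal (M ^ (2 * CARD('n))) * ennreal ((cmod (z $ i) / norm z)\<^sup>2 * fs_density i w)"
        using M z0 by (simp add: fs_density_eq z_def[symmetric] zi ennreal_mult[symmetric] power_divide mult_ac)
      also have "(H z * (ennreal (M ^ (2 * CARD('n))) * ennreal ((cmod (z $ i) / norm z)\<^sup>2 * fs_density i w))) *
          (\<integral>\<^sup>+\<zeta>. ennreal (cmod \<zeta> ^ (2 * ?m)) * indicator {\<zeta>. cmod \<zeta> \<le> 1} (complex_of_real M * \<zeta>) \<partial>lborel)
        = (H z * ennreal ((cmod (z $ i) / norm z)\<^sup>2 * fs_density i w)) * (ennreal (M ^ (2 * CARD('n))) *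
          (\<integral>\<^sup>+\<zeta>. ennreal (cmod \<zeta> ^ (2 * ?m)) * indicator {\<zeta>. cmod \<zeta> \<le> 1} (complex_of_real M * \<zeta>) \<partial>lborel))"
        by (simp only: mult_ac)
      also have "ennreal (M ^ (2 * CARD('n))) *
          (\<integral>\<^sup>+\<zeta>. ennreal (cmod \<zeta> ^ (2 * ?m)) * indicator {\<zeta>. cmod \<zeta> \<le> 1} (complex_of_real M * \<zeta>) \<partial>lborel) = fiber_constant ?m"
      proof -
        have "fiber_constant ?m = ennreal (M\<^sup>2) * (\<integral>\<^sup>+\<zeta>. ennreal (cmod (complex_of_real M * \<zeta>) ^ (2 * ?m)) * indicator {\<zeta>. cmod \<zeta> \<le> 1} (complex_of_real M * \<zeta>) \<partial>lborel)"
          unfolding fiber_constant_def using M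
          by (subst nn_integral_complex_scaling[of "complex_of_real M"]) auto
        also have "(\<lambda>\<zeta>. ennreal (cmod (complex_of_real M * \<zeta>) ^ (2 * ?m)) * indicator {\<zeta>. cmod \<zeta> \<le> 1} (complex_of_real M * \<zeta>)) =
          (\<lambda>\<zeta>. ennreal (M ^ (2 * ?m)) * (ennreal (cmod \<zeta> ^ (2 * ?m)) * indicator {\<zeta>. cmod \<zeta> \<le> 1} (complex_of_real M * \<zeta>)))"
          using M by (simp add: norm_mult power_mult_distrib ennreal_mult mult.assoc)
        also have "(\<integral>\<^sup>+\<zeta>. ennreal (M ^ (2 * ?m)) * (ennreal (cmod \<zeta> ^ (2 * ?m)) * indicator {\<zeta>. cmod \<zeta> \<le> 1} (complex_of_real M * \<zeta>)) \<partial>lborel)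
          = ennreal (M ^ (2 * ?m)) * (\<integral>\<^sup>+\<zeta>. ennreal (cmod \<zeta> ^ (2 * ?m)) * indicator {\<zeta>. cmod \<zeta> \<le> 1} (complex_of_real M * \<zeta>) \<partial>lborel)"
          by (rule nn_integral_cmult) measurable
        finally have "fiber_constant ?m = (ennreal (M\<^sup>2) * ennreal (M ^ (2 * ?m))) * (\<integral>\<^sup>+\<zeta>. ennreal (cmod \<zeta> ^ (2 * ?m)) * indicator {\<zeta>. cmod \<zeta> \<le> 1} (complex_of_real M * \<zeta>) \<partial>lborel)"
          by (simp only: mult.assoc)
        also have "ennreal (M\<^sup>2) * ennreal (M ^ (2 * ?m)) = ennreal (M ^ (2 * CARD('n)))"
        proof -
          have "2 + 2 * ?m = 2 * CARD('n)" using zero_less_card_finite[where 'a='n] by linarith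
          then show ?thesis using M by (simp add: ennreal_mult[symmetric] power_add[symmetric])
        qed
        finally show ?thesis ..
      qed
      finally show ?thesis by (simp only: z_def[symmetric] mult_ac)
    qed
  qed
  have mchart: "(\<lambda>w. H (chart_lift i w) * ennreal ((cmod (chart_lift i w $ i) / norm (chart_lift i w))\<^sup>2 * fs_density i w))
      \<in> borel_measurable (Pi\<^sub>M (- {i}) (\<lambda>_. lborel))" for i
  proof -
    have "(\<lambda>w. (1::complex, w)) \<in> Pi\<^sub>M (- {i}) (\<lambda>_. lborel) \<rightarrow>\<^sub>M lborel \<Otimes>\<^sub>M Pi\<^sub>M (- {i}) (\<lambda>_. lborel :: complex measure)"
      by measurable
    from measurable_compose[OF this measurable_chart_lift]
    have cl[measurable]: "chart_lift i \<in> Pi\<^sub>M (- {i}) (\<lambda>_. lborel) \<rightarrow>\<^sub>M borel" by simp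
    have [measurable]: "(\<lambda>w. norm (chart_lift i w)) \<in> borel_measurable (Pi\<^sub>M (- {i}) (\<lambda>_. lborel))"
      by (rule measurable_compose[OF cl]) (intro borel_measurable_continuous_onI continuous_intros)
    have "chart_lift i w $ i = 1" for w by (simp add: chart_lift_def)
    then show ?thesis unfolding fs_density_eq by simp
  qed
  have "(\<integral>\<^sup>+z. F z \<partial>lborel) = (\<Sum>i\<in>UNIV. \<integral>\<^sup>+z. K i z \<partial>lborel)"
    unfolding sumK by (rule nn_integral_sum) (use mK in auto)
  also have "\<dots> = (\<Sum>i\<in>UNIV. \<integral>\<^sup>+w. fiber_constant (CARD('n) - 1) * (H (chart_lift i w) *
      ennreal ((cmod (chart_lift i w $ i) / norm (chart_lift i w))\<^sup>2 * fs_density i w)) \<partial>Pi\<^sub>M (- {i}) (\<lambda>_. lborel))"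
  proof (intro sum.cong refl)
    fix i
    show "(\<integral>\<^sup>+z. K i z \<partial>lborel) = (\<integral>\<^sup>+w. fiber_constant (CARD('n) - 1) * (H (chart_lift i w) *
      ennreal ((cmod (chart_lift i w $ i) / norm (chart_lift i w))\<^sup>2 * fs_density i w)) \<partial>Pi\<^sub>M (- {i}) (\<lambda>_. lborel))"
      unfolding nn_integral_lborel_chart[OF mK, of i i] inner ..
  qed
  also have "\<dots> = (\<Sum>i\<in>UNIV. fiber_constant (CARD('n) - 1) * (\<integral>\<^sup>+w. H (chart_lift i w) *
      ennreal ((cmod (chart_lift i w $ i) / norm (chart_lift i w))\<^sup>2 * fs_density i w) \<partial>Pi\<^sub>M (- {i}) (\<lambda>_. lborel)))"
    by (intro sum.cong refl nn_integral_cmult mchart)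
  finally show ?thesis
    by (simp only: F_def sum_distrib_left)
qed


section \<open>Cones and their shells\<close>

lemma linear_smult_i: "linear ((*s) \<i> :: complex^'n \<Rightarrow> complex^'n)"
  using bounded_linear_smult_right[of \<i>] by (rule bounded_linear.linear)

text \<open>
  The pullbacks along \<open>proj\<close> of the local equations of \<open>X\<close> are equations of the cone, and both
  holomorphy and the rank condition are phrased in terms of these pullbacks.
\<close>

lemma submanifold_cone_contact:
  fixes X :: "'n::finite cproj set"
  assumes X: "complex_submanifold k X" and x: "x \<noteq> 0" "proj x \<in> X"
  shows "complex_quadratic_contact ((*s) \<i>) (2 * (CARD('n) - (k + 1))) (affine_cone X) x"
proof -
  from X[unfolded complex_submanifold_def] obtain m where mloc: "k + m + 1 = CARD('n) \<and> (\<forall>p\<in>X. \<exists>U f. open U \<and> p \<in> U \<and>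
          (\<forall>j<m. holomorphic_cproj (f j) U) \<and>
          X \<inter> U = {q \<in> U. \<forall>j<m. f j q = 0} \<and>
          (\<forall>z. z \<noteq> 0 \<and> proj z \<in> X \<inter> U \<longrightarrow>
             (\<forall>a :: nat \<Rightarrow> complex.
                (\<forall>v. (\<Sum>j<m. a j * frechet_derivative (\<lambda>y. f j (proj y)) (at z) v) = 0) \<longrightarrow>
                (\<forall>j<m. a j = 0))))"
    by (elim exE)
  note m = conjunct1[OF mloc] and loc = conjunct2[OF mloc]
  from bspec[OF loc x(2)] obtain U f where Uf: "open U \<and> proj x \<in> U \<and>
          (\<forall>j<m. holomorphic_cproj (f j) U) \<and>
          X \<inter> U = {q \<in> U. \<forall>j<m. f j q = 0} \<and>
          (\<forall>z. z \<noteq> 0 \<and> proj z \<in> X \<inter> U \<longrightarrow>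
             (\<forall>a :: nat \<Rightarrow> complex.
                (\<forall>v. (\<Sum>j<m. a j * frechet_derivative (\<lambda>y. f j (proj y)) (at z) v) = 0) \<longrightarrow>
                (\<forall>j<m. a j = 0)))"
    by (elim exE)
  note U = conjunct1[OF Uf] conjunct1[OF conjunct2[OF Uf]]
    and hol = conjunct1[OF conjunct2[OF conjunct2[OF Uf]]]
    and XU = conjunct1[OF conjunct2[OF conjunct2[OF conjunct2[OF Uf]]]]
    and ind = conjunct2[OF conjunct2[OF conjunct2[OF conjunct2[OF Uf]]]]
  have "open {z :: complex^'n. z \<noteq> 0 \<and> proj z \<in> U}" using U(1) by (simp add: open_cproj_def)
  then obtain r where r: "r > 0" and sub: "ball x r \<subseteq> {z. z \<noteq> 0 \<and> proj z \<in> U}"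
    using x U(2) unfolding open_contains_ball by blast
  define F where "F j z = f j (proj z)" for j z
  have der: "\<exists>D. (F j has_derivative D) (at y) \<and> (\<forall>c v. D (c *s v) = c * D v)" if j: "j < m" and y: "y \<in> ball x r" for j y
  proof -
    have "y \<noteq> 0 \<and> proj y \<in> U" using sub y by blast
    with hol j obtain D where D: "(F j has_derivative D) (at y)" and lin: "Vector_Spaces.linear (*s) (*) D"
      unfolding holomorphic_cproj_def F_def by blast
    have "D (c *s v) = c * D v" for c v
      using lin unfolding Vector_Spaces.linear_iff_module_hom by (rule module_hom.scale)
    then show ?thesis using D by blast
  qed
  define D where "D j = frechet_derivative (F j) (at x)" for j
  have D: "(F j has_derivative D j) (at x)" and Dlin: "D j (c *s v) = c * D j v" if "j < m" for j c v
  proof -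
    have "x \<in> ball x r" using r by simp
    from der[OF that this] obtain D' where D': "(F j has_derivative D') (at x)" "\<forall>c v. D' (c *s v) = c * D' v" by blast
    have "D j = D'" unfolding D_def using frechet_derivative_at[OF D'(1)] by simp
    then show "(F j has_derivative D j) (at x)" "D j (c *s v) = c * D j v" using D' by auto
  qed
  have "complex_quadratic_contact ((*s) \<i>) (2 * m) (affine_cone X) x"
  proof (rule zero_set_quadratic_contact[OF r _ _ D Dlin])
    show "complex_differentiable_on (F j) (ball x r)" if "j < m" for j
      unfolding complex_differentiable_on_def using der[OF that] by blast
    show "F j x = 0" if "j < m" for j
      using XU x(2) U(2) that unfolding F_def by blast
    show "\<forall>j<m. a j = 0" if "\<And>v. (\<Sum>j<m. a j * D j v) = 0" for a
      using ind[rule_format, of x a] x U(2) that unfolding D_def F_def[abs_def] by blast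
    show "y \<in> affine_cone X \<longleftrightarrow> (\<forall>j<m. F j y = 0)" if "y \<in> ball x r" for y
    proof -
      have y: "y \<noteq> 0" "proj y \<in> U" using subsetD[OF sub that] by blast+
      have "y \<in> affine_cone X \<longleftrightarrow> proj y \<in> X \<inter> U" using y by (simp add: mem_affine_cone)
      also have "\<dots> \<longleftrightarrow> (\<forall>j<m. F j y = 0)" unfolding XU F_def using y by simp
      finally show ?thesis .
    qed
  qed
  moreover have "m = CARD('n) - (k + 1)" using m by simp
  ultimately show ?thesis by simp
qed

text \<open>
  A point \<open>z\<close> splits into a nearest point \<open>x\<close> of \<open>C\<close> and an orthogonal vector \<open>z - x\<close> of norm \<open>infdist z C\<close>.
  By Pythagoras \<open>norm x\<close> depends on \<open>z\<close> only, even where \<open>x\<close> does not; it is called \<open>radial z\<close>.  The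
  quotient \<open>infdist z C / radial z\<close> is the tangent of the angle between \<open>z\<close> and \<open>C\<close>, and a shell collects the
  points outside \<open>C\<close> with radial part at most 1 by the logarithm of this slope.
\<close>

locale complex_cone =
  fixes C :: "(complex^'n::finite) set"
  assumes closed_C: "closed C" and zero_C: "0 \<in> C" and smult_C: "z \<in> C \<Longrightarrow> c *s z \<in> C"
begin

definition radial :: "complex^'n \<Rightarrow> real" where
  "radial z = sqrt ((norm z)\<^sup>2 - (infdist z C)\<^sup>2)"

definition shell :: "real set \<Rightarrow> (complex^'n) set" where
  "shell A = {z. 0 < radial z \<and> radial z \<le> 1 \<and> 0 < infdist z C \<and> ln (infdist z C / radial z) \<in> A}"

lemma infdist_le_norm: "infdist z C \<le> norm z"
  using infdist_le[OF zero_C, of z] by (simp add: dist_norm)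

lemma infdist_sq_le: "(infdist z C)\<^sup>2 \<le> (norm z)\<^sup>2"
  by (rule power_mono[OF infdist_le_norm infdist_nonneg])

lemma radial_nonneg: "0 \<le> radial z"
  unfolding radial_def by (rule real_sqrt_ge_zero) (use infdist_sq_le[of z] in linarith)

lemma radial_sq: "(radial z)\<^sup>2 = (norm z)\<^sup>2 - (infdist z C)\<^sup>2"
  unfolding radial_def by (rule real_sqrt_pow2) (use infdist_sq_le[of z] in linarith)

lemma nearest_exists: obtains x where "x \<in> C" "norm (z - x) = infdist z C"
proof -
  have "C \<noteq> {}" using zero_C by blast
  from infdist_attains_inf[OF closed_C this, of z] obtain x where "x \<in> C" "infdist z C = dist z x" .
  then show ?thesis using that[of x] unfolding dist_norm by simp
qed

lemma infdist_le_diff: "y \<in> C \<Longrightarrow> infdist z C \<le> norm (z - y)"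
  using infdist_le[of y C z] by (simp add: dist_norm)

lemma nearest_orthogonal:
  assumes x: "x \<in> C" and near: "norm (z - x) = infdist z C"
  shows "(z - x) \<bullet> x = 0"
proof (rule zero_of_quadratic_bound)
  fix t :: real
  have "(1 + t) *\<^sub>R x \<in> C" unfolding scaleR_eq_smult by (rule smult_C[OF x])
  then have "norm (z - x) \<le> norm (z - (1 + t) *\<^sub>R x)" using infdist_le_diff near by simp
  then have "(norm (z - x))\<^sup>2 \<le> (norm ((z - x) - t *\<^sub>R x))\<^sup>2"
    by (intro power_mono) (auto simp: algebra_simps)
  then show "2 * t * ((z - x) \<bullet> x) \<le> t\<^sup>2 * (x \<bullet> x)"
    unfolding power2_norm_eq_inner[of "z - x"] power2_norm_eq_inner[of "(z - x) - t *\<^sub>R x"]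
    by (simp only: inner_diff_left[of "z - x"] inner_diff_right[of _ "z - x"] inner_scaleR_left inner_scaleR_right
        inner_commute[of x "z - x"]) (simp add: power2_eq_square algebra_simps)
qed

lemma radial_eq_norm_nearest:
  assumes x: "x \<in> C" and near: "norm (z - x) = infdist z C"
  shows "radial z = norm x"
proof -
  have "(norm ((z - x) + x))\<^sup>2 = (norm (z - x))\<^sup>2 + (norm x)\<^sup>2"
    using nearest_orthogonal[OF assms] by (intro norm_add_Pythagorean) (simp add: orthogonal_def)
  then have "(radial z)\<^sup>2 = (norm x)\<^sup>2" by (simp add: radial_sq near)
  then show ?thesis using radial_nonneg by (simp add: power2_eq_iff_nonneg)
qed

lemma infdist_smult: "infdist (\<zeta> *s z) C = cmod \<zeta> * infdist z C"
proof -
  have le: "infdist (c *s z) C \<le> cmod c * infdist z C" for c z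
  proof -
    obtain x where x: "x \<in> C" "norm (z - x) = infdist z C" by (rule nearest_exists)
    have "infdist (c *s z) C \<le> norm (c *s z - c *s x)" by (rule infdist_le_diff[OF smult_C[OF x(1)]])
    also have "c *s z - c *s x = c *s (z - x)" by (simp add: vector_ssub_ldistrib)
    finally show ?thesis unfolding norm_vec_smult x(2) .
  qed
  show ?thesis
  proof (cases "\<zeta> = 0")
    case True
    then show ?thesis using zero_C by simp
  next
    case False
    have "infdist (inverse \<zeta> *s (\<zeta> *s z)) C \<le> cmod (inverse \<zeta>) * infdist (\<zeta> *s z) C" by (rule le)
    then have "infdist z C \<le> infdist (\<zeta> *s z) C / cmod \<zeta>"
      using False by (simp add: vector_smult_assoc norm_inverse divide_inverse mult.commute)
    then show ?thesis using le[of \<zeta> z] False by (simp add: pos_le_divide_eq mult.commute antisym)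
  qed
qed

lemma radial_smult: "radial (\<zeta> *s z) = cmod \<zeta> * radial z"
proof -
  have "(norm (\<zeta> *s z))\<^sup>2 - (infdist (\<zeta> *s z) C)\<^sup>2 = (cmod \<zeta>)\<^sup>2 * ((norm z)\<^sup>2 - (infdist z C)\<^sup>2)"
    unfolding norm_vec_smult infdist_smult power_mult_distrib right_diff_distrib ..
  then show ?thesis unfolding radial_def by (simp only: real_sqrt_mult real_sqrt_abs abs_norm_cancel)
qed

lemma measurable_infdist[measurable]: "(\<lambda>z. infdist z C) \<in> borel_measurable borel"
  by (rule borel_measurable_continuous_onI[OF continuous_on_infdist[OF continuous_on_id]])

lemma measurable_radial[measurable]: "radial \<in> borel_measurable borel"
proof -
  have "continuous_on UNIV (\<lambda>z::complex^'n. sqrt ((norm z)\<^sup>2 - (infdist z C)\<^sup>2))"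
    by (rule continuous_on_real_sqrt[OF continuous_on_diff[OF continuous_on_power[OF continuous_on_norm[OF continuous_on_id]]
        continuous_on_power[OF continuous_on_infdist[OF continuous_on_id]]]])
  moreover have "radial = (\<lambda>z. sqrt ((norm z)\<^sup>2 - (infdist z C)\<^sup>2))"
    by (rule ext) (rule radial_def)
  ultimately show ?thesis
    by (simp only: borel_measurable_continuous_onI)
qed

lemma measurable_shell[measurable]:
  assumes [measurable]: "A \<in> sets borel"
  shows "shell A \<in> sets borel"
proof -
  have "{z \<in> space borel. 0 < radial z \<and> radial z \<le> 1 \<and> 0 < infdist z C \<and> ln (infdist z C / radial z) \<in> A} \<in> sets borel"
    by measurable
  then show ?thesis by (simp add: shell_def)
qed

text \<open>
  If the origin is a nearest point of \<open>z\<close>, then \<open>z\<close> is orthogonal to every line of \<open>C\<close>.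
\<close>

lemma radial_zero_negligible:
  assumes "C \<noteq> {0}"
  shows "{z. radial z = 0} \<in> null_sets lborel"
proof -
  obtain x where x: "x \<in> C" "x \<noteq> 0" using assms zero_C by blast
  have "{z. radial z = 0} \<subseteq> {z. x \<bullet> z = 0}"
  proof safe
    fix z assume "radial z = 0"
    then have "(infdist z C)\<^sup>2 = (norm z)\<^sup>2" using radial_sq[of z] by simp
    then have d: "infdist z C = norm z" by (simp add: power2_eq_iff_nonneg infdist_nonneg)
    have "z \<bullet> x = 0"
    proof (rule zero_of_quadratic_bound)
      fix t :: real
      have "norm z \<le> norm (z - t *\<^sub>R x)"
        using infdist_le_diff[of "t *\<^sub>R x" z] smult_C[OF x(1)] by (simp add: scaleR_eq_smult d)
      then have "(norm z)\<^sup>2 \<le> (norm (z - t *\<^sub>R x))\<^sup>2" by (simp add: power_mono)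
      then show "2 * t * (z \<bullet> x) \<le> t\<^sup>2 * (x \<bullet> x)"
        unfolding power2_norm_eq_inner
        by (simp add: inner_diff_left inner_diff_right inner_commute power2_eq_square algebra_simps)
    qed
    then show "x \<bullet> z = 0" by (simp add: inner_commute)
  qed
  moreover have "negligible {z. x \<bullet> z = 0}" using x by (intro negligible_hyperplane) auto
  ultimately have "negligible {z. radial z = 0}" by (rule negligible_subset[rotated])
  moreover have "{z. radial z = 0} \<in> sets borel"
  proof -
    have "{z \<in> space borel. radial z = 0} \<in> sets borel" by measurable
    then show ?thesis by simp
  qed
  ultimately show ?thesis
    by (simp add: negligible_iff_null_sets null_sets_def)
qed

lemma emeasure_le_by_compact:
  fixes S :: "(complex^'n) set"
  assumes S: "S \<in> sets borel" and K: "\<And>K. compact K \<Longrightarrow> K \<subseteq> S \<Longrightarrow> emeasure lborel K \<le> b"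
  shows "emeasure lborel S \<le> b"
proof (rule ennreal_le_epsilon)
  fix e :: real assume e: "0 < e"
  have "S \<in> sets lebesgue" using S by auto
  obtain T where T: "closed T" "T \<subseteq> S" "emeasure lebesgue (S - T) < ennreal e"
    using sets_lebesgue_inner_closed[OF \<open>S \<in> sets lebesgue\<close> e] by metis
  have Tm: "T \<in> sets borel" using T(1) by (rule borel_closed)
  have "emeasure lborel S \<le> emeasure lborel T + emeasure lborel (S - T)"
  proof -
    have "S = T \<union> (S - T)" using T(2) by auto
    moreover have "S - T \<in> sets borel" using Tm S by blast
    ultimately show ?thesis using emeasure_subadditive[of T lborel "S - T"] Tm by simp
  qed
  also have "emeasure lborel (S - T) \<le> ennreal e" using T(3) S Tm by (simp add: less_imp_le)
  also have "emeasure lborel T \<le> b"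
  proof -
    have U: "(\<Union>n::nat. T \<inter> cball 0 (real n)) = T"
    proof safe
      fix x assume "x \<in> T"
      obtain n :: nat where "norm x \<le> real n" using real_arch_simple by blast
      then show "x \<in> (\<Union>n. T \<inter> cball 0 (real n))" using \<open>x \<in> T\<close> by auto
    qed
    have "(SUP n. emeasure lborel (T \<inter> cball 0 (real n))) = emeasure lborel (\<Union>n::nat. T \<inter> cball 0 (real n))"
    proof (rule SUP_emeasure_incseq)
      show "range (\<lambda>n. T \<inter> cball 0 (real n)) \<subseteq> sets lborel" using Tm by auto
      show "incseq (\<lambda>n. T \<inter> cball 0 (real n))" unfolding incseq_def by (auto intro: order_trans)
    qed
    also have "\<dots> = emeasure lborel T" by (simp only: U)
    finally have "emeasure lborel T = (SUP n. emeasure lborel (T \<inter> cball 0 (real n)))" ..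
    also have "\<dots> \<le> b"
      using T by (intro SUP_least K) auto
    finally show ?thesis .
  qed
  finally show "emeasure lborel S \<le> b + ennreal e" by (simp add: add_right_mono)
qed

text \<open>
  Shrinking the normal vectors by \<open>l\<close> keeps the nearest point and thus the radial part, and shifts the
  logarithm of the slope by \<open>ln l\<close>.  The volume estimate for this contraction applies to compact subsets,
  which exhaust the measure of the shell.
\<close>

theorem shell_contraction:
  assumes contact: "\<And>x. x \<in> C \<Longrightarrow> x \<noteq> 0 \<Longrightarrow> complex_quadratic_contact ((*s) \<i>) d C x"
    and l: "0 < l" "l < 1" and A: "A \<in> sets borel"
  shows "emeasure lborel (shell A) \<le> ennreal ((1 / l) ^ d) * emeasure lborel (shell ((\<lambda>a. a + ln l) ` A))"
proof (rule emeasure_le_by_compact)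
  show "shell A \<in> sets borel" using A by (rule measurable_shell)
  fix K assume K: "compact K" "K \<subseteq> shell A"
  \<comment> \<open>All decompositions z = x + v of points z of K with x a nearest point of z in C.\<close>
  define Z where "Z = {p. fst p \<in> C \<and> fst p + snd p \<in> K \<and> norm (snd p) \<le> infdist (fst p + snd p) C}"
  have "closed Z"
  proof -
    have "Z = fst -` C \<inter> ((\<lambda>p. fst p + snd p) -` K \<inter> {p. norm (snd p) \<le> infdist (fst p + snd p) C})"
      by (auto simp: Z_def)
    moreover have "closed \<dots>"
      using closed_C compact_imp_closed[OF K(1)]
      by (intro closed_Int closed_vimage closed_Collect_le continuous_intros)
    ultimately show ?thesis by simp
  qed
  moreover have "bounded Z"
  proof -
    obtain R where R: "\<forall>z\<in>K. norm z \<le> R"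
      using compact_imp_bounded[OF K(1)] unfolding bounded_iff by (elim exE)
    have "norm p \<le> 3 * R" if p: "p \<in> Z" for p
    proof -
      have 1: "norm (fst p + snd p) \<le> R" using p R by (simp add: Z_def)
      have "norm (snd p) \<le> infdist (fst p + snd p) C" using p by (simp add: Z_def)
      then have 2: "norm (snd p) \<le> R" using 1 infdist_le_norm[of "fst p + snd p"] by linarith
      have "norm (fst p + snd p - snd p) \<le> R + R"
        using norm_triangle_ineq4[of "fst p + snd p" "snd p"] 1 2 by linarith
      then have 3: "norm (fst p) \<le> 2 * R" by simp
      have "norm p \<le> norm (fst p) + norm (snd p)"
        using norm_Pair_le[of "fst p" "snd p"] by simp
      then show ?thesis using 2 3 by simp
    qed
    then show ?thesis unfolding bounded_iff by blast
  qed
  ultimately have Z: "compact Z" by (simp add: compact_eq_bounded_closed)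
  have ZD: "x \<in> C" "x + v \<in> K" "norm v = infdist (x + v) C" if "(x, v) \<in> Z" for x v
  proof -
    show "x \<in> C" "x + v \<in> K" using that by (auto simp: Z_def)
    have "infdist (x + v) C \<le> norm (x + v - x)" using \<open>x \<in> C\<close> by (rule infdist_le_diff)
    then show "norm v = infdist (x + v) C" using that by (simp add: Z_def)
  qed
  have near: "norm v \<le> norm (x + v - y)" if "(x, v) \<in> Z" "y \<in> C" for x v y
    using ZD(3)[OF that(1)] infdist_le_diff[OF that(2), of "x + v"] by simp
  have sh: "0 < norm x \<and> norm x \<le> 1 \<and> 0 < norm v \<and> ln (norm v / norm x) \<in> A" if "(x, v) \<in> Z" for x v
  proof -
    have "radial (x + v) = norm x"
      using ZD(1,3)[OF that] by (intro radial_eq_norm_nearest) auto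
    moreover have "x + v \<in> shell A" using ZD(2)[OF that] K(2) by blast
    ultimately show ?thesis using ZD(3)[OF that] by (simp add: shell_def)
  qed
  have "K = (\<lambda>(x, v). x + v) ` Z"
  proof safe
    fix z assume z: "z \<in> K"
    obtain x where x: "x \<in> C" "norm (z - x) = infdist z C" by (rule nearest_exists)
    then have "(x, z - x) \<in> Z" using z by (simp add: Z_def)
    then show "z \<in> (\<lambda>(x, v). x + v) ` Z" by (intro image_eqI[of _ _ "(x, z - x)"]) auto
  qed (auto simp: Z_def)
  moreover have "emeasure lborel ((\<lambda>(x, v). x + v) ` Z) \<le> ennreal ((1 / l) ^ d) * emeasure lborel ((\<lambda>(x, v). x + l *\<^sub>R v) ` Z)"
  \<comment> \<open>The index type has to have 2 CARD('n) elements and be well-ordered.\<close>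
  proof (rule contraction_volume_bound[where J = "(*s) \<i>" and C = C and 'm = "'n bit0"])
    show "DIM(complex^'n) = CARD('n bit0)" by simp
    show "linear ((*s) \<i> :: complex^'n \<Rightarrow> complex^'n)" by (rule linear_smult_i)
    show "norm (\<i> *s x) = norm x" for x :: "complex^'n" by (simp add: norm_vec_smult)
    show "complex_quadratic_contact ((*s) \<i>) d C x" if "(x, v) \<in> Z" for x v
      using ZD(1)[OF that] sh[OF that] by (intro contact) auto
  qed (use l Z ZD near in auto)
  moreover have "(\<lambda>(x, v). x + l *\<^sub>R v) ` Z \<subseteq> shell ((\<lambda>a. a + ln l) ` A)"
  proof safe
    fix x v assume xv: "(x, v) \<in> Z"
    have near_l: "norm (l *\<^sub>R v) \<le> norm (x + l *\<^sub>R v - y)" if "y \<in> C" for y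
    proof (rule power2_le_imp_le)
      have "0 \<le> (1 - l) * (norm (y - x))\<^sup>2" using l by simp
      moreover have "l\<^sup>2 * (norm v)\<^sup>2 + (1 - l) * (norm (y - x))\<^sup>2 \<le> (norm (x + l *\<^sub>R v - y))\<^sup>2"
        using l by (intro nearest_point_stability[OF near[OF xv] that]) auto
      moreover have "(norm (l *\<^sub>R v))\<^sup>2 = l\<^sup>2 * (norm v)\<^sup>2" by (simp add: power_mult_distrib)
      ultimately show "(norm (l *\<^sub>R v))\<^sup>2 \<le> (norm (x + l *\<^sub>R v - y))\<^sup>2"
        by linarith
    qed simp
    obtain y where y: "y \<in> C" "norm (x + l *\<^sub>R v - y) = infdist (x + l *\<^sub>R v) C" by (rule nearest_exists)
    have d: "norm (x + l *\<^sub>R v - x) = infdist (x + l *\<^sub>R v) C"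
      using near_l[OF y(1)] y(2) infdist_le_diff[OF ZD(1)[OF xv], of "x + l *\<^sub>R v"] by simp
    then have "radial (x + l *\<^sub>R v) = norm x" by (rule radial_eq_norm_nearest[OF ZD(1)[OF xv]])
    moreover have "infdist (x + l *\<^sub>R v) C = l * norm v" using d l by simp
    moreover have "ln (l * norm v / norm x) = ln (norm v / norm x) + ln l"
      using sh[OF xv] l by (simp add: ln_div ln_mult)
    ultimately show "x + l *\<^sub>R v \<in> shell ((\<lambda>a. a + ln l) ` A)"
      using sh[OF xv] l by (auto simp: shell_def)
  qed
  moreover have "shell ((\<lambda>a. a + ln l) ` A) \<in> sets borel"
  proof (rule measurable_shell)
    have "(\<lambda>a. a + ln l) ` A = (\<lambda>a. a - ln l) -` A \<inter> space borel" by (auto simp: image_iff) (metis diff_add_cancel)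
    also have "\<dots> \<in> sets borel" using A by measurable
    finally show "(\<lambda>a. a + ln l) ` A \<in> sets borel" .
  qed
  ultimately show "emeasure lborel K \<le> ennreal ((1 / l) ^ d) * emeasure lborel (shell ((\<lambda>a. a + ln l) ` A))"
    by (simp only:) (erule order_trans, intro mult_left_mono emeasure_mono, simp_all)
qed

end


section \<open>Distributions that grow or decay under shifts\<close>

lemma nn_integral_translate:
  fixes g :: "real \<Rightarrow> ennreal"
  assumes [measurable]: "g \<in> borel_measurable borel"
  shows "(\<integral>\<^sup>+y. g y \<partial>lborel) = (\<integral>\<^sup>+u. g (t + u) \<partial>lborel)"
proof -
  have "(\<integral>\<^sup>+y. g y \<partial>lborel) = (\<integral>\<^sup>+y. g y \<partial>distr lborel borel (\<lambda>x. t + x))"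
    by (simp add: lborel_distr_plus)
  also have "\<dots> = (\<integral>\<^sup>+u. g (t + u) \<partial>lborel)" by (simp add: nn_integral_distr)
  finally show ?thesis .
qed

lemma nn_integral_reflect_translate:
  fixes g :: "real \<Rightarrow> ennreal"
  assumes [measurable]: "g \<in> borel_measurable borel"
  shows "(\<integral>\<^sup>+y. g y \<partial>lborel) = (\<integral>\<^sup>+u. g (t - u) \<partial>lborel)"
proof -
  have "(\<integral>\<^sup>+u. g (t - u) \<partial>lborel) = (\<integral>\<^sup>+u. g (t + u) \<partial>distr lborel borel uminus)"
    by (simp add: nn_integral_distr)
  also have "\<dots> = (\<integral>\<^sup>+u. g (t + u) \<partial>lborel)" by (simp add: lborel_distr_uminus)
  finally show ?thesis using nn_integral_translate[of g t] by simp
qed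

text \<open>
  The hypothesis compares two distributions on the real line as measures.
\<close>

lemma nn_integral_mono_of_emeasure:
  fixes e :: "'a::euclidean_space \<Rightarrow> ennreal" and \<theta>1 \<theta>2 :: "'a \<Rightarrow> real"
  assumes [measurable]: "e \<in> borel_measurable borel" "\<theta>1 \<in> borel_measurable borel" "\<theta>2 \<in> borel_measurable borel"
    "F \<in> borel_measurable borel"
    and le: "\<And>A. A \<in> sets borel \<Longrightarrow> (\<integral>\<^sup>+z. e z * indicator A (\<theta>1 z) \<partial>lborel) \<le> c * (\<integral>\<^sup>+z. e z * indicator A (\<theta>2 z) \<partial>lborel)"
  shows "(\<integral>\<^sup>+z. e z * F (\<theta>1 z) \<partial>lborel) \<le> c * (\<integral>\<^sup>+z. e z * F (\<theta>2 z) \<partial>lborel)"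
proof -
  define M1 where "M1 = distr (density lborel e) borel \<theta>1"
  define M2 where "M2 = distr (density lborel (\<lambda>z. c * e z)) borel \<theta>2"
  have em: "emeasure M1 A \<le> emeasure M2 A" for A
  proof (cases "A \<in> sets borel")
    case True
    then have [measurable]: "A \<in> sets borel" .
    have "emeasure M1 A = (\<integral>\<^sup>+z. e z * indicator A (\<theta>1 z) \<partial>lborel)"
      unfolding M1_def by (simp add: emeasure_distr emeasure_density indicator_def[abs_def] vimage_def cong: if_cong)
    moreover have "emeasure M2 A = (\<integral>\<^sup>+z. c * (e z * indicator A (\<theta>2 z)) \<partial>lborel)"
      unfolding M2_def by (simp add: emeasure_distr emeasure_density indicator_def[abs_def] vimage_def mult.assoc cong: if_cong)
    ultimately show ?thesis using le[OF True] by (simp add: nn_integral_cmult)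
  next
    case False
    then show ?thesis by (simp add: M1_def M2_def emeasure_notin_sets)
  qed
  then have "M1 \<le> M2" by (subst le_measure) (auto simp: M1_def M2_def le_fun_def)
  then have "integral\<^sup>N M1 F \<le> integral\<^sup>N M2 F"
    by (intro nn_integral_mono_measure) (auto simp: M1_def M2_def)
  moreover have "integral\<^sup>N M1 F = (\<integral>\<^sup>+z. e z * F (\<theta>1 z) \<partial>lborel)"
    by (simp add: M1_def nn_integral_distr nn_integral_density)
  moreover have "integral\<^sup>N M2 F = (\<integral>\<^sup>+z. c * (e z * F (\<theta>2 z)) \<partial>lborel)"
    by (simp add: M2_def nn_integral_distr nn_integral_density mult.assoc)
  ultimately show ?thesis by (simp add: nn_integral_cmult)
qed

context
  fixes e :: "'a::euclidean_space \<Rightarrow> ennreal" and \<theta> :: "'a \<Rightarrow> real" and f g :: "real \<Rightarrow> ennreal" and \<kappa> :: real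
  assumes me: "e \<in> borel_measurable borel" and m\<theta>: "\<theta> \<in> borel_measurable borel"
    and mf: "f \<in> borel_measurable borel" and mg: "g \<in> borel_measurable borel"
begin

text \<open>
  The product is a double integral over \<open>z\<close> and \<open>y\<close>, taken in the variable \<open>u = y - \<theta> z\<close>.
\<close>

lemma product_as_shift_integral_right:
  "(\<integral>\<^sup>+z. e z * f (\<theta> z) \<partial>lborel) * (\<integral>\<^sup>+y. g y * ennreal (exp (\<kappa> * y)) \<partial>lborel) =
   (\<integral>\<^sup>+u. ennreal (exp (\<kappa> * u)) * (\<integral>\<^sup>+z. e z * (f (\<theta> z) * g (\<theta> z + u) * ennreal (exp (\<kappa> * \<theta> z))) \<partial>lborel) \<partial>lborel)"
proof -
  note [measurable] = me m\<theta> mf mg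
  have "(\<integral>\<^sup>+z. e z * f (\<theta> z) \<partial>lborel) * (\<integral>\<^sup>+y. g y * ennreal (exp (\<kappa> * y)) \<partial>lborel) =
      (\<integral>\<^sup>+z. e z * f (\<theta> z) * (\<integral>\<^sup>+y. g y * ennreal (exp (\<kappa> * y)) \<partial>lborel) \<partial>lborel)"
    by (rule nn_integral_multc[symmetric]) measurable
  also have "\<dots> = (\<integral>\<^sup>+z. \<integral>\<^sup>+u. ennreal (exp (\<kappa> * u)) * (e z * (f (\<theta> z) * g (\<theta> z + u) * ennreal (exp (\<kappa> * \<theta> z)))) \<partial>lborel \<partial>lborel)"
  proof (rule nn_integral_cong)
    fix z
    have "(\<integral>\<^sup>+y. g y * ennreal (exp (\<kappa> * y)) \<partial>lborel) = (\<integral>\<^sup>+u. g (\<theta> z + u) * ennreal (exp (\<kappa> * (\<theta> z + u))) \<partial>lborel)"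
      by (rule nn_integral_translate) measurable
    then have "e z * f (\<theta> z) * (\<integral>\<^sup>+y. g y * ennreal (exp (\<kappa> * y)) \<partial>lborel) =
        (\<integral>\<^sup>+u. e z * f (\<theta> z) * (g (\<theta> z + u) * ennreal (exp (\<kappa> * (\<theta> z + u)))) \<partial>lborel)"
      by (simp add: nn_integral_cmult)
    also have "\<dots> = (\<integral>\<^sup>+u. ennreal (exp (\<kappa> * u)) * (e z * (f (\<theta> z) * g (\<theta> z + u) * ennreal (exp (\<kappa> * \<theta> z)))) \<partial>lborel)"
    proof (rule nn_integral_cong)
      fix u
      have "ennreal (exp (\<kappa> * (\<theta> z + u))) = ennreal (exp (\<kappa> * \<theta> z)) * ennreal (exp (\<kappa> * u))"
        by (simp add: ennreal_mult[symmetric] exp_add[symmetric] distrib_left)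
      then show "e z * f (\<theta> z) * (g (\<theta> z + u) * ennreal (exp (\<kappa> * (\<theta> z + u)))) =
          ennreal (exp (\<kappa> * u)) * (e z * (f (\<theta> z) * g (\<theta> z + u) * ennreal (exp (\<kappa> * \<theta> z))))"
        by (simp only: mult_ac)
    qed
    finally show "e z * f (\<theta> z) * (\<integral>\<^sup>+y. g y * ennreal (exp (\<kappa> * y)) \<partial>lborel) =
      (\<integral>\<^sup>+u. ennreal (exp (\<kappa> * u)) * (e z * (f (\<theta> z) * g (\<theta> z + u) * ennreal (exp (\<kappa> * \<theta> z)))) \<partial>lborel)" .
  qed
  also have "\<dots> = (\<integral>\<^sup>+u. \<integral>\<^sup>+z. ennreal (exp (\<kappa> * u)) * (e z * (f (\<theta> z) * g (\<theta> z + u) * ennreal (exp (\<kappa> * \<theta> z)))) \<partial>lborel \<partial>lborel)"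
    by (rule lborel_pair.Fubini'[symmetric]) measurable
  also have "\<dots> = (\<integral>\<^sup>+u. ennreal (exp (\<kappa> * u)) * (\<integral>\<^sup>+z. e z * (f (\<theta> z) * g (\<theta> z + u) * ennreal (exp (\<kappa> * \<theta> z))) \<partial>lborel) \<partial>lborel)"
    by (intro nn_integral_cong nn_integral_cmult) measurable
  finally show ?thesis .
qed

text \<open>
  The same double integral with the roles of \<open>f\<close> and \<open>g\<close> exchanged and \<open>u = \<theta> z - y\<close>; for each \<open>u\<close> its
  integrand is that of the preceding lemma with \<open>\<theta> z\<close> replaced by \<open>\<theta> z - u\<close>.
\<close>

lemma product_as_shift_integral_left:
  "(\<integral>\<^sup>+z. e z * g (\<theta> z) \<partial>lborel) * (\<integral>\<^sup>+y. f y * ennreal (exp (\<kappa> * y)) \<partial>lborel) =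
   (\<integral>\<^sup>+u. (\<integral>\<^sup>+z. e z * (f (\<theta> z - u) * g (\<theta> z - u + u) * ennreal (exp (\<kappa> * (\<theta> z - u)))) \<partial>lborel) \<partial>lborel)"
proof -
  note [measurable] = me m\<theta> mf mg
  have "(\<integral>\<^sup>+z. e z * g (\<theta> z) \<partial>lborel) * (\<integral>\<^sup>+y. f y * ennreal (exp (\<kappa> * y)) \<partial>lborel) =
      (\<integral>\<^sup>+z. e z * g (\<theta> z) * (\<integral>\<^sup>+y. f y * ennreal (exp (\<kappa> * y)) \<partial>lborel) \<partial>lborel)"
    by (rule nn_integral_multc[symmetric]) measurable
  also have "\<dots> = (\<integral>\<^sup>+z. \<integral>\<^sup>+u. e z * (f (\<theta> z - u) * g (\<theta> z - u + u) * ennreal (exp (\<kappa> * (\<theta> z - u)))) \<partial>lborel \<partial>lborel)"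
  proof (rule nn_integral_cong)
    fix z
    have "(\<integral>\<^sup>+y. f y * ennreal (exp (\<kappa> * y)) \<partial>lborel) = (\<integral>\<^sup>+u. f (\<theta> z - u) * ennreal (exp (\<kappa> * (\<theta> z - u))) \<partial>lborel)"
      by (rule nn_integral_reflect_translate) measurable
    then have "e z * g (\<theta> z) * (\<integral>\<^sup>+y. f y * ennreal (exp (\<kappa> * y)) \<partial>lborel) =
        (\<integral>\<^sup>+u. e z * g (\<theta> z) * (f (\<theta> z - u) * ennreal (exp (\<kappa> * (\<theta> z - u)))) \<partial>lborel)"
      by (simp add: nn_integral_cmult)
    also have "\<dots> = (\<integral>\<^sup>+u. e z * (f (\<theta> z - u) * g (\<theta> z - u + u) * ennreal (exp (\<kappa> * (\<theta> z - u)))) \<partial>lborel)"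
      by (intro nn_integral_cong) (simp only: diff_add_cancel mult_ac)
    finally show "e z * g (\<theta> z) * (\<integral>\<^sup>+y. f y * ennreal (exp (\<kappa> * y)) \<partial>lborel) =
      (\<integral>\<^sup>+u. e z * (f (\<theta> z - u) * g (\<theta> z - u + u) * ennreal (exp (\<kappa> * (\<theta> z - u)))) \<partial>lborel)" .
  qed
  also have "\<dots> = (\<integral>\<^sup>+u. (\<integral>\<^sup>+z. e z * (f (\<theta> z - u) * g (\<theta> z - u + u) * ennreal (exp (\<kappa> * (\<theta> z - u)))) \<partial>lborel) \<partial>lborel)"
    by (rule lborel_pair.Fubini'[symmetric]) measurable
  finally show ?thesis .
qed

end

lemma zero_unless_positive_shift:
  fixes f g :: "real \<Rightarrow> ennreal"
  assumes "\<And>x. a < x \<Longrightarrow> f x = 0" "\<And>x. x \<le> a \<Longrightarrow> g x = 0" "u \<le> 0"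
  shows "f x * g (x + u) = 0"
proof (cases "a < x")
  case True
  then show ?thesis by (simp add: assms(1))
next
  case False
  then have "x + u \<le> a" using assms(3) by simp
  then show ?thesis by (simp add: assms(2))
qed

text \<open>
  Suppose that the distribution of \<open>\<theta>\<close> under the density \<open>e\<close> has a density \<open>\<rho>\<close> with respect to
  \<open>exp (\<kappa> * y)\<close> times Lebesgue measure.  The two hypotheses then say that \<open>\<rho>\<close> is decreasing and increasing,
  respectively, and the conclusions compare the averages of \<open>\<rho>\<close> to the left and to the right of \<open>a\<close>.
  Writing the products as integrals over shifts \<open>u\<close> proves the same for arbitrary distributions: the
  hypothesis is applied for each \<open>u\<close> separately.
\<close>

theorem shift_increasing_comparison:
  fixes e :: "'a::euclidean_space \<Rightarrow> ennreal" and \<theta> :: "'a \<Rightarrow> real" and f g :: "real \<Rightarrow> ennreal"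
  assumes me: "e \<in> borel_measurable borel" and m\<theta>: "\<theta> \<in> borel_measurable borel"
    and mf: "f \<in> borel_measurable borel" and mg: "g \<in> borel_measurable borel"
    and supp: "\<And>x. a < x \<Longrightarrow> f x = 0" "\<And>x. x \<le> a \<Longrightarrow> g x = 0"
  shows shift_increasing_le:
      "(\<And>u A. 0 < u \<Longrightarrow> A \<in> sets borel \<Longrightarrow> (\<integral>\<^sup>+z. e z * indicator A (\<theta> z - u) \<partial>lborel)
          \<le> ennreal (exp (\<kappa> * u)) * (\<integral>\<^sup>+z. e z * indicator A (\<theta> z) \<partial>lborel)) \<Longrightarrow>
       (\<integral>\<^sup>+z. e z * g (\<theta> z) \<partial>lborel) * (\<integral>\<^sup>+y. f y * ennreal (exp (\<kappa> * y)) \<partial>lborel)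
       \<le> (\<integral>\<^sup>+z. e z * f (\<theta> z) \<partial>lborel) * (\<integral>\<^sup>+y. g y * ennreal (exp (\<kappa> * y)) \<partial>lborel)"
    and shift_decreasing_le:
      "(\<And>u A. 0 < u \<Longrightarrow> A \<in> sets borel \<Longrightarrow> ennreal (exp (\<kappa> * u)) * (\<integral>\<^sup>+z. e z * indicator A (\<theta> z) \<partial>lborel)
          \<le> (\<integral>\<^sup>+z. e z * indicator A (\<theta> z - u) \<partial>lborel)) \<Longrightarrow>
       (\<integral>\<^sup>+z. e z * f (\<theta> z) \<partial>lborel) * (\<integral>\<^sup>+y. g y * ennreal (exp (\<kappa> * y)) \<partial>lborel)
       \<le> (\<integral>\<^sup>+z. e z * g (\<theta> z) \<partial>lborel) * (\<integral>\<^sup>+y. f y * ennreal (exp (\<kappa> * y)) \<partial>lborel)"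
proof -
  note [measurable] = me m\<theta> mf mg
  \<comment> \<open>Pairs (x, x + u) straddle a only for u > 0, which is where the hypothesis applies.\<close>
  define F where "F u x = f x * g (x + u) * ennreal (exp (\<kappa> * x))" for u x
  have mF: "F u \<in> borel_measurable borel" for u unfolding F_def by measurable
  have F0: "F u x = 0" if "u \<le> 0" for u x
  proof -
    have "f x * g (x + u) = 0"
      by (rule zero_unless_positive_shift[where a = a]) (use supp that in auto)
    then show ?thesis by (simp add: F_def)
  qed
  note R = product_as_shift_integral_right[OF me m\<theta> mf mg, of \<kappa>, folded F_def]
  note L = product_as_shift_integral_left[OF me m\<theta> mf mg, of \<kappa>, folded F_def]
  show "(\<integral>\<^sup>+z. e z * g (\<theta> z) \<partial>lborel) * (\<integral>\<^sup>+y. f y * ennreal (exp (\<kappa> * y)) \<partial>lborel)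
       \<le> (\<integral>\<^sup>+z. e z * f (\<theta> z) \<partial>lborel) * (\<integral>\<^sup>+y. g y * ennreal (exp (\<kappa> * y)) \<partial>lborel)"
    if le: "\<And>u A. 0 < u \<Longrightarrow> A \<in> sets borel \<Longrightarrow> (\<integral>\<^sup>+z. e z * indicator A (\<theta> z - u) \<partial>lborel)
          \<le> ennreal (exp (\<kappa> * u)) * (\<integral>\<^sup>+z. e z * indicator A (\<theta> z) \<partial>lborel)"
    unfolding R L
  proof (rule nn_integral_mono)
    fix u :: real
    show "(\<integral>\<^sup>+z. e z * F u (\<theta> z - u) \<partial>lborel) \<le> ennreal (exp (\<kappa> * u)) * (\<integral>\<^sup>+z. e z * F u (\<theta> z) \<partial>lborel)"
    proof (cases "0 < u")
      case True
      show ?thesis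
      proof (rule nn_integral_mono_of_emeasure[OF me _ m\<theta> mF])
        show "(\<lambda>z. \<theta> z - u) \<in> borel_measurable borel" by measurable
      qed (rule le[OF True])
    qed (simp add: F0)
  qed
  show "(\<integral>\<^sup>+z. e z * f (\<theta> z) \<partial>lborel) * (\<integral>\<^sup>+y. g y * ennreal (exp (\<kappa> * y)) \<partial>lborel)
       \<le> (\<integral>\<^sup>+z. e z * g (\<theta> z) \<partial>lborel) * (\<integral>\<^sup>+y. f y * ennreal (exp (\<kappa> * y)) \<partial>lborel)"
    if le: "\<And>u A. 0 < u \<Longrightarrow> A \<in> sets borel \<Longrightarrow> ennreal (exp (\<kappa> * u)) * (\<integral>\<^sup>+z. e z * indicator A (\<theta> z) \<partial>lborel)
          \<le> (\<integral>\<^sup>+z. e z * indicator A (\<theta> z - u) \<partial>lborel)"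
    unfolding R L
  proof (rule nn_integral_mono)
    fix u :: real
    show "ennreal (exp (\<kappa> * u)) * (\<integral>\<^sup>+z. e z * F u (\<theta> z) \<partial>lborel) \<le> (\<integral>\<^sup>+z. e z * F u (\<theta> z - u) \<partial>lborel)"
    proof (cases "0 < u")
      case True
      have inv: "ennreal (exp (- (\<kappa> * u))) * ennreal (exp (\<kappa> * u)) = 1"
        by (simp add: ennreal_mult[symmetric] exp_add[symmetric])
      have "(\<integral>\<^sup>+z. e z * F u (\<theta> z) \<partial>lborel) \<le> ennreal (exp (- (\<kappa> * u))) * (\<integral>\<^sup>+z. e z * F u (\<theta> z - u) \<partial>lborel)"
      proof (rule nn_integral_mono_of_emeasure[OF me m\<theta> _ mF])
        show "(\<lambda>z. \<theta> z - u) \<in> borel_measurable borel" by measurable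
      next
        fix A :: "real set" assume "A \<in> sets borel"
        from mult_left_mono[OF le[OF True this], of "ennreal (exp (- (\<kappa> * u)))"]
        show "(\<integral>\<^sup>+z. e z * indicator A (\<theta> z) \<partial>lborel) \<le> ennreal (exp (- (\<kappa> * u))) * (\<integral>\<^sup>+z. e z * indicator A (\<theta> z - u) \<partial>lborel)"
          by (simp add: mult.assoc[symmetric] inv)
      qed
      from mult_left_mono[OF this, of "ennreal (exp (\<kappa> * u))"] show ?thesis
        by (simp add: mult.assoc[symmetric] inv mult.commute[of "ennreal (exp (\<kappa> * u))" "ennreal (exp (- (\<kappa> * u)))"])
    qed (simp add: F0)
  qed
qed

lemma weight_integral_finite_positive:
  fixes \<phi> :: "real \<Rightarrow> real"
  assumes \<kappa>: "0 < \<kappa>" and m\<phi>: "\<phi> \<in> borel_measurable borel" and \<phi>: "\<And>x. 0 < \<phi> x" "\<And>x. \<phi> x \<le> 1"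
  shows "0 < (\<integral>\<^sup>+y. (ennreal (\<phi> y) * indicator {..a} y) * ennreal (exp (\<kappa> * y)) \<partial>lborel)"
    and "(\<integral>\<^sup>+y. (ennreal (\<phi> y) * indicator {..a} y) * ennreal (exp (\<kappa> * y)) \<partial>lborel) < \<infinity>"
proof -
  note [measurable] = m\<phi>
  have "(\<integral>\<^sup>+y. (ennreal (\<phi> y) * indicator {..a} y) * ennreal (exp (\<kappa> * y)) \<partial>lborel)
      \<le> (\<integral>\<^sup>+y. ennreal (exp (\<kappa> * y)) * indicator {..a} y \<partial>lborel)"
    using \<phi> by (intro nn_integral_mono) (auto simp: indicator_def ennreal_mult[symmetric] less_imp_le mult_left_le_one_le)
  also have "\<dots> = (\<integral>\<^sup>+u. ennreal (exp (\<kappa> * (0 - u))) * indicator {..a} (0 - u) \<partial>lborel)"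
    by (rule nn_integral_reflect_translate) measurable
  also have "\<dots> = (\<integral>\<^sup>+u. ennreal (exp (- \<kappa> * u)) * indicator {- a ..} u \<partial>lborel)"
    by (intro nn_integral_cong) (auto simp: indicator_def)
  also have "\<dots> = ennreal (0 - (- exp (- \<kappa> * (- a)) / \<kappa>))"
  proof (rule nn_integral_FTC_atLeast)
    show "((\<lambda>u. - exp (- \<kappa> * u) / \<kappa>) has_real_derivative exp (- \<kappa> * x)) (at x)" for x
      using \<kappa> by (auto intro!: derivative_eq_intros)
    show "((\<lambda>u. - exp (- \<kappa> * u) / \<kappa>) \<longlongrightarrow> 0) at_top"
      using \<kappa> by real_asymp
  qed auto
  finally show "(\<integral>\<^sup>+y. (ennreal (\<phi> y) * indicator {..a} y) * ennreal (exp (\<kappa> * y)) \<partial>lborel) < \<infinity>"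
    by (simp add: order_le_less_trans)
  have "(\<integral>\<^sup>+y. (ennreal (\<phi> y) * indicator {..a} y) * ennreal (exp (\<kappa> * y)) \<partial>lborel) \<noteq> 0"
  proof
    assume "(\<integral>\<^sup>+y. (ennreal (\<phi> y) * indicator {..a} y) * ennreal (exp (\<kappa> * y)) \<partial>lborel) = 0"
    then have "AE y in lborel. (ennreal (\<phi> y) * indicator {..a} y) * ennreal (exp (\<kappa> * y)) = 0"
      by (subst (asm) nn_integral_0_iff_AE) auto
    then have "AE y in lborel. y \<notin> {a - 1..a}"
    proof eventually_elim
      case (elim y)
      then show ?case using \<phi>(1)[of y] by (auto simp: indicator_def ennreal_eq_0_iff split: if_splits)
    qed
    then have "emeasure lborel {a - 1..a} = 0"
      by (subst (asm) AE_iff_measurable[of "{a - 1..a}"]) auto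
    then show False by simp
  qed
  then show "0 < (\<integral>\<^sup>+y. (ennreal (\<phi> y) * indicator {..a} y) * ennreal (exp (\<kappa> * y)) \<partial>lborel)"
    by (simp add: zero_less_iff_neq_zero)
qed


section \<open>The volume of tubes as a function of the slope\<close>

text \<open>
  The integral of a function on projective space, given by its lift to nonzero vectors, with respect
  to the Fubini--Study volume.
\<close>

definition chart_integral :: "(complex^'n::finite \<Rightarrow> ennreal) \<Rightarrow> ennreal" where
  "chart_integral H = (\<Sum>i\<in>UNIV. \<integral>\<^sup>+w. H (chart_lift i w) *
      ennreal ((cmod (chart_lift i w $ i) / norm (chart_lift i w))\<^sup>2 * fs_density i w) \<partial>Pi\<^sub>M (- {i}) (\<lambda>_. lborel))"

lemma fs_volume_eq_chart_integral: "fs_volume A = chart_integral (\<lambda>z. indicator A (proj z))"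
  by (simp add: fs_volume_def chart_integral_def)

lemma chart_integral_mono:
  fixes H H' :: "complex^'n::finite \<Rightarrow> ennreal"
  assumes "\<And>z. z \<noteq> 0 \<Longrightarrow> H z \<le> H' z"
  shows "chart_integral H \<le> chart_integral H'"
proof -
  have "chart_lift i w \<noteq> 0" for i :: 'n and w
  proof
    assume "chart_lift i w = 0"
    then have "chart_lift i w $ i = 0" by simp
    then show False by (simp add: chart_lift_def)
  qed
  then show ?thesis
    unfolding chart_integral_def using assms by (intro sum_mono nn_integral_mono mult_right_mono) auto
qed

lemma fs_volume_mono: "A \<subseteq> B \<Longrightarrow> fs_volume A \<le> fs_volume B"
  unfolding fs_volume_eq_chart_integral by (intro chart_integral_mono) (auto simp: indicator_def)

text \<open>
  The factor \<open>(radial z / norm z) ^ (2 * N)\<close> as a function of the logarithm of the slope of \<open>z\<close>.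
\<close>

definition cone_weight :: "nat \<Rightarrow> real \<Rightarrow> real" where
  "cone_weight N x = (1 / (1 + (exp x)\<^sup>2)) ^ N"

lemma measurable_cone_weight[measurable]: "cone_weight N \<in> borel_measurable borel"
  unfolding cone_weight_def[abs_def] by measurable

lemma cone_weight_bounds: "0 < cone_weight N x" "cone_weight N x \<le> 1"
proof -
  have "0 < 1 + (exp x)\<^sup>2" by (simp add: add_pos_nonneg)
  then show "0 < cone_weight N x" "cone_weight N x \<le> 1"
    unfolding cone_weight_def by (auto intro!: zero_less_power power_le_one simp: divide_le_eq_1)
qed

context complex_cone
begin

definition log_slope :: "complex^'n \<Rightarrow> real" where
  "log_slope z = ln (infdist z C / radial z)"

lemma measurable_log_slope[measurable]: "log_slope \<in> borel_measurable borel"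
proof -
  have "(\<lambda>z. ln (infdist z C / radial z)) \<in> borel_measurable borel" by measurable
  then show ?thesis unfolding log_slope_def[abs_def] .
qed

lemma measurable_indicator_shell: "(\<lambda>z. indicator (shell UNIV) z :: ennreal) \<in> borel_measurable borel"
  using measurable_shell[of UNIV] by simp

lemma integral_shell:
  assumes "A \<in> sets borel"
  shows "(\<integral>\<^sup>+z. indicator (shell UNIV) z * indicator A (log_slope z) \<partial>lborel) = emeasure lborel (shell A)"
proof -
  have "indicator (shell UNIV) z * indicator A (log_slope z) = (indicator (shell A) z :: ennreal)" for z
    by (auto simp: indicator_def shell_def log_slope_def)
  then show ?thesis using measurable_shell[OF assms] by simp
qed

lemma integral_shell_shift:
  assumes "A \<in> sets borel"
  shows "(\<integral>\<^sup>+z. indicator (shell UNIV) z * indicator A (log_slope z - u) \<partial>lborel) = emeasure lborel (shell ((\<lambda>a. a + u) ` A))"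
    and "(\<lambda>a. a + u) ` A \<in> sets borel"
proof -
  have eq: "(\<lambda>a. a + u) ` A = (\<lambda>a. a - u) -` A \<inter> space borel" by (auto simp: image_iff) (metis diff_add_cancel)
  also have "\<dots> \<in> sets borel" using assms by measurable
  finally show m: "(\<lambda>a. a + u) ` A \<in> sets borel" .
  have "indicator A (log_slope z - u) = (indicator ((\<lambda>a. a + u) ` A) (log_slope z) :: ennreal)" for z
    unfolding eq by (simp add: indicator_def)
  then show "(\<integral>\<^sup>+z. indicator (shell UNIV) z * indicator A (log_slope z - u) \<partial>lborel) = emeasure lborel (shell ((\<lambda>a. a + u) ` A))"
    using integral_shell[OF m] by simp
qed

lemma shell_shift_le:
  assumes contact: "\<And>x. x \<in> C \<Longrightarrow> x \<noteq> 0 \<Longrightarrow> complex_quadratic_contact ((*s) \<i>) d C x"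
    and u: "0 < u" and A: "A \<in> sets borel"
  shows "(\<integral>\<^sup>+z. indicator (shell UNIV) z * indicator A (log_slope z - u) \<partial>lborel)
    \<le> ennreal (exp (real d * u)) * (\<integral>\<^sup>+z. indicator (shell UNIV) z * indicator A (log_slope z) \<partial>lborel)"
proof -
  have "emeasure lborel (shell ((\<lambda>a. a + u) ` A))
      \<le> ennreal ((1 / exp (- u)) ^ d) * emeasure lborel (shell ((\<lambda>a. a + ln (exp (- u))) ` (\<lambda>a. a + u) ` A))"
    using u by (intro shell_contraction contact integral_shell_shift(2)[OF A]) auto
  also have "(1 / exp (- u)) ^ d = exp (real d * u)" by (simp add: exp_minus inverse_eq_divide exp_of_nat_mult)
  also have "(\<lambda>a. a + ln (exp (- u))) ` (\<lambda>a. a + u) ` A = A" by (simp add: image_image)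
  finally show ?thesis unfolding integral_shell_shift(1)[OF A] integral_shell[OF A] .
qed

text \<open>
  For a linear subspace, scaling the normal component is a linear map with eigenvalues \<open>1\<close> and \<open>l\<close>, so
  that here the contraction estimate becomes an equality of the opposite kind: the shells shrink at
  least as fast as the codimension predicts.
\<close>

lemma subspace_shell_shift_ge:
  assumes C: "subspace C" and d: "d + dim C \<le> DIM(complex^'n)"
    and u: "0 < u" and A: "A \<in> sets borel"
  shows "ennreal (exp (real d * u)) * (\<integral>\<^sup>+z. indicator (shell UNIV) z * indicator A (log_slope z) \<partial>lborel)
    \<le> (\<integral>\<^sup>+z. indicator (shell UNIV) z * indicator A (log_slope z - u) \<partial>lborel)"
proof -
  define l where "l = exp (- u)"
  have l: "0 < l" "l < 1" using u by (auto simp: l_def)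
  obtain B where B: "onb B C" using onb_exists[OF C] .
  obtain B' where B': "onb B' (C\<^sup>\<bottom>)" using onb_exists[OF subspace_orthogonal_comp] .
  note BB = onb_union[OF B C B']
  have fin: "finite B" "finite B'" using B B' onb_finite by auto
  define P where "P z = (\<Sum>b\<in>B. (z \<bullet> b) *\<^sub>R b)" for z
  have linP: "linear P"
    unfolding P_def by (rule linearI) (simp_all add: inner_add_left scaleR_add_left sum.distrib scaleR_sum_right)
  have PC: "P z \<in> C" for z
    unfolding P_def using onb_subset[OF B] by (intro subspace_sum[OF C] subspace_scale[OF C]) auto
  have Pid: "P a = a" if "a \<in> C" for a unfolding P_def by (rule onb_expand[OF B that])
  have orth: "(z - P z) \<bullet> y = 0" if y: "y \<in> C" for z y
  proof -
    have "P z \<bullet> y = (\<Sum>b\<in>B. (z \<bullet> b) * (y \<bullet> b))" by (simp add: P_def inner_sum_left inner_commute[of y])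
    also have "\<dots> = z \<bullet> P y" by (simp add: P_def inner_sum_right mult.commute)
    finally show ?thesis using Pid[OF y] by (simp add: inner_diff_left)
  qed
  have dist_P: "norm (z - P z) = infdist z C" for z
  proof (rule antisym)
    obtain x where x: "x \<in> C" "norm (z - x) = infdist z C" by (rule nearest_exists)
    have "(norm ((z - P z) + (P z - x)))\<^sup>2 = (norm (z - P z))\<^sup>2 + (norm (P z - x))\<^sup>2"
      using orth[OF subspace_diff[OF C PC x(1)]] by (intro norm_add_Pythagorean) (simp add: orthogonal_def)
    then have "(norm (z - P z))\<^sup>2 \<le> (norm (z - x))\<^sup>2" by simp
    then have "norm (z - P z) \<le> norm (z - x)" by (rule power2_le_imp_le) simp
    then show "norm (z - P z) \<le> infdist z C" using x(2) by simp
  qed (rule infdist_le_diff[OF PC])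
  have rad_P: "radial z = norm (P z)" for z by (rule radial_eq_norm_nearest[OF PC dist_P])
  \<comment> \<open>Scaling the normal component by c, linear because the nearest point is the projection.\<close>
  define D where "D c z = P z + c *\<^sub>R (z - P z)" for c z
  have linD: "linear (D c)" for c
    unfolding D_def by (rule linearI) (simp_all add: linear_add[OF linP] linear_cmul[OF linP] algebra_simps)
  have PD: "P (D c z) = P z" for c z
  proof -
    have "P (z - P z) = 0" by (simp add: linear_diff[OF linP] Pid[OF PC])
    then show ?thesis by (simp add: D_def linear_add[OF linP] linear_cmul[OF linP] Pid[OF PC])
  qed
  have DD: "D c (D c' z) = D (c * c') z" for c c' z
    unfolding D_def[of c "D c' z"] PD by (simp add: D_def)
  have D1: "D 1 z = z" for z by (simp add: D_def)
  have DB: "D c b = (if b \<in> B then 1 else c) *\<^sub>R b" if "b \<in> B \<union> B'" for b c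
  proof (cases "b \<in> B")
    case True
    then show ?thesis using Pid[OF onb_subset[OF B True]] by (simp add: D_def)
  next
    case False
    then have "b \<in> C\<^sup>\<bottom>" using that onb_subset[OF B'] by auto
    then have "b \<bullet> c = 0" if "c \<in> B" for c
      using onb_subset[OF B that] by (auto simp: orthogonal_comp_def orthogonal_def inner_commute)
    then have "P b = 0" by (simp add: P_def)
    then show ?thesis using False by (simp add: D_def)
  qed
  let ?A = "(\<lambda>a. a + u) ` A"
  have "emeasure lborel (shell A) \<le> ennreal (l ^ d) * emeasure lborel (shell ?A)"
  proof (rule emeasure_le_by_compact)
    show "shell A \<in> sets borel" using A by (rule measurable_shell)
    fix K assume K: "compact K" "K \<subseteq> shell A"
    define K' where "K' = D (1 / l) ` K"
    have "compact K'"
      unfolding K'_def using K(1) linD by (intro compact_continuous_image linear_continuous_on) (simp add: linear_conv_bounded_linear)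
    have "D l ` K' = K" using l by (simp add: K'_def image_image DD D1)
    moreover have "emeasure lborel (D l ` K') \<le> ennreal (l ^ d) * emeasure lborel K'"
    proof (rule emeasure_image_le_eigenvalue_bound[where 'm = "'n bit0" and f' = "\<lambda>_. D l"])
      show "DIM(complex^'n) = CARD('n bit0)" by simp
      show "(D l has_derivative D l) (at x within K')" for x
        using linD by (intro bounded_linear_imp_has_derivative) (simp add: linear_conv_bounded_linear)
      have "card B' + dim C = DIM(complex^'n)"
        using onb_card[OF BB(1)] card_Un_disjoint[OF fin BB(2)] onb_card[OF B] by simp
      then have "l ^ card B' \<le> l ^ d" using d l by (intro power_decreasing) auto
      moreover have "(\<Prod>b\<in>B \<union> B'. if b \<in> B then 1 else l) = l ^ card B'"
      proof -
        have "(\<Prod>b\<in>B \<union> B'. if b \<in> B then 1 else l) = (\<Prod>b\<in>B. if b \<in> B then 1 else l) * (\<Prod>b\<in>B'. if b \<in> B then 1 else l)"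
          by (rule prod.union_disjoint[OF fin BB(2)])
        also have "(\<Prod>b\<in>B'. if b \<in> B then 1 else l) = (\<Prod>b\<in>B'. l)"
          using BB(2) by (intro prod.cong) auto
        finally show ?thesis by simp
      qed
      ultimately have "\<bar>\<Prod>b\<in>B \<union> B'. if b \<in> B then 1 else l\<bar> \<le> l ^ d" using l by simp
      then show "\<exists>B e. onb B UNIV \<and> (\<forall>b\<in>B. D l b = e b *\<^sub>R b) \<and> \<bar>\<Prod>b\<in>B. e b\<bar> \<le> l ^ d"
        using BB(1) DB[of _ l] by (intro exI[of _ "B \<union> B'"] exI[of _ "\<lambda>b. if b \<in> B then 1 else l"]) auto
    qed (use l \<open>compact K'\<close> in auto)
    moreover have "K' \<subseteq> shell ?A"
    proof
      fix y assume "y \<in> K'"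
      then obtain z where z: "z \<in> K" "y = D (1 / l) z" by (auto simp: K'_def)
      have zs: "z \<in> shell A" using z K by blast
      have r: "radial y = radial z" by (simp add: rad_P z PD)
      have "y - P y = (1 / l) *\<^sub>R (z - P z)" unfolding z(2) PD by (simp add: D_def)
      then have i: "infdist y C = infdist z C / l" using l by (simp add: dist_P[symmetric])
      have "ln (infdist z C / l / radial z) = ln (infdist z C / radial z) + u"
      proof -
        have p: "0 < infdist z C / radial z" using zs by (simp add: shell_def)
        have "infdist z C / l / radial z = (infdist z C / radial z) * exp u"
          by (simp add: l_def exp_minus field_simps)
        then show ?thesis using p by (simp only: ln_mult_pos exp_gt_zero ln_exp)
      qed
      then show "y \<in> shell ?A" using zs l by (auto simp: shell_def r i)
    qed
    then have "emeasure lborel K' \<le> emeasure lborel (shell ?A)"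
      using measurable_shell[OF integral_shell_shift(2)[OF A]] by (intro emeasure_mono) auto
    ultimately show "emeasure lborel K \<le> ennreal (l ^ d) * emeasure lborel (shell ?A)"
      using mult_left_mono[of "emeasure lborel K'" "emeasure lborel (shell ?A)" "ennreal (l ^ d)"]
      by (metis order_trans zero_le)
  qed
  from mult_left_mono[OF this, of "ennreal (exp (real d * u))"]
  have "ennreal (exp (real d * u)) * emeasure lborel (shell A) \<le> (ennreal (exp (real d * u)) * ennreal (l ^ d)) * emeasure lborel (shell ?A)"
    by (simp add: mult.assoc)
  also have "ennreal (exp (real d * u)) * ennreal (l ^ d) = 1"
  proof -
    have "l ^ d = exp (- (real d * u))" by (simp add: l_def exp_of_nat_mult[symmetric])
    then show ?thesis by (simp add: ennreal_mult[symmetric] exp_add[symmetric])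
  qed
  finally show ?thesis unfolding integral_shell_shift(1)[OF A] integral_shell[OF A] by simp
qed

lemma cone_weight_eq:
  assumes "0 < radial z" "0 < infdist z C"
  shows "(radial z / norm z) ^ (2 * CARD('n)) = cone_weight CARD('n) (log_slope z)"
proof -
  have e: "exp (log_slope z) = infdist z C / radial z"
    using assms by (simp add: log_slope_def)
  have "(norm z)\<^sup>2 = (radial z)\<^sup>2 + (infdist z C)\<^sup>2" by (simp add: radial_sq)
  then have "(radial z / norm z)\<^sup>2 = 1 / (1 + (exp (log_slope z))\<^sup>2)"
    unfolding e using assms by (simp add: power_divide field_simps)
  then show ?thesis by (simp only: power_mult cone_weight_def)
qed

text \<open>
  The points of \<open>C\<close> have slope 0 and are counted separately, because the logarithm takes a default
  value there.
\<close>

definition core_mass :: ennreal where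
  "core_mass = emeasure lborel {z. 0 < radial z \<and> radial z \<le> 1 \<and> infdist z C = 0}"

definition slope_mass :: "real set \<Rightarrow> ennreal" where
  "slope_mass I = (\<integral>\<^sup>+z. indicator (shell UNIV) z * (ennreal (cone_weight CARD('n) (log_slope z)) * indicator I (log_slope z)) \<partial>lborel)"

text \<open>
  The cone formula with the radial part as gauge.
\<close>

lemma chart_integral_slope:
  assumes I[measurable]: "I \<in> sets borel"
  shows "fiber_constant (CARD('n) - 1) *
      chart_integral (indicator {z. 0 < radial z \<and> (infdist z C = 0 \<or> log_slope z \<in> I)}) = core_mass + slope_mass I"
proof -
  define H where "H = (indicator {z. 0 < radial z \<and> (infdist z C = 0 \<or> log_slope z \<in> I)} :: complex^'n \<Rightarrow> ennreal)"
  have "{z \<in> space borel. 0 < radial z \<and> (infdist z C = 0 \<or> log_slope z \<in> I)} \<in> sets borel" by measurable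
  then have mH: "H \<in> borel_measurable borel" unfolding H_def by simp
  have "fiber_constant (CARD('n) - 1) * chart_integral H =
      (\<integral>\<^sup>+z. H z * ennreal ((radial z / norm z) ^ (2 * CARD('n))) * indicator {z. radial z \<le> 1} z \<partial>lborel)"
    unfolding chart_integral_def
  proof (rule fs_volume_cone_formula[OF mH measurable_radial _ radial_smult, symmetric])
    fix \<zeta> :: complex and z :: "complex^'n" assume "\<zeta> \<noteq> 0"
    then show "H (\<zeta> *s z) = H z"
      by (simp add: H_def indicator_def radial_smult infdist_smult log_slope_def zero_less_mult_iff)
  next
    fix z :: "complex^'n" assume "radial z \<le> 0"
    then show "H z = 0" by (simp add: H_def)
  qed
  also have "\<dots> = (\<integral>\<^sup>+z. indicator {z. 0 < radial z \<and> radial z \<le> 1 \<and> infdist z C = 0} z +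
      indicator (shell UNIV) z * (ennreal (cone_weight CARD('n) (log_slope z)) * indicator I (log_slope z)) \<partial>lborel)"
  proof (rule nn_integral_cong)
    fix z
    show "H z * ennreal ((radial z / norm z) ^ (2 * CARD('n))) * indicator {z. radial z \<le> 1} z =
      indicator {z. 0 < radial z \<and> radial z \<le> 1 \<and> infdist z C = 0} z +
      indicator (shell UNIV) z * (ennreal (cone_weight CARD('n) (log_slope z)) * indicator I (log_slope z))"
    proof (cases "0 < radial z \<and> radial z \<le> 1")
      case True
      show ?thesis
      proof (cases "infdist z C = 0")
        case inf0: True
        have "radial z = norm z" using inf0 by (simp add: radial_def)
        then show ?thesis using True inf0 by (simp add: H_def shell_def)
      next
        case False
        then have "0 < infdist z C" using infdist_nonneg[of z C] by simp
        then show ?thesis using True cone_weight_eq[of z] by (simp add: H_def shell_def indicator_def)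
      qed
    next
      case False
      then show ?thesis by (auto simp: H_def shell_def indicator_def)
    qed
  qed
  also have "\<dots> = core_mass + slope_mass I"
  proof -
    have m: "{z \<in> space borel. 0 < radial z \<and> radial z \<le> 1 \<and> infdist z C = 0} \<in> sets borel" by measurable
    note [measurable] = measurable_indicator_shell
    have m2: "(\<lambda>z. indicator (shell UNIV) z * (ennreal (cone_weight CARD('n) (log_slope z)) * indicator I (log_slope z))) \<in> borel_measurable borel"
      by measurable
    show ?thesis
      using m m2 by (simp add: nn_integral_add core_mass_def slope_mass_def)
  qed
  finally show ?thesis by (simp add: H_def)
qed

text \<open>
  The region of positive radial part is almost everything; the cone formula with the norm as gauge
  computes the same integral as the volume of the unit ball.
\<close>

lemma total_mass:
  assumes C: "C \<noteq> {0}"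
  shows "core_mass + slope_mass {..a} + slope_mass {a<..} = emeasure lborel (cball (0 :: complex^'n) 1)"
proof -
  note [measurable] = measurable_indicator_shell
  have split: "slope_mass UNIV = slope_mass {..a} + slope_mass {a<..}"
  proof -
    have "slope_mass {..a} + slope_mass {a<..} =
      (\<integral>\<^sup>+z. indicator (shell UNIV) z * (ennreal (cone_weight CARD('n) (log_slope z)) * indicator {..a} (log_slope z)) +
        indicator (shell UNIV) z * (ennreal (cone_weight CARD('n) (log_slope z)) * indicator {a<..} (log_slope z)) \<partial>lborel)"
      unfolding slope_mass_def by (rule nn_integral_add[symmetric]) measurable
    also have "\<dots> = slope_mass UNIV"
      unfolding slope_mass_def by (intro nn_integral_cong) (auto simp: indicator_def)
    finally show ?thesis ..
  qed
  define H where "H = (indicator {z. 0 < radial z} :: complex^'n \<Rightarrow> ennreal)"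
  have mR: "{z. 0 < radial z} \<in> sets borel"
  proof -
    have "{z \<in> space borel. 0 < radial z} \<in> sets borel" by measurable
    then show ?thesis by simp
  qed
  have "core_mass + slope_mass UNIV = fiber_constant (CARD('n) - 1) * chart_integral H"
    using chart_integral_slope[of UNIV] by (simp add: H_def)
  also have "\<dots> = (\<integral>\<^sup>+z. H z * ennreal ((norm z / norm z) ^ (2 * CARD('n))) * indicator {z. norm z \<le> 1} z \<partial>lborel)"
    unfolding chart_integral_def
  proof (rule fs_volume_cone_formula[OF _ _ _ norm_vec_smult, symmetric])
    show "H \<in> borel_measurable borel" unfolding H_def using mR by simp
    show "(norm :: complex^'n \<Rightarrow> real) \<in> borel_measurable borel"
      by (rule borel_measurable_continuous_onI[OF continuous_on_norm[OF continuous_on_id]])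
    show "H (\<zeta> *s z) = H z" if "\<zeta> \<noteq> 0" for \<zeta> z
      using that by (simp add: H_def indicator_def radial_smult zero_less_mult_iff)
    show "H z = 0" if "norm z \<le> 0" for z
    proof -
      have "z = 0" using that by simp
      then have "radial z = 0" using radial_smult[of 0 0] by simp
      then show ?thesis by (simp add: H_def)
    qed
  qed
  also have "\<dots> = (\<integral>\<^sup>+z. indicator (cball (0 :: complex^'n) 1) z \<partial>lborel)"
  proof (rule nn_integral_cong_AE)
    have "AE z in lborel. z \<notin> {z. radial z = 0}"
      using radial_zero_negligible[OF C] by (rule AE_not_in)
    then show "AE z in lborel. H z * ennreal ((norm z / norm z) ^ (2 * CARD('n))) * indicator {z. norm z \<le> 1} z = indicator (cball 0 1) z"
    proof eventually_elim
      case (elim z)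
      then have r: "0 < radial z" using radial_nonneg[of z] by simp
      then have "z \<noteq> 0" using radial_smult[of 0 0] by auto
      then show ?case using r by (simp add: H_def indicator_def)
    qed
  qed
  also have "\<dots> = emeasure lborel (cball (0 :: complex^'n) 1)" by simp
  finally show ?thesis by (simp add: split add.assoc)
qed

lemma slope_le_iff:
  assumes t: "0 < t" "t < pi / 2" and z: "z \<noteq> 0"
  shows "infdist z C \<le> sin t * norm z \<longleftrightarrow> 0 < radial z \<and> (infdist z C = 0 \<or> log_slope z \<le> ln (tan t))"
proof -
  have s: "0 < sin t" using t by (intro sin_gt_zero) auto
  have c: "0 < cos t" using t by (intro cos_gt_zero) auto
  have tan: "0 < tan t" using s c by (simp add: tan_def)
  have i0: "0 \<le> infdist z C" by (rule infdist_nonneg)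
  have "infdist z C \<le> sin t * norm z \<longleftrightarrow> (infdist z C)\<^sup>2 \<le> (sin t * norm z)\<^sup>2"
    using i0 s by (simp add: power_mono_iff)
  also have "\<dots> \<longleftrightarrow> (infdist z C)\<^sup>2 \<le> (sin t)\<^sup>2 * ((radial z)\<^sup>2 + (infdist z C)\<^sup>2)"
    by (simp add: radial_sq power_mult_distrib)
  also have "\<dots> \<longleftrightarrow> (infdist z C)\<^sup>2 * (cos t)\<^sup>2 \<le> (sin t)\<^sup>2 * (radial z)\<^sup>2"
    by (simp add: cos_squared_eq algebra_simps)
  also have "\<dots> \<longleftrightarrow> (infdist z C * cos t)\<^sup>2 \<le> (sin t * radial z)\<^sup>2"
    by (simp add: power_mult_distrib)
  also have "\<dots> \<longleftrightarrow> infdist z C * cos t \<le> sin t * radial z"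
    using i0 c s radial_nonneg[of z] by (intro power_mono_iff) auto
  also have "\<dots> \<longleftrightarrow> infdist z C \<le> tan t * radial z"
    using c by (simp add: tan_def field_simps)
  finally have 1: "infdist z C \<le> sin t * norm z \<longleftrightarrow> infdist z C \<le> tan t * radial z" .
  show ?thesis
  proof (cases "0 < radial z")
    case False
    then have r: "radial z = 0" using radial_nonneg[of z] by simp
    then have "(infdist z C)\<^sup>2 = (norm z)\<^sup>2" using radial_sq[of z] by simp
    then have "infdist z C > 0" using z i0 by (metis less_eq_real_def norm_eq_zero power_eq_0_iff zero_power2)
    then show ?thesis using 1 r by simp
  next
    case r: True
    show ?thesis
    proof (cases "infdist z C = 0")
      case True
      then show ?thesis using 1 r tan by simp
    next
      case False
      then have i: "0 < infdist z C" using i0 by simp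
      then have "log_slope z \<le> ln (tan t) \<longleftrightarrow> infdist z C / radial z \<le> tan t"
        using r tan by (simp add: log_slope_def)
      also have "\<dots> \<longleftrightarrow> infdist z C \<le> tan t * radial z" using r by (simp add: pos_divide_le_eq)
      finally show ?thesis using 1 r False by simp
    qed
  qed
qed

lemma tube_mass:
  assumes t: "0 < t" "t < pi / 2"
  shows "fiber_constant (CARD('n) - 1) * chart_integral (indicator {z. z \<noteq> 0 \<and> infdist z C \<le> sin t * norm z})
    = core_mass + slope_mass {..ln (tan t)}"
proof -
  have "{z. z \<noteq> 0 \<and> infdist z C \<le> sin t * norm z} = {z. 0 < radial z \<and> (infdist z C = 0 \<or> log_slope z \<in> {..ln (tan t)})}"
  proof (intro set_eqI)
    fix z
    have "radial 0 = 0" using radial_smult[of 0 0] by simp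
    then show "(z \<in> {z. z \<noteq> 0 \<and> infdist z C \<le> sin t * norm z}) = (z \<in> {z. 0 < radial z \<and> (infdist z C = 0 \<or> log_slope z \<in> {..ln (tan t)})})"
      using slope_le_iff[OF t, of z] by (cases "z = 0") auto
  qed
  then show ?thesis using chart_integral_slope[of "{..ln (tan t)}"] by simp
qed

end


section \<open>Comparison with a linear subspace\<close>

lemma affine_cone_projectivization:
  fixes L :: "(complex^'n::finite) set"
  assumes L: "vec.subspace L"
  shows "affine_cone (projectivization L) = L"
proof (intro set_eqI)
  fix z
  show "z \<in> affine_cone (projectivization L) \<longleftrightarrow> z \<in> L"
  proof (cases "z = 0")
    case True
    then show ?thesis using vec.subspace_0[OF L] by (simp add: affine_cone_def)
  next
    case False
    have "range (\<lambda>c. c *s z) \<subseteq> L \<longleftrightarrow> z \<in> L"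
    proof
      assume "range (\<lambda>c. c *s z) \<subseteq> L"
      then have "1 *s z \<in> L" by blast
      then show "z \<in> L" by simp
    qed (auto intro: vec.subspace_scale[OF L])
    then show ?thesis
      using False by (simp add: mem_affine_cone projectivization_def line_of_proj)
  qed
qed

lemma real_subspace_of_complex:
  fixes L :: "(complex^'n) set"
  assumes L: "vec.subspace L"
  shows "subspace L"
  unfolding subspace_def scaleR_eq_smult
  using vec.subspace_0[OF L] vec.subspace_add[OF L] vec.subspace_scale[OF L] by blast

lemma real_dim_le:
  fixes L :: "(complex^'n::finite) set"
  shows "dim L \<le> 2 * vec.dim L"
proof -
  obtain B where B: "B \<subseteq> L" "vec.independent B" "L \<subseteq> vec.span B" "card B = vec.dim L"
    using vec.basis_exists by blast
  have fB: "finite B" using B(2) by (rule vec.finiteI_independent)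
  define G where "G = B \<union> (\<lambda>v. \<i> *s v) ` B"
  have i_span: "\<i> *s x \<in> span G" if x: "x \<in> span G" for x
  proof -
    have "(*s) \<i> ` span G = span ((*s) \<i> ` G)"
      by (rule linear_span_image[OF linear_smult_i, symmetric])
    also have "\<dots> \<subseteq> span G"
    proof (rule span_minimal)
      show "(*s) \<i> ` G \<subseteq> span G"
      proof safe
        fix g assume "g \<in> G"
        then consider "g \<in> B" | b where "b \<in> B" "g = \<i> *s b" by (auto simp: G_def)
        then show "\<i> *s g \<in> span G"
        proof cases
          case 1
          then show ?thesis by (intro span_base) (simp add: G_def)
        next
          case 2
          have "\<i> *s g = - b" by (simp add: 2 vector_smult_assoc vec_eq_iff)
          moreover have "b \<in> span G" using 2 by (intro span_base) (simp add: G_def)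
          ultimately show ?thesis by (simp add: span_neg)
        qed
      qed
    qed (rule subspace_span)
    finally show ?thesis using x by blast
  qed
  have "vec.subspace (span G)"
  proof (rule vec.subspaceI)
    show "c *s x \<in> span G" if "x \<in> span G" for c x
    proof -
      have "c *s x = Re c *\<^sub>R x + Im c *\<^sub>R (\<i> *s x)"
        by (simp add: vec_eq_iff scaleR_conv_of_real[where 'a=complex] complex_eq_iff)
      then show ?thesis using that i_span[OF that] by (simp only: span_add span_scale)
    qed
  qed (simp_all add: span_zero span_add)
  moreover have "B \<subseteq> span G" by (auto simp: G_def intro: span_base)
  ultimately have "vec.span B \<subseteq> span G" by (intro vec.span_minimal)
  then have "L \<subseteq> span G" using B(3) by blast
  then have "dim L \<le> card G" using fB by (intro dim_le_card) (simp_all add: G_def)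
  also have "\<dots> \<le> card B + card ((\<lambda>v. \<i> *s v) ` B)" unfolding G_def by (rule card_Un_le)
  also have "card ((\<lambda>v. \<i> *s v) ` B) \<le> card B" using fB by (rule card_image_le)
  finally show ?thesis using B(4) by simp
qed

lemma complex_cone_affine_cone:
  "closed Y \<Longrightarrow> complex_cone (affine_cone Y)"
  by unfold_locales (auto intro: closed_affine_cone zero_in_affine_cone affine_cone_smult)

text \<open>
  In full dimension all directions are tangent to the cone, so a nonzero nearest point of \<open>z\<close> is \<open>z\<close>
  itself.  The complement of the cone is therefore contained in a null set, and it is open.
\<close>

lemma full_dimension_imp_UNIV:
  fixes X :: "'n::finite cproj set"
  assumes X: "closed X" "complex_submanifold k X" "X \<noteq> {}" and k: "CARD('n) = k + 1"
  shows "X = UNIV"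
proof -
  interpret complex_cone "affine_cone X" by (rule complex_cone_affine_cone[OF X(1)])
  obtain p where "p \<in> X" using X by blast
  then obtain x0 where x0: "x0 \<noteq> 0" "x0 \<in> affine_cone X" using proj_surj[of p] by (metis mem_affine_cone)
  then have C0: "affine_cone X \<noteq> {0}" by blast
  have "- affine_cone X \<subseteq> {z. radial z = 0}"
  proof
    fix z assume z: "z \<in> - affine_cone X"
    show "z \<in> {z. radial z = 0}"
    proof (rule ccontr)
      assume "z \<notin> {z. radial z = 0}"
      then have r: "radial z \<noteq> 0" by simp
      obtain x where x: "x \<in> affine_cone X" "norm (z - x) = infdist z (affine_cone X)" by (rule nearest_exists)
      then have x0: "x \<noteq> 0" using r radial_eq_norm_nearest[OF x] by auto
      then have "complex_quadratic_contact ((*s) \<i>) (2 * (CARD('n) - (k + 1))) (affine_cone X) x"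
        using x by (intro submanifold_cone_contact[OF X(2)]) (auto simp: mem_affine_cone)
      then obtain W \<Gamma> where W: "quadratic_contact (affine_cone X) x W \<Gamma>" "DIM(complex^'n) \<le> dim W"
        unfolding complex_quadratic_contact_def k by auto
      have "subspace W" using W(1) unfolding quadratic_contact_def by simp
      then have "W = UNIV"
        using W(2) by (intro subspace_dim_equal) (auto simp: dim_UNIV)
      moreover have "norm (z - x) \<le> norm (x + (z - x) - y)" if "y \<in> affine_cone X" for y
        using infdist_le_diff[OF that, of z] x(2) by simp
      ultimately have "(z - x) \<bullet> (z - x) = 0"
        using nearest_point_first_second_order(1)[OF W(1)] by blast
      then have "z = x" by simp
      then show False using x z by simp
    qed
  qed
  moreover have "negligible {z. radial z = 0}"
    using radial_zero_negligible[OF C0] by (simp add: negligible_iff_null_sets null_sets_completionI)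
  ultimately have "negligible (- affine_cone X)" by (rule negligible_subset[rotated])
  moreover have "open (- affine_cone X)" using closed_affine_cone[OF X(1)] by (simp add: open_Compl)
  ultimately have "- affine_cone X = {}" using open_not_negligible by blast
  then have all: "z \<in> affine_cone X" for z by blast
  have "p \<in> X" for p
  proof -
    obtain z where "z \<noteq> 0" "p = proj z" using proj_surj .
    then show ?thesis using all[of z] by (simp add: mem_affine_cone)
  qed
  then show ?thesis by blast
qed

lemma fs_neighborhood_UNIV:
  assumes "0 < t"
  shows "fs_neighborhood UNIV t = (UNIV :: 'n::finite cproj set)"
proof -
  have "q \<in> fs_neighborhood UNIV t" for q :: "'n cproj"
  proof -
    obtain z where z: "z \<noteq> 0" "q = proj z" using proj_surj .
    have "cos_angle z z = 1" using z by (simp add: cos_angle_def hermitian_self power2_eq_square norm_mult)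
    then have "fs_dist q q \<le> 0" using fs_dist_le_arccos[OF z(1,1)] z by simp
    then show ?thesis using assms by (intro fs_neighborhoodI[of q]) auto
  qed
  then show ?thesis by blast
qed

text \<open>
  If \<open>X\<close> had less mass than \<open>L\<close> below the threshold, the density comparison would give it at most as much
  above, contradicting the equal totals.
\<close>

lemma mass_comparison:
  fixes aX fX gX fL gL p q B :: ennreal
  assumes X: "aX + fX + gX = B" and L: "fL + gL = B" and B: "B < \<infinity>" and p: "0 < p" "p < \<infinity>"
    and leX: "gX * p \<le> fX * q" and leL: "fL * q \<le> gL * p"
  shows "fL \<le> aX + fX"
proof (rule ccontr)
  assume "\<not> fL \<le> aX + fX"
  then have less: "aX + fX < fL" by simp
  have fin: "aX < \<infinity>" "fX < \<infinity>" "gX < \<infinity>" "fL < \<infinity>" "gL < \<infinity>"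
    using X L B by (auto simp: less_top[symmetric])
  have "fX \<le> fL" using less by (metis add.commute add_increasing2 less_imp_le order.trans order_refl zero_le)
  then have "gX * p \<le> gL * p"
    using leX leL mult_right_mono[of fX fL q] by (meson order_trans zero_le)
  then have "p * gX \<le> p * gL" by (simp add: mult.commute)
  then have "gX \<le> gL" using p by (subst (asm) ennreal_mult_le_mult_iff) auto
  then have "aX + fX + gX \<le> aX + fX + gL" by (rule add_left_mono)
  also have "\<dots> < fL + gL"
    using less fin by (simp add: add.commute[of _ gL] ennreal_add_left_cancel_less)
  finally show False using X L by simp
qed

theorem theorem5p3:
  fixes X :: "'n::finite cproj set" and L :: "(complex ^ 'n) set" and k :: nat and t :: real
  assumes "algebraic_submanifold k X" and "X \<noteq> {}"
    and "vec.subspace L" and "vec.dim L = k + 1"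
    and "t > 0"
  shows "fs_volume (fs_neighborhood X t) \<ge> fs_volume (fs_neighborhood (projectivization L) t)"
proof -
  have clX: "closed X" and subX: "complex_submanifold k X"
    using assms(1) by (auto simp: algebraic_submanifold_def)
  have kn: "k + 1 \<le> CARD('n)" using subX by (auto simp: complex_submanifold_def)
  \<comment> \<open>Beyond pi / 2 both neighbourhoods are everything, and in full dimension so is X; the
    remaining case has d > 0, which makes the exponential weights integrable.\<close>
  consider "pi / 2 \<le> t" | "CARD('n) = k + 1" | "t < pi / 2" "k + 1 < CARD('n)" using kn by linarith
  then show ?thesis
  proof cases
    case 1
    then show ?thesis using fs_neighborhood_large[OF assms(2)] by (simp add: fs_volume_mono)
  next
    case 2
    then have "fs_neighborhood X t = UNIV"
      using full_dimension_imp_UNIV[OF clX subX assms(2)] fs_neighborhood_UNIV[where 'n = 'n, OF assms(5)]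
      by simp
    then show ?thesis by (simp add: fs_volume_mono)
  next
    case 3
    note t = assms(5) 3(1)
    have subL: "subspace L" by (rule real_subspace_of_complex[OF assms(3)])
    have dimL: "dim L \<le> 2 * (k + 1)" using real_dim_le[of L] assms(4) by simp
    have coneL: "affine_cone (projectivization L) = L" by (rule affine_cone_projectivization[OF assms(3)])
    interpret X: complex_cone "affine_cone X" by (rule complex_cone_affine_cone[OF clX])
    interpret L: complex_cone L
      by unfold_locales
        (auto intro: closed_subspace[OF subL] vec.subspace_0[OF assms(3)] vec.subspace_scale[OF assms(3)])
    define d where "d = 2 * (CARD('n) - (k + 1))"
    have d: "0 < real d" "d + dim L \<le> DIM(complex^'n)" using 3 dimL by (auto simp: d_def)
    have X0: "affine_cone X \<noteq> {0}"
    proof -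
      obtain p where p: "p \<in> X" using assms(2) by blast
      obtain x where "x \<noteq> 0" "p = proj x" using proj_surj .
      then have "x \<in> affine_cone X" using p by (simp add: mem_affine_cone)
      then show ?thesis using \<open>x \<noteq> 0\<close> by blast
    qed
    have L0: "L \<noteq> {0}" using assms(4) vec.dim_eq_0[of L] by auto
    have contact: "complex_quadratic_contact ((*s) \<i>) d (affine_cone X) x" if "x \<in> affine_cone X" "x \<noteq> 0" for x
      unfolding d_def using that by (intro submanifold_cone_contact[OF subX]) (auto simp: mem_affine_cone)
    define a where "a = ln (tan t)"
    define f where "f y = ennreal (cone_weight CARD('n) y) * indicator {..a} y" for y
    define g where "g y = ennreal (cone_weight CARD('n) y) * indicator {a<..} y" for y
    have mf: "f \<in> borel_measurable borel" unfolding f_def by measurable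
    have mg: "g \<in> borel_measurable borel" unfolding g_def by measurable
    have supp: "\<And>x. a < x \<Longrightarrow> f x = 0" "\<And>x. x \<le> a \<Longrightarrow> g x = 0" by (auto simp: f_def g_def)
    define p where "p = (\<integral>\<^sup>+y. f y * ennreal (exp (real d * y)) \<partial>lborel)"
    define q where "q = (\<integral>\<^sup>+y. g y * ennreal (exp (real d * y)) \<partial>lborel)"
    have p: "0 < p" "p < \<infinity>"
      unfolding p_def f_def using weight_integral_finite_positive[OF d(1) measurable_cone_weight cone_weight_bounds] by auto
    have cmpX: "X.slope_mass {a<..} * p \<le> X.slope_mass {..a} * q"
      unfolding p_def q_def X.slope_mass_def f_def[symmetric] g_def[symmetric]
      by (rule shift_increasing_le[OF X.measurable_indicator_shell X.measurable_log_slope mf mg supp X.shell_shift_le[OF contact]])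
    have cmpL: "L.slope_mass {..a} * q \<le> L.slope_mass {a<..} * p"
      unfolding p_def q_def L.slope_mass_def f_def[symmetric] g_def[symmetric]
      by (rule shift_decreasing_le[OF L.measurable_indicator_shell L.measurable_log_slope mf mg supp L.subspace_shell_shift_ge[OF subL d(2)]])
    have coreL: "L.core_mass = 0"
    proof -
      have "negligible L" using dimL 3(2) by (intro negligible_lowdim) simp
      then have "L \<in> null_sets lborel"
        using closed_subspace[OF subL] by (simp add: negligible_iff_null_sets null_sets_def borel_closed)
      moreover have "{z. 0 < L.radial z \<and> L.radial z \<le> 1 \<and> infdist z L = 0} \<subseteq> L"
        using in_closed_iff_infdist_zero[OF L.closed_C] L.zero_C by blast
      ultimately show ?thesis
        unfolding L.core_mass_def by (meson emeasure_0_AE emeasure_eq_0 null_setsD1 null_setsD2)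
    qed
    let ?c = "fiber_constant (CARD('n) - 1)"
    let ?TX = "indicator {z. z \<noteq> 0 \<and> infdist z (affine_cone X) \<le> sin t * norm z} :: complex^'n \<Rightarrow> ennreal"
    let ?TL = "indicator {z. z \<noteq> 0 \<and> infdist z L \<le> sin t * norm z} :: complex^'n \<Rightarrow> ennreal"
    have "?c * chart_integral ?TL = L.slope_mass {..a}"
      using L.tube_mass[OF t] coreL by (simp add: a_def)
    also have "\<dots> \<le> X.core_mass + X.slope_mass {..a}"
    proof (rule mass_comparison[OF X.total_mass[OF X0, of a] _ _ p cmpX cmpL])
      show "L.slope_mass {..a} + L.slope_mass {a<..} = emeasure lborel (cball (0 :: complex^'n) 1)"
        using L.total_mass[OF L0, of a] coreL by simp
      show "emeasure lborel (cball (0 :: complex^'n) 1) < \<infinity>" by (rule emeasure_lborel_cball_finite)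
    qed
    also have "\<dots> = ?c * chart_integral ?TX"
      using X.tube_mass[OF t] by (simp add: a_def)
    finally have "chart_integral ?TL \<le> chart_integral ?TX"
      using fiber_constant_pos[of "CARD('n) - 1"] fiber_constant_finite[of "CARD('n) - 1"]
      by (subst (asm) ennreal_mult_le_mult_iff) auto
    moreover have "fs_volume (fs_neighborhood (projectivization L) t) \<le> chart_integral ?TL"
      unfolding fs_volume_eq_chart_integral
      using infdist_le_of_fs_neighborhood[OF t, of _ "projectivization L"]
      by (intro chart_integral_mono) (auto simp: coneL indicator_def)
    moreover have "chart_integral ?TX \<le> fs_volume (fs_neighborhood X t)"
      unfolding fs_volume_eq_chart_integral
      using fs_neighborhood_contains[OF clX t]
      by (intro chart_integral_mono) (auto simp: indicator_def)
    ultimately show ?thesis by (meson order_trans)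
  qed
qed

end
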